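(* Assume $Q$ is ergodic. Let $x\in\mathbb R_+^{\mathcal R}$ and $D\in\mathbb R^{\Lambda(x)}$. Then $$\lim_{\tau\to0}\lim_{\delta\to0}\lim_{\epsilon\to0}\liminf_{n\to\infty}\frac1{n\tau}\inf_{y\in\mathbb Z_+^{\mathcal R},\,|y-nx|<\epsilon n}\log\mathbb P\Big[\sup_{t\in[0,n\tau]}|Q(t,y)-nx-Dt|<\delta n\Big]$$ $$=\lim_{\tau\to0}\lim_{\delta\to0}\lim_{\epsilon\to0}\limsup_{n\to\infty}\frac1{n\tau}\sup_{y\in\mathbb Z_+^{\mathcal R},\,|y-nx|<\epsilon n}\log\mathbb P\Big[\sup_{t\in[0,n\tau]}|Q(t,y)-nx-Dt|<\delta n\Big]=-L(x,D),$$ where $$L(x,D)=\sum_{ij\in\Lambda(x)\cup\Lambda_1(x)} l\big(D_{ij}\,\|\,\lambda_{ij},\mu_{ij}(x)\big).$$ Moreover, if a face $\Lambda$ and a drift $D\in\mathbb R^\Lambda$ are fixed, the limit in $\tau$ is uniform with respect to $x$ in compact subsets of the face $\Lambda$.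
   Context: Star network: $\mathcal S=\{1,\dots,N\}$ is a set of channels with capacities $C_i>0$. Routes are unordered pairs $ij=ji$ of distinct channels; each route has arrival rate $\lambda_{ij}\ge0$ and a parameter $\mu_{ij}>0$; $\mathcal R=\{ij:\lambda_{ij}>0\}$ is the set of active routes. For $x\in\mathbb R_+^{\mathcal R}$ write $x_i=\sum_{j:ij\in\mathcal R}x_{ij}$, $\nu_{ij}(x)=x_{ij}\,(C_i/x_i\wedge C_j/x_j)$ if $x_{ij}>0$ and $\nu_{ij}(x)=0$ otherwise, and $\mu_{ij}(x)=\mu_{ij}\nu_{ij}(x)$ (min policy). $Q(t,y)$, $t\ge0$, is the continuous-time Markov jump process on $\mathbb Z_+^{\mathcal R}$ started at $y$ which jumps from $x$ to $x+e_{ij}$ at rate $\lambda_{ij}$ and from $x$ to $x-e_{ij}$ at rate $\mu_{ij}(x)$ ($ij\in\mathcal R$); $\mathbb P$ is its law. "$Q$ is ergodic" means $\sum_{j:ij\in\mathcal R}\lambda_{ij}/\mu_{ij}<C_i$ for every $i\in\mathcal S$. $|\cdot|$ is a norm on $\mathbb R^{\mathcal R}$. Faces: for $x\in\mathbb R_+^{\mathcal R}$, $\Lambda(x)=\{ij\in\mathcal R:x_{ij}>0\}$. For $\Lambda\subset\mathcal R$, $\Lambda_1=\{ij\in\mathcal R\setminus\Lambda:\exists k\in\mathcal S,\ ik\in\Lambda\text{ or }jk\in\Lambda\}$ and $\Lambda_2=\mathcal R\setminus(\Lambda\cup\Lambda_1)$; $\Lambda_1(x),\Lambda_2(x)$ are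 these sets for $\Lambda=\Lambda(x)$. $\mathbb R^\Lambda=\{D\in\mathbb R^{\mathcal R}:D_{ij}=0\ \forall ij\notin\Lambda\}$. The "face $\Lambda$" also denotes the set $\{y\in\mathbb R_+^{\mathcal R}:y_{ij}>0\ \forall ij\in\Lambda,\ y_{ij}=0\ \forall ij\notin\Lambda\}$. For $\lambda>0,\mu\ge0$ and real $D$ (with $D\ge0$ if $\mu=0$), $$l(D\|\lambda,\mu)=D\log\Big(\frac{D+\sqrt{D^2+4\lambda\mu}}{2\lambda}\Big)+\lambda+\mu-\sqrt{D^2+4\lambda\mu},$$ with the convention $0\log0=0$ (so $l(0\|\lambda,0)=\lambda$). *)

theory Defs
  imports "HOL-Probability.Probability"
begin

text \<open>Channels are 1..N.  A route ij = ji is encoded as the pair (min i j, max i j).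
Vectors in R^R are functions route => real vanishing outside the active route set.\<close>

type_synonym route = "nat \<times> nat"
type_synonym vec = "route \<Rightarrow> real"

definition routes :: "nat \<Rightarrow> route set" where
  "routes N = {(i, j). 1 \<le> i \<and> i < j \<and> j \<le> N}"

definition active :: "nat \<Rightarrow> (route \<Rightarrow> real) \<Rightarrow> route set" where
  "active N lam = {r \<in> routes N. lam r > 0}"

definition on_ch :: "nat \<Rightarrow> route \<Rightarrow> bool" where
  "on_ch i r \<longleftrightarrow> fst r = i \<or> snd r = i"

definition load :: "route set \<Rightarrow> vec \<Rightarrow> nat \<Rightarrow> real" where
  "load R x i = (\<Sum>r\<in>{r \<in> R. on_ch i r}. x r)"

definition nu :: "route set \<Rightarrow> (nat \<Rightarrow> real) \<Rightarrow> vec \<Rightarrow> route \<Rightarrow> real" where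
  "nu R C x r = (if x r > 0
      then x r * min (C (fst r) / load R x (fst r)) (C (snd r) / load R x (snd r)) else 0)"

definition murate :: "route set \<Rightarrow> (nat \<Rightarrow> real) \<Rightarrow> (route \<Rightarrow> real) \<Rightarrow> vec \<Rightarrow> route \<Rightarrow> real" where
  "murate R C mu x r = mu r * nu R C x r"

definition ergodic :: "nat \<Rightarrow> (nat \<Rightarrow> real) \<Rightarrow> (route \<Rightarrow> real) \<Rightarrow> (route \<Rightarrow> real) \<Rightarrow> bool" where
  "ergodic N C lam mu \<longleftrightarrow>
     (\<forall>i\<in>{1..N}. (\<Sum>r\<in>{r \<in> active N lam. on_ch i r}. lam r / mu r) < C i)"

definition Rplus :: "route set \<Rightarrow> vec set" where
  "Rplus R = {x. (\<forall>r\<in>R. x r \<ge> 0) \<and> (\<forall>r. r \<notin> R \<longrightarrow> x r = 0)}"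

definition Rsub :: "route set \<Rightarrow> vec set" where
  "Rsub L = {D. \<forall>r. r \<notin> L \<longrightarrow> D r = 0}"

definition Zplus :: "route set \<Rightarrow> vec set" where
  "Zplus R = {y. (\<forall>r\<in>R. y r \<in> \<nat>) \<and> (\<forall>r. r \<notin> R \<longrightarrow> y r = 0)}"

definition lface :: "route set \<Rightarrow> vec \<Rightarrow> route set" where
  "lface R x = {r \<in> R. x r > 0}"

definition joins :: "nat \<Rightarrow> nat \<Rightarrow> route \<Rightarrow> bool" where
  "joins i k r \<longleftrightarrow> i \<noteq> k \<and> on_ch i r \<and> on_ch k r"

definition face1 :: "route set \<Rightarrow> route set \<Rightarrow> route set" where
  "face1 R L = {r \<in> R - L. \<exists>k. \<exists>r'\<in>L. joins (fst r) k r' \<or> joins (snd r) k r'}"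

definition faceset :: "route set \<Rightarrow> vec set" where
  "faceset L = {y. (\<forall>r\<in>L. y r > 0) \<and> (\<forall>r. r \<notin> L \<longrightarrow> y r = 0)}"

definition lfun :: "real \<Rightarrow> real \<Rightarrow> real \<Rightarrow> real" where
  "lfun D la m = (if D = 0 then 0 else D * ln ((D + sqrt (D\<^sup>2 + 4 * la * m)) / (2 * la)))
                 + la + m - sqrt (D\<^sup>2 + 4 * la * m)"

definition Lcost :: "nat \<Rightarrow> (nat \<Rightarrow> real) \<Rightarrow> (route \<Rightarrow> real) \<Rightarrow> (route \<Rightarrow> real) \<Rightarrow> vec \<Rightarrow> vec \<Rightarrow> real" where
  "Lcost N C lam mu x D =
     (let R = active N lam; L = lface R x in
      \<Sum>r\<in>L \<union> face1 R L. lfun (D r) (lam r) (murate R C mu x r))"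

text \<open>Construction of the law of the Markov jump process Q(t,y) by uniformization:
 i.i.d. pairs (E_k, U_k) with E_k ~ Exp(Lam) and U_k ~ Uniform[0,1]; the jump chain moves
 from x to x +- e_r with probabilities lam_r/Lam, mu_r(x)/Lam (staying put otherwise),
 and jumps occur at the partial sums of the E_k.\<close>

definition unif_rate :: "nat \<Rightarrow> (nat \<Rightarrow> real) \<Rightarrow> (route \<Rightarrow> real) \<Rightarrow> (route \<Rightarrow> real) \<Rightarrow> real" where
  "unif_rate N C lam mu = (\<Sum>r\<in>active N lam. lam r + mu r * (C (fst r) + C (snd r))) + 1"

fun pick :: "(route \<times> real \<times> real) list \<Rightarrow> real \<Rightarrow> (route \<times> real) option" where
  "pick [] u = None"
| "pick ((r, s, w) # es) u = (if u < w then Some (r, s) else pick es (u - w))"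

definition events :: "nat \<Rightarrow> (nat \<Rightarrow> real) \<Rightarrow> (route \<Rightarrow> real) \<Rightarrow> (route \<Rightarrow> real) \<Rightarrow> vec
     \<Rightarrow> (route \<times> real \<times> real) list" where
  "events N C lam mu x =
     concat (map (\<lambda>r. [(r, 1, lam r), (r, -1, murate (active N lam) C mu x r)])
                 [(i, j). i \<leftarrow> [1..<N+1], j \<leftarrow> [i+1..<N+1], lam (i, j) > 0])"

definition step :: "nat \<Rightarrow> (nat \<Rightarrow> real) \<Rightarrow> (route \<Rightarrow> real) \<Rightarrow> (route \<Rightarrow> real) \<Rightarrow> vec \<Rightarrow> real \<Rightarrow> vec" where
  "step N C lam mu x u =
     (case pick (events N C lam mu x) (u * unif_rate N C lam mu) of
        None \<Rightarrow> x
      | Some (r, s) \<Rightarrow> x(r := x r + s))"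

definition base_measure :: "real \<Rightarrow> (real \<times> real) measure" where
  "base_measure L = density lborel (\<lambda>t. ennreal (exponential_density L t))
                    \<Otimes>\<^sub>M uniform_measure lborel {0..1::real}"

definition path_space :: "nat \<Rightarrow> (nat \<Rightarrow> real) \<Rightarrow> (route \<Rightarrow> real) \<Rightarrow> (route \<Rightarrow> real)
     \<Rightarrow> (nat \<Rightarrow> real \<times> real) measure" where
  "path_space N C lam mu = (\<Pi>\<^sub>M k\<in>(UNIV::nat set). base_measure (unif_rate N C lam mu))"

fun chain :: "nat \<Rightarrow> (nat \<Rightarrow> real) \<Rightarrow> (route \<Rightarrow> real) \<Rightarrow> (route \<Rightarrow> real) \<Rightarrow> vec
     \<Rightarrow> (nat \<Rightarrow> real \<times> real) \<Rightarrow> nat \<Rightarrow> vec" where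
  "chain N C lam mu y \<omega> 0 = y"
| "chain N C lam mu y \<omega> (Suc k) = step N C lam mu (chain N C lam mu y \<omega> k) (snd (\<omega> k))"

definition jtime :: "(nat \<Rightarrow> real \<times> real) \<Rightarrow> nat \<Rightarrow> real" where
  "jtime \<omega> k = (\<Sum>m<k. fst (\<omega> m))"

definition Qproc :: "nat \<Rightarrow> (nat \<Rightarrow> real) \<Rightarrow> (route \<Rightarrow> real) \<Rightarrow> (route \<Rightarrow> real) \<Rightarrow> vec
     \<Rightarrow> (nat \<Rightarrow> real \<times> real) \<Rightarrow> real \<Rightarrow> vec" where
  "Qproc N C lam mu y \<omega> t = chain N C lam mu y \<omega> (card {k. 1 \<le> k \<and> jtime \<omega> k \<le> t})"

definition tube_prob :: "nat \<Rightarrow> (nat \<Rightarrow> real) \<Rightarrow> (route \<Rightarrow> real) \<Rightarrow> (route \<Rightarrow> real) \<Rightarrow> (vec \<Rightarrow> real)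
     \<Rightarrow> vec \<Rightarrow> nat \<Rightarrow> vec \<Rightarrow> vec \<Rightarrow> real \<Rightarrow> real \<Rightarrow> real" where
  "tube_prob N C lam mu nrm y n x D \<tau> \<delta> =
     measure (path_space N C lam mu)
       {\<omega> \<in> space (path_space N C lam mu).
          (SUP t\<in>{0..real n * \<tau>}.
             ereal (nrm (\<lambda>r. Qproc N C lam mu y \<omega> t r - real n * x r - D r * t)))
          < ereal (\<delta> * real n)}"

definition eln :: "real \<Rightarrow> ereal" where
  "eln p = (if p \<le> 0 then -\<infinity> else ereal (ln p))"

definition lowF :: "nat \<Rightarrow> (nat \<Rightarrow> real) \<Rightarrow> (route \<Rightarrow> real) \<Rightarrow> (route \<Rightarrow> real) \<Rightarrow> (vec \<Rightarrow> real)
     \<Rightarrow> vec \<Rightarrow> vec \<Rightarrow> real \<Rightarrow> real \<Rightarrow> real \<Rightarrow> ereal" where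
  "lowF N C lam mu nrm x D \<tau> \<delta> \<epsilon> =
     liminf (\<lambda>n::nat. ereal (1 / (real n * \<tau>)) *
       (INF y\<in>{y \<in> Zplus (active N lam). nrm (\<lambda>r. y r - real n * x r) < \<epsilon> * real n}.
          eln (tube_prob N C lam mu nrm y n x D \<tau> \<delta>)))"

definition upF :: "nat \<Rightarrow> (nat \<Rightarrow> real) \<Rightarrow> (route \<Rightarrow> real) \<Rightarrow> (route \<Rightarrow> real) \<Rightarrow> (vec \<Rightarrow> real)
     \<Rightarrow> vec \<Rightarrow> vec \<Rightarrow> real \<Rightarrow> real \<Rightarrow> real \<Rightarrow> ereal" where
  "upF N C lam mu nrm x D \<tau> \<delta> \<epsilon> =
     limsup (\<lambda>n::nat. ereal (1 / (real n * \<tau>)) *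
       (SUP y\<in>{y \<in> Zplus (active N lam). nrm (\<lambda>r. y r - real n * x r) < \<epsilon> * real n}.
          eln (tube_prob N C lam mu nrm y n x D \<tau> \<delta>)))"

definition is_dlim :: "(real \<Rightarrow> real \<Rightarrow> real \<Rightarrow> ereal) \<Rightarrow> real \<Rightarrow> ereal \<Rightarrow> bool" where
  "is_dlim F \<tau> h \<longleftrightarrow> (\<exists>G. (\<forall>\<delta>>0. (F \<tau> \<delta> \<longlongrightarrow> G \<delta>) (at_right 0)) \<and> (G \<longlongrightarrow> h) (at_right 0))"

definition is_itlim :: "(real \<Rightarrow> real \<Rightarrow> real \<Rightarrow> ereal) \<Rightarrow> ereal \<Rightarrow> bool" where
  "is_itlim F v \<longleftrightarrow> (\<exists>H. (\<forall>\<tau>>0. is_dlim F \<tau> (H \<tau>)) \<and> (H \<longlongrightarrow> v) (at_right 0))"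

definition is_norm_on :: "route set \<Rightarrow> (vec \<Rightarrow> real) \<Rightarrow> bool" where
  "is_norm_on R nrm \<longleftrightarrow>
     (\<forall>v\<in>Rsub R. nrm v \<ge> 0 \<and> (nrm v = 0 \<longleftrightarrow> v = (\<lambda>_. 0))) \<and>
     (\<forall>v\<in>Rsub R. \<forall>w\<in>Rsub R. nrm (\<lambda>r. v r + w r) \<le> nrm v + nrm w) \<and>
     (\<forall>v\<in>Rsub R. \<forall>c. nrm (\<lambda>r. c * v r) = \<bar>c\<bar> * nrm v)"

end

theory Submission
  imports Defs
begin

text \<open>Conditioning on the first jump shows that the tube probability, as a function of the starting
state and the starting time, is a fixed point of a contraction. Hence it is bounded from below by every
subsolution, and from above by every supersolution, of the backward Kolmogorov equation in the tube, and
both bounds are obtained from products of functions of one coordinate each. With \<open>z\<close> the deviation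
of a coordinate from the centre of the tube, the routes of \<open>\<Lambda>\<close> contribute the exponential tilt
\<open>exp (\<theta> z)\<close> at the maximiser \<open>\<theta>\<close> of the Legendre transform, which costs \<open>l(D \<parallel> \<lambda>, \<mu>)\<close>;
for the lower bound it is multiplied by a Gaussian hump that keeps the tilted process inside the tube at
negligible cost. On \<open>\<Lambda>\<^sub>1\<close> service is negligible, so arrivals must be suppressed, at cost
\<open>\<lambda>\<close>. On \<open>\<Lambda>\<^sub>2\<close> ergodicity makes \<open>max (\<mu> z / \<lambda>)\<close> a Lyapunov function, so that an
exponential barrier shows that staying near 0 costs nothing.\<close>

section \<open>One-dimensional sub- and supersolutions\<close>

text \<open>Near the face the rates are continuous on its own routes and on the first-order ones,
  but they can be discontinuous at 0 on the second-order ones. No approximation by frozen rates is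
  available there, only a drift condition near the top of the allowed range. Comparison with
  explicit functions gets by with that: a subsolution is tested only where it is positive, so it may
  be cut off at 0 outside the tube, while a supersolution is used without a cutoff. The one
  probabilistic input is the splitting of the product space into the first pair (holding time,
  uniform) and the remaining sequence. The contraction factor over the horizon \<open>T\<close> is
  \<open>1 - exp (- W * T)\<close>, the chance that the clock rings before \<open>T\<close>.

  The order of the limits fixes the order of the constants. Whatever determines \<tau> depends only
  on the error \<open>e\<close>, the drift and a box inside the face, which gives the uniformity.
  The widths come afterwards and are so small against \<open>\<tau> * e\<close> that boundary
  factors exponential in width times \<open>n\<close> vanish in the error.\<close>

text \<open>This is the positive root \<open>u\<close> of
  \<open>la * u\<^sup>2 - D * u - m = 0\<close>, that is \<open>exp \<theta>\<close> at the
  maximiser \<theta> of \<open>\<theta> * D - la * (exp \<theta> - 1) - m * (exp (- \<theta>) -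
  1)\<close>. A walk with up rate \<open>la * u\<close> and down rate \<open>m / u\<close> has drift
  \<open>D\<close>.\<close>

definition tilt :: "real \<Rightarrow> real \<Rightarrow> real \<Rightarrow> real" where
  "tilt D la m = (D + sqrt (D\<^sup>2 + 4 * la * m)) / (2 * la)"

text \<open>The last identity is the conjugate root: \<open>(s + D) * (s - D) = 4 * la * m\<close>
  for the square root \<open>s\<close>. It yields bounds on \<open>1 / u\<close> that involve only
  \<open>s\<close>, \<open>D\<close> and \<open>m\<close>.\<close>

lemma tilt_props:
  assumes "0 < la" "0 < m"
  shows "0 < tilt D la m" "la * tilt D la m - m / tilt D la m = D"
    "la * tilt D la m + m / tilt D la m = sqrt (D\<^sup>2 + 4 * la * m)"
    "m / tilt D la m = (sqrt (D\<^sup>2 + 4 * la * m) - D) / 2"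
proof -
  define s where "s = sqrt (D\<^sup>2 + 4 * la * m)"
  have s2: "s\<^sup>2 = D\<^sup>2 + 4 * la * m" using assms by (simp add: s_def)
  have "\<bar>D\<bar> < s" unfolding s_def using assms by (intro real_less_rsqrt) simp
  then have pos: "0 < D + s" by linarith
  then show "0 < tilt D la m" using assms by (simp add: tilt_def s_def)
  have "(D + s) * (s - D) = 4 * la * m" using s2 by (simp add: power2_eq_square algebra_simps)
  then show m: "m / tilt D la m = (sqrt (D\<^sup>2 + 4 * la * m) - D) / 2"
    using pos assms unfolding tilt_def s_def[symmetric] by (simp add: field_simps)
  have la: "la * tilt D la m = (D + s) / 2" using assms by (simp add: tilt_def s_def)
  show "la * tilt D la m - m / tilt D la m = D"
    "la * tilt D la m + m / tilt D la m = sqrt (D\<^sup>2 + 4 * la * m)"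
    unfolding m la s_def[symmetric] by (simp_all add: field_simps)
qed

text \<open>The value of the Legendre transform at its maximiser \<open>ln (tilt D la m)\<close>.
  This is the form in which the cost appears when the generator acts on an exponential.\<close>

lemma lfun_tilt:
  assumes "0 < la" "0 < m"
  shows "lfun D la m = D * ln (tilt D la m) - la * (tilt D la m - 1) - m * (1 / tilt D la m - 1)"
  using tilt_props(3)[OF assms, of D, symmetric] by (simp add: lfun_def tilt_def algebra_simps)

text \<open>At \<open>D = la * u - m / u\<close> the cost is a sum of two Poisson relative
  entropies, \<open>la * (u * ln u - u + 1)\<close> for the up jumps and the same expression with
  \<open>m\<close> and \<open>1 / u\<close> for the down jumps. Each is nonnegative by
  \<open>ln t \<le> t - 1\<close>.\<close>

lemma lfun_nonneg:
  assumes "0 < la" "0 < m"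
  shows "0 \<le> lfun D la m"
proof -
  define u where "u = tilt D la m"
  have u: "0 < u" using tilt_props(1)[OF assms] by (simp add: u_def)
  have D: "D = la * u - m / u" using tilt_props(2)[OF assms] by (simp add: u_def)
  have l1: "- ln u \<le> 1 / u - 1" using ln_le_minus_one[of "1 / u"] u by (simp add: ln_div)
  have l2: "ln u \<le> u - 1" using ln_le_minus_one[OF u] .
  have "0 \<le> ln u - 1 + 1 / u" "0 \<le> u - 1 - ln u" using l1 l2 by auto
  then have "0 \<le> la * u * (ln u - 1 + 1 / u) + m / u * (u - 1 - ln u)"
    using u assms by (metis add_nonneg_nonneg divide_nonneg_nonneg less_imp_le mult_nonneg_nonneg)
  also have "\<dots> = lfun D la m"
    unfolding lfun_tilt[OF assms] u_def[symmetric] using u by (subst D) (simp add: field_simps)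
  finally show ?thesis .
qed

lemma lfun_zero: "0 < la \<Longrightarrow> lfun 0 la 0 = la"
  by (simp add: lfun_def)

text \<open>The tilt increases with the square root, hence with \<open>m\<close>, and
  \<open>1 / u\<close> is that root minus \<open>D\<close>, over \<open>2 * m\<close>; so a positive
  lower bound and an upper bound on the rate control both.\<close>

lemma tilt_bounded:
  assumes "0 < la" "0 < m1"
  obtains E where "1 \<le> E"
    "\<And>m. m1 \<le> m \<Longrightarrow> m \<le> m2 \<Longrightarrow> tilt D la m \<le> E \<and> 1 / tilt D la m \<le> E \<and> \<bar>ln (tilt D la m)\<bar> \<le> E"
proof -
  define s2 where "s2 = sqrt (D\<^sup>2 + 4 * la * m2)"
  \<comment> \<open>The two terms with \<open>\<bar>s2\<bar>\<close> secure \<open>1 \<le> E\<close>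
    also when \<open>m2\<close> is so negative that \<open>s2\<close> is negative,
    \<open>sqrt\<close> being an odd function.\<close>
  define E where "E = 1 + (\<bar>D\<bar> + s2) / (2 * la) + (\<bar>D\<bar> + s2) / (2 * m1) + \<bar>s2\<bar> / la + \<bar>s2\<bar> / m1"
  have E1: "(\<bar>D\<bar> + s2) / (2 * la) + \<bar>s2\<bar> / la \<ge> 0" "(\<bar>D\<bar> + s2) / (2 * m1) + \<bar>s2\<bar> / m1 \<ge> 0"
    using assms by (auto simp: field_simps)
  show ?thesis
  proof (rule that[of E])
    show "1 \<le> E" using E1 unfolding E_def by linarith
    fix m assume m: "m1 \<le> m" "m \<le> m2"
    define s where "s = sqrt (D\<^sup>2 + 4 * la * m)"
    define u where "u = tilt D la m"
    have mpos: "0 < m" using m assms by simp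
    have u: "0 < u" "m / u = (s - D) / 2" using tilt_props(1,4)[OF assms(1) mpos] by (auto simp: u_def s_def)
    have s: "s \<le> s2" unfolding s_def s2_def using m assms by (intro real_sqrt_le_mono) simp
    have "0 \<le> s" using mpos assms by (simp add: s_def)
    have "u = (D + s) / (2 * la)" by (simp add: u_def tilt_def s_def)
    also have "\<dots> \<le> (\<bar>D\<bar> + s2) / (2 * la)" using s assms by (intro divide_right_mono) auto
    finally have 1: "u \<le> (\<bar>D\<bar> + s2) / (2 * la)" .
    have "1 / u = (s - D) / (2 * m)" using u mpos by (simp add: field_simps)
    also have "\<dots> \<le> (\<bar>D\<bar> + s2) / (2 * m)" using s mpos by (intro divide_right_mono) auto
    also have "\<dots> \<le> (\<bar>D\<bar> + s2) / (2 * m1)" using s m assms \<open>0 \<le> s\<close> by (intro divide_left_mono) auto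
    finally have 2: "1 / u \<le> (\<bar>D\<bar> + s2) / (2 * m1)" .
    have "0 \<le> (\<bar>D\<bar> + s2) / (2 * la)" "0 \<le> (\<bar>D\<bar> + s2) / (2 * m1)" "0 \<le> \<bar>s2\<bar> / la" "0 \<le> \<bar>s2\<bar> / m1"
      using assms s \<open>0 \<le> s\<close> by auto
    then have "u \<le> E" "1 / u \<le> E" using 1 2 unfolding E_def by linarith+
    moreover have "ln u \<le> u" "- ln u \<le> 1 / u"
      using ln_le_minus_one[of u] ln_le_minus_one[of "1 / u"] u(1) by (auto simp: ln_div)
    ultimately show "tilt D la m \<le> E \<and> 1 / tilt D la m \<le> E \<and> \<bar>ln (tilt D la m)\<bar> \<le> E"
      unfolding u_def[symmetric] by (auto simp: abs_le_iff)
  qed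
qed

text \<open>Here \<open>\<beta>\<close> is the half-width of the tube; the hump changes the tilt by at most \<open>\<omega>\<close> inside the tube.\<close>

definition hill :: "real \<Rightarrow> real \<Rightarrow> real \<Rightarrow> real" where
  "hill \<beta> \<omega> z = exp (- (\<omega> / \<beta>) * z\<^sup>2 / 2) - exp (- \<omega> * \<beta> / 2)"

text \<open>The factor \<open>exp (- \<bar>\<theta>\<bar> * \<beta>)\<close> normalises the tilt to
  at most 1 on the tube, as the lower comparison asks for a function bounded by 1. Cutting at 0
  confines the support to the tube.\<close>

definition tilted_hill :: "real \<Rightarrow> real \<Rightarrow> real \<Rightarrow> real \<Rightarrow> real" where
  "tilted_hill \<theta> \<beta> \<omega> z = exp (\<theta> * z - \<bar>\<theta>\<bar> * \<beta>) * max 0 (hill \<beta> \<omega> z)"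

text \<open>The constant subtracted in \<open>hill\<close> is the value of the Gaussian at
  \<open>\<bar>z\<bar> = \<beta>\<close>.\<close>

lemma hill_pos_iff:
  assumes "0 < \<beta>" "0 < \<omega>"
  shows "0 < hill \<beta> \<omega> z \<longleftrightarrow> \<bar>z\<bar> < \<beta>"
proof -
  have "0 < hill \<beta> \<omega> z \<longleftrightarrow> \<omega> * (z\<^sup>2 / \<beta>) < \<omega> * \<beta>" by (simp add: hill_def)
  also have "\<dots> \<longleftrightarrow> z\<^sup>2 < \<beta>\<^sup>2" using assms by (simp add: power2_eq_square divide_less_eq)
  also have "\<dots> \<longleftrightarrow> \<bar>z\<bar> < \<beta>" using assms by (metis abs_of_pos abs_le_square_iff not_le)
  finally show ?thesis .
qed

lemma tilted_hill_pos_iff: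
  assumes "0 < \<beta>" "0 < \<omega>"
  shows "0 < tilted_hill \<theta> \<beta> \<omega> z \<longleftrightarrow> \<bar>z\<bar> < \<beta>"
  using hill_pos_iff[OF assms, of z] by (auto simp: tilted_hill_def zero_less_mult_iff less_max_iff_disj)

lemma tilted_hill_bounds:
  assumes "0 < \<beta>" "0 < \<omega>"
  shows "0 \<le> tilted_hill \<theta> \<beta> \<omega> z" "tilted_hill \<theta> \<beta> \<omega> z \<le> 1"
proof -
  show *: "0 \<le> tilted_hill \<theta> \<beta> \<omega> z" by (simp add: tilted_hill_def)
  show "tilted_hill \<theta> \<beta> \<omega> z \<le> 1"
  proof (cases "\<bar>z\<bar> < \<beta>")
    case True
    have "\<bar>\<theta> * z\<bar> \<le> \<bar>\<theta>\<bar> * \<beta>"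
      unfolding abs_mult using True by (intro mult_left_mono) auto
    then have "\<theta> * z \<le> \<bar>\<theta>\<bar> * \<beta>" by linarith
    moreover have "hill \<beta> \<omega> z \<le> 1 - 0" unfolding hill_def using assms by (intro diff_mono) auto
    ultimately have "tilted_hill \<theta> \<beta> \<omega> z \<le> 1 * 1"
      unfolding tilted_hill_def by (intro mult_mono) auto
    then show ?thesis by simp
  next
    case False
    then show ?thesis using tilted_hill_pos_iff[OF assms, of \<theta> z] by linarith
  qed
qed

lemma exp_minus_le_half:
  assumes "1 \<le> (x::real)"
  shows "exp (- x) \<le> 1 / 2"
proof -
  have "2 \<le> exp x" using exp_ge_add_one_self[of x] assms by linarith
  then show ?thesis by (simp add: exp_minus field_simps)
qed

text \<open>On the inner half of the tube the Gaussian is at least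
  \<open>exp (- \<omega> * \<beta> / 8)\<close>, so the subtracted constant is smaller by the factor
  \<open>exp (- (3 * (\<omega> * \<beta>) / 8))\<close>, which is below 1/2. The value 48 itself
  comes from the discretisation error in \<open>hill_generator\<close>.\<close>

lemma hill_core:
  assumes "0 < \<beta>" "0 < \<omega>" "48 \<le> \<omega> * \<beta>" "\<bar>z\<bar> \<le> \<beta> / 2"
  shows "exp (- (\<omega> / \<beta>) * z\<^sup>2 / 2) \<le> 2 * hill \<beta> \<omega> z" "exp (- \<omega> * \<beta> / 8) \<le> exp (- (\<omega> / \<beta>) * z\<^sup>2 / 2)"
proof -
  have "z\<^sup>2 \<le> (\<beta> / 2)\<^sup>2" using assms(4) by (metis abs_ge_zero power2_abs power_mono)
  then have "\<omega> / \<beta> * z\<^sup>2 \<le> \<omega> / \<beta> * (\<beta> / 2)\<^sup>2" using assms by (intro mult_left_mono) auto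
  also have "\<dots> = \<omega> * \<beta> / 4" using assms by (simp add: power2_eq_square)
  finally have "\<omega> / \<beta> * z\<^sup>2 \<le> \<omega> * \<beta> / 4" .
  moreover have "- Y / 8 \<le> - X / 2" if "X \<le> Y / 4" for X Y :: real using that by simp
  ultimately have "- (\<omega> * \<beta>) / 8 \<le> - (\<omega> / \<beta> * z\<^sup>2) / 2" by blast
  then have *: "- \<omega> * \<beta> / 8 \<le> - (\<omega> / \<beta>) * z\<^sup>2 / 2" by (simp only: minus_mult_left)
  then show "exp (- \<omega> * \<beta> / 8) \<le> exp (- (\<omega> / \<beta>) * z\<^sup>2 / 2)" by simp
  have "exp (- \<omega> * \<beta> / 2) = exp (- \<omega> * \<beta> / 8) * exp (- (3 * (\<omega> * \<beta>) / 8))"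
    by (simp add: exp_add[symmetric])
  also have "\<dots> \<le> exp (- (\<omega> / \<beta>) * z\<^sup>2 / 2) * (1 / 2)"
    using * assms(3) by (intro mult_mono exp_minus_le_half) auto
  finally show "exp (- (\<omega> / \<beta>) * z\<^sup>2 / 2) \<le> 2 * hill \<beta> \<omega> z" by (simp add: hill_def)
qed

text \<open>Gives the starting value of the face factors: a start near the centre loses at most a
  factor exponential in \<beta>, and \<beta> is later a small multiple of \<open>n\<close>.\<close>

lemma tilted_hill_core:
  assumes "0 < \<beta>" "0 < \<omega>" "\<omega> \<le> 1" "48 \<le> \<omega> * \<beta>" "\<bar>z\<bar> \<le> \<beta> / 2"
  shows "exp (- (2 * \<bar>\<theta>\<bar> + 1) * \<beta>) / 2 \<le> tilted_hill \<theta> \<beta> \<omega> z"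
proof -
  have "\<bar>\<theta> * z\<bar> \<le> \<bar>\<theta>\<bar> * \<beta>" unfolding abs_mult using assms by (intro mult_left_mono) auto
  then have 1: "- 2 * \<bar>\<theta>\<bar> * \<beta> \<le> \<theta> * z - \<bar>\<theta>\<bar> * \<beta>" by (simp add: abs_le_iff algebra_simps)
  have "\<omega> * \<beta> \<le> 1 * \<beta>" using assms by (intro mult_right_mono) auto
  then have "exp (- \<beta>) \<le> exp (- \<omega> * \<beta> / 8)" using assms by simp
  then have 2: "exp (- \<beta>) / 2 \<le> max 0 (hill \<beta> \<omega> z)" using hill_core[OF assms(1,2,4,5)] by linarith
  have "exp (- (2 * \<bar>\<theta>\<bar> + 1) * \<beta>) / 2 = exp (- 2 * \<bar>\<theta>\<bar> * \<beta>) * (exp (- \<beta>) / 2)"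
    by (simp add: exp_add[symmetric] algebra_simps)
  also have "\<dots> \<le> tilted_hill \<theta> \<beta> \<omega> z"
    unfolding tilted_hill_def using 1 2 by (intro mult_mono) auto
  finally show ?thesis .
qed

text \<open>Square \<open>1 + y / 2 \<le> exp (y / 2)\<close>. The quadratic gain later pays for the
  drift error and the discretisation error.\<close>

lemma exp_quadratic_le:
  assumes "\<bar>y\<bar> \<le> (1::real)"
  shows "1 + y + y\<^sup>2 / 4 \<le> exp y"
proof -
  have "(1 + y / 2)\<^sup>2 \<le> (exp (y / 2))\<^sup>2"
    using exp_ge_add_one_self[of "y / 2"] assms by (intro power_mono) auto
  then show ?thesis by (simp add: power2_eq_square exp_add[symmetric] field_simps)
qed

text \<open>The Gaussian factor adds a restoring force, which dominates the drift error \<open>\<kappa>\<close> once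
\<open>\<bar>z\<bar> \<ge> \<beta> / 2\<close>; on the core its cost is of order \<open>\<omega>\<^sup>2\<close>.\<close>

lemma hill_generator:
  fixes p q :: real
  assumes \<beta>: "0 < \<beta>" and \<omega>: "0 < \<omega>" "\<omega> \<le> 1" "48 \<le> \<omega> * \<beta>" and z: "\<bar>z\<bar> < \<beta>"
    and p: "0 < p" "0 \<le> q" and \<kappa>: "\<bar>D - (p - q)\<bar> \<le> \<kappa>" "\<kappa> \<le> p * \<omega> / 16"
  defines "a \<equiv> \<omega> / \<beta>"
  shows "0 \<le> hill \<beta> \<omega> z * ((p + q) * \<omega>\<^sup>2 / 8) + exp (- a * z\<^sup>2 / 2) *
      (D * (a * z) + p * (exp (- (a * z) - a / 2) - 1) + q * (exp (a * z - a / 2) - 1))"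
proof -
  \<comment> \<open>The Gaussian at \<open>z + 1\<close> and \<open>z - 1\<close> is its value at
    \<open>z\<close> times \<open>exp (- w - a / 2)\<close> and \<open>exp (w - a / 2)\<close>. The
    tilt has been divided out: \<open>p\<close> and \<open>q\<close> stand for the tilted rates
    \<open>la * u\<close> and \<open>\<mu> / u\<close>, and \<open>X\<close> bounds
    \<open>p * exp (- w) + q * exp w\<close> from below.\<close>
  define w where "w = a * z"
  define \<sigma> where "\<sigma> = p + q"
  define X where "X = p * (1 - w + w\<^sup>2 / 4) + q * (1 + w + w\<^sup>2 / 4)"
  define G where "G = exp (- a * z\<^sup>2 / 2)"
  have a: "0 < a" using \<beta> \<omega> by (simp add: a_def)
  have "\<sigma> > 0" using p by (simp add: \<sigma>_def)
  have w: "\<bar>w\<bar> \<le> \<omega>"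
  proof -
    have "\<bar>w\<bar> = a * \<bar>z\<bar>" using a by (simp add: w_def abs_mult)
    also have "\<dots> \<le> a * \<beta>" using z a by (intro mult_left_mono) auto
    finally show ?thesis using \<beta> by (simp add: a_def)
  qed
  have w1: "\<bar>w\<bar> \<le> 1" using w \<omega> by simp
  have Xle: "X \<le> 3 * \<sigma>"
  proof -
    have "w\<^sup>2 \<le> 1" using w1 by (simp add: abs_square_le_1)
    then have "p * (1 - w + w\<^sup>2 / 4) \<le> p * 3" "q * (1 + w + w\<^sup>2 / 4) \<le> q * 3"
      using w1 p by (auto intro!: mult_left_mono)
    then show ?thesis by (simp add: X_def \<sigma>_def)
  qed
  have X0: "0 \<le> X"
  proof -
    have "1 - w + w\<^sup>2 / 4 = (1 - w / 2)\<^sup>2" "1 + w + w\<^sup>2 / 4 = (1 + w / 2)\<^sup>2"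
      by (auto simp: power2_eq_square field_simps)
    then show ?thesis using p unfolding X_def by simp
  qed
  have "exp (- a / 2) * X \<le> p * exp (- w - a / 2) + q * exp (w - a / 2)"
  proof -
    have "p * (1 - w + w\<^sup>2 / 4) \<le> p * exp (- w)" "q * (1 + w + w\<^sup>2 / 4) \<le> q * exp w"
      using exp_quadratic_le[of "- w"] exp_quadratic_le[of w] w1 p by (auto intro!: mult_left_mono)
    then have "exp (- a / 2) * X \<le> exp (- a / 2) * (p * exp (- w) + q * exp w)"
      unfolding X_def by (intro mult_left_mono) auto
    also have "\<dots> = p * exp (- w - a / 2) + q * exp (w - a / 2)"
    proof -
      have "exp (- w - a / 2) = exp (- a / 2) * exp (- w)" "exp (w - a / 2) = exp (- a / 2) * exp w"
        by (simp_all add: exp_add[symmetric])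
      then show ?thesis by (simp only: distrib_left mult_ac)
    qed
    finally show ?thesis .
  qed
  moreover have "X - 3 / 2 * a * \<sigma> \<le> exp (- a / 2) * X"
  proof -
    have "(1 - a / 2) * X \<le> exp (- a / 2) * X"
      using exp_ge_add_one_self[of "- a / 2"] X0 by (intro mult_right_mono) auto
    moreover have "a / 2 * X \<le> a / 2 * (3 * \<sigma>)" using Xle a by (intro mult_left_mono) auto
    ultimately show ?thesis by (simp add: algebra_simps)
  qed
  moreover have "X - \<sigma> + D * w = (D - (p - q)) * w + \<sigma> * w\<^sup>2 / 4"
    by (simp add: X_def \<sigma>_def field_simps)
  moreover have "\<bar>(D - (p - q)) * w\<bar> \<le> \<kappa> * \<bar>w\<bar>"
    unfolding abs_mult using \<kappa>(1) by (intro mult_right_mono) auto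
  \<comment> \<open>The gain \<open>\<sigma> * w\<^sup>2 / 4\<close> comes from convexity, the loss
    \<open>\<kappa> * \<bar>w\<bar>\<close> from the error in the drift, and the loss of order
    \<open>a * \<sigma>\<close> from the unit step size.\<close>
  ultimately have main: "\<sigma> * w\<^sup>2 / 4 - \<kappa> * \<bar>w\<bar> - 3 / 2 * a * \<sigma>
      \<le> D * w + p * (exp (- w - a / 2) - 1) + q * (exp (w - a / 2) - 1)"
    by (simp add: \<sigma>_def algebra_simps abs_le_iff)
  \<comment> \<open>This inequality amounts to \<open>48 * a \<le> \<omega>\<^sup>2\<close> with
    \<open>a = \<omega> / \<beta>\<close>, whence the condition
    \<open>48 \<le> \<omega> * \<beta>\<close>.\<close>
  have a_small: "3 / 2 * a * \<sigma> \<le> \<sigma> * \<omega>\<^sup>2 / 32"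
  proof -
    have "48 * a \<le> \<omega>\<^sup>2" using \<omega>(3) \<beta> mult_left_mono[OF \<omega>(3), of \<omega>] \<omega>(1)
      by (simp add: a_def divide_le_eq power2_eq_square algebra_simps)
    then have "48 * a * \<sigma> \<le> \<omega>\<^sup>2 * \<sigma>" using \<open>\<sigma> > 0\<close> by (intro mult_right_mono) auto
    then show ?thesis by (simp add: algebra_simps)
  qed
  have \<kappa>\<sigma>: "\<kappa> \<le> \<sigma> * \<omega> / 16"
  proof -
    have "p * \<omega> \<le> \<sigma> * \<omega>" using p \<omega> by (intro mult_right_mono) (auto simp: \<sigma>_def)
    then show ?thesis using \<kappa>(2) by linarith
  qed
  have \<kappa>0: "0 \<le> \<kappa>" using \<kappa>(1) by linarith
  have h: "0 < hill \<beta> \<omega> z" using z by (simp add: hill_pos_iff \<beta> \<omega>)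
  have "0 \<le> hill \<beta> \<omega> z * (\<sigma> * \<omega>\<^sup>2 / 8) + G *
      (D * w + p * (exp (- w - a / 2) - 1) + q * (exp (w - a / 2) - 1))"
  proof (cases "\<bar>z\<bar> \<le> \<beta> / 2")
    \<comment> \<open>Here \<open>\<bar>w\<bar>\<close> is at least \<open>\<omega> / 2\<close>, and
      after the drift error the convexity gain still leaves
      \<open>\<sigma> * \<omega>\<^sup>2 / 32\<close>, exactly what the step size may cost.\<close>
    case False
    have wl: "\<omega> / 2 \<le> \<bar>w\<bar>"
    proof -
      have "a * (\<beta> / 2) \<le> a * \<bar>z\<bar>" using False a by (intro mult_left_mono) auto
      then show ?thesis using \<beta> a \<omega> by (simp add: w_def abs_mult a_def)
    qed
    have "\<omega> / 2 * (\<sigma> * \<omega> / 16) \<le> \<bar>w\<bar> * (\<sigma> * \<bar>w\<bar> / 4 - \<kappa>)"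
    proof (rule mult_mono)
      have "\<sigma> * (\<omega> / 2) \<le> \<sigma> * \<bar>w\<bar>" using wl \<open>\<sigma> > 0\<close> by (intro mult_left_mono) auto
      then show "\<sigma> * \<omega> / 16 \<le> \<sigma> * \<bar>w\<bar> / 4 - \<kappa>" using \<kappa>\<sigma> by simp
    qed (use wl \<omega> \<open>\<sigma> > 0\<close> in auto)
    also have "\<dots> = \<sigma> * w\<^sup>2 / 4 - \<kappa> * \<bar>w\<bar>" by (simp add: algebra_simps power2_eq_square)
    finally have "\<sigma> * \<omega>\<^sup>2 / 32 \<le> \<sigma> * w\<^sup>2 / 4 - \<kappa> * \<bar>w\<bar>" by (simp add: power2_eq_square mult_ac)
    then have "0 \<le> D * w + p * (exp (- w - a / 2) - 1) + q * (exp (w - a / 2) - 1)"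
      using main a_small by linarith
    then have "0 \<le> G * (D * w + p * (exp (- w - a / 2) - 1) + q * (exp (w - a / 2) - 1))"
      by (rule mult_nonneg_nonneg[rotated]) (simp add: G_def)
    moreover have "0 \<le> hill \<beta> \<omega> z * (\<sigma> * \<omega>\<^sup>2 / 8)" using h \<open>\<sigma> > 0\<close> by simp
    ultimately show ?thesis by linarith
  next
    \<comment> \<open>The two losses add up to at most
      \<open>\<sigma> * \<omega>\<^sup>2 / 16\<close>; as the Gaussian is at most twice the hump
      here, the zero-order term with \<open>\<omega>\<^sup>2 / 8\<close> absorbs them.\<close>
    case True
    have wl: "\<bar>w\<bar> \<le> \<omega> / 2"
    proof -
      have "a * \<bar>z\<bar> \<le> a * (\<beta> / 2)" using True a by (intro mult_left_mono) auto
      then show ?thesis using \<beta> a \<omega> by (simp add: w_def abs_mult a_def)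
    qed
    have "\<kappa> * \<bar>w\<bar> \<le> \<sigma> * \<omega> / 16 * (\<omega> / 2)"
      using \<kappa>\<sigma> wl \<open>\<sigma> > 0\<close> \<omega> by (intro mult_mono) auto
    then have "\<kappa> * \<bar>w\<bar> \<le> \<sigma> * \<omega>\<^sup>2 / 32" by (simp add: power2_eq_square mult_ac)
    moreover have "0 \<le> \<sigma> * w\<^sup>2 / 4" using \<open>\<sigma> > 0\<close> by simp
    ultimately have lo: "- (\<sigma> * \<omega>\<^sup>2 / 16) \<le> D * w + p * (exp (- w - a / 2) - 1) + q * (exp (w - a / 2) - 1)"
      using main a_small by linarith
    have "G \<le> 2 * hill \<beta> \<omega> z" using hill_core(1)[OF \<beta> \<omega>(1,3) True] by (simp add: G_def a_def)
    then have "G * (\<sigma> * \<omega>\<^sup>2 / 16) \<le> 2 * hill \<beta> \<omega> z * (\<sigma> * \<omega>\<^sup>2 / 16)"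
      using \<open>\<sigma> > 0\<close> by (intro mult_right_mono) auto
    moreover have "G * - (\<sigma> * \<omega>\<^sup>2 / 16) \<le> G * (D * w + p * (exp (- w - a / 2) - 1) + q * (exp (w - a / 2) - 1))"
      using lo by (intro mult_left_mono) (auto simp: G_def)
    moreover have "hill \<beta> \<omega> z * (\<sigma> * \<omega>\<^sup>2 / 8) = 2 * hill \<beta> \<omega> z * (\<sigma> * \<omega>\<^sup>2 / 16)" by simp
    ultimately show ?thesis by linarith
  qed
  then show ?thesis by (simp add: w_def \<sigma>_def G_def)
qed

text \<open>The tilt \<open>e\<close> factors out of the three values and turns the rates
  \<open>la\<close> and \<mu> into \<open>la * u\<close> and \<open>\<mu> / u\<close>; what remains
  is \<open>hill_generator\<close> plus the Legendre expression at \<open>ln u\<close>. The rate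
  \<mu> is the current one, while \<open>u\<close> may belong to another rate, and \<kappa> measures
  the mismatch.\<close>

lemma tilted_hill_generator:
  fixes la \<mu> u :: real
  assumes \<beta>: "0 < \<beta>" and \<omega>: "0 < \<omega>" "\<omega> \<le> 1" "48 \<le> \<omega> * \<beta>" and z: "\<bar>z\<bar> < \<beta>"
    and la: "0 < la" "0 \<le> \<mu>" and u: "0 < u"
    and \<kappa>: "\<bar>D - (la * u - \<mu> / u)\<bar> \<le> \<kappa>" "\<kappa> \<le> la * u * \<omega> / 16"
    and cr: "ln u * D - la * (u - 1) - \<mu> * (1 / u - 1) + (la * u + \<mu> / u) * \<omega>\<^sup>2 / 8 \<le> cr"
    and F: "F = tilted_hill (ln u) \<beta> \<omega>"
    and d: "d = - D * (exp (ln u * z - \<bar>ln u\<bar> * \<beta>) *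
       (ln u * hill \<beta> \<omega> z - \<omega> / \<beta> * z * exp (- (\<omega> / \<beta>) * z\<^sup>2 / 2)))"
  shows "0 \<le> d + (la * (F (z + 1) - F z) + \<mu> * (F (z - 1) - F z)) + cr * F z"
proof -
  define a where "a = \<omega> / \<beta>"
  define e where "e = exp (ln u * z - \<bar>ln u\<bar> * \<beta>)"
  define G where "G = exp (- a * z\<^sup>2 / 2)"
  define B where "B = exp (- \<omega> * \<beta> / 2)"
  define H where "H = hill \<beta> \<omega> z"
  have H: "H = G - B" "0 < H"
    using z by (auto simp: H_def hill_def G_def B_def a_def hill_pos_iff[OF \<beta> \<omega>(1), symmetric])
  have Fz: "F z = e * H" using H(2) by (simp add: F tilted_hill_def e_def H_def)
  \<comment> \<open>At the neighbours only inequalities hold: cutting at 0 can raise the value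
    there, which is the favourable direction.\<close>
  have up: "e * (u * (G * exp (- (a * z) - a / 2) - B)) \<le> F (z + 1)"
  proof -
    have "exp (ln u * (z + 1) - \<bar>ln u\<bar> * \<beta>) = e * u"
      using u by (simp add: e_def exp_add[symmetric] algebra_simps) (simp add: exp_add exp_diff)
    moreover have "exp (- (\<omega> / \<beta>) * (z + 1)\<^sup>2 / 2) = G * exp (- (a * z) - a / 2)"
      unfolding a_def[symmetric] G_def exp_add[symmetric] by (simp add: power2_eq_square field_simps)
    ultimately show ?thesis using u
      by (auto simp: F tilted_hill_def hill_def B_def e_def mult.assoc intro!: mult_left_mono)
  qed
  have dn: "e * (1 / u * (G * exp (a * z - a / 2) - B)) \<le> F (z - 1)"
  proof -
    have "exp (ln u * (z - 1) - \<bar>ln u\<bar> * \<beta>) = e * (1 / u)"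
      using u by (simp add: e_def algebra_simps) (simp add: exp_add exp_diff)
    moreover have "exp (- (\<omega> / \<beta>) * (z - 1)\<^sup>2 / 2) = G * exp (a * z - a / 2)"
      unfolding a_def[symmetric] G_def exp_add[symmetric] by (simp add: power2_eq_square field_simps)
    ultimately show ?thesis using u
      by (auto simp: F tilted_hill_def hill_def B_def e_def mult.assoc intro!: mult_left_mono divide_right_mono)
  qed
  define A where "A = D * (a * z) + la * u * (exp (- (a * z) - a / 2) - 1) + \<mu> / u * (exp (a * z - a / 2) - 1)"
  define K where "K = ln u * D - la * (u - 1) - \<mu> * (1 / u - 1)"
  define K' where "K' = (la * u + \<mu> / u) * \<omega>\<^sup>2 / 8"
  have gen: "0 \<le> H * K' + G * A"
    unfolding H_def G_def a_def A_def K'_def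
    by (rule hill_generator[OF \<beta> \<omega> z _ _ \<kappa>]) (use la u in auto)
  have "H * (K + K') \<le> H * cr"
    using cr H(2) unfolding K_def K'_def by (intro mult_left_mono) auto
  with gen have "0 \<le> G * A - H * K + H * cr" by (simp add: algebra_simps)
  also have "\<dots> = - D * (ln u * H - a * z * G)
      + (la * (u * (G * exp (- (a * z) - a / 2) - B) - H) + \<mu> * (1 / u * (G * exp (a * z - a / 2) - B) - H)) + cr * H"
    unfolding H(1) A_def K_def by (simp add: algebra_simps add_divide_distrib diff_divide_distrib)
  finally have "0 \<le> - D * (ln u * H - a * z * G)
      + (la * (u * (G * exp (- (a * z) - a / 2) - B) - H) + \<mu> * (1 / u * (G * exp (a * z - a / 2) - B) - H)) + cr * H" .
  then have "0 \<le> e * (- D * (ln u * H - a * z * G)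
      + (la * (u * (G * exp (- (a * z) - a / 2) - B) - H) + \<mu> * (1 / u * (G * exp (a * z - a / 2) - B) - H)) + cr * H)"
    by (intro mult_nonneg_nonneg) (auto simp: e_def)
  also have "\<dots> = d + (la * (e * (u * (G * exp (- (a * z) - a / 2) - B)) - F z)
      + \<mu> * (e * (1 / u * (G * exp (a * z - a / 2) - B)) - F z)) + cr * F z"
    unfolding Fz d e_def[symmetric] a_def[symmetric] G_def[symmetric] H_def[symmetric] by (simp add: algebra_simps)
  also have "\<dots> \<le> d + (la * (F (z + 1) - F z) + \<mu> * (F (z - 1) - F z)) + cr * F z"
    using up dn la by (intro add_mono mult_left_mono diff_right_mono order_refl) auto
  finally show ?thesis .
qed

lemma continuous_tilted_hill: "continuous_on UNIV (\<lambda>t. tilted_hill \<theta> \<beta> \<omega> (v - D * t))"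
  unfolding tilted_hill_def hill_def by (intro continuous_intros) auto

text \<open>Inside the open tube the cut at 0 is inactive near \<open>t\<close>, so the smooth
  formula may be differentiated.\<close>

lemma tilted_hill_deriv:
  assumes "0 < \<beta>" "0 < \<omega>" "\<bar>v - D * t\<bar> < \<beta>"
  shows "((\<lambda>t. tilted_hill \<theta> \<beta> \<omega> (v - D * t)) has_real_derivative
    - D * (exp (\<theta> * (v - D * t) - \<bar>\<theta>\<bar> * \<beta>) *
       (\<theta> * hill \<beta> \<omega> (v - D * t) - \<omega> / \<beta> * (v - D * t) * exp (- (\<omega> / \<beta>) * (v - D * t)\<^sup>2 / 2)))) (at t)"
proof -
  let ?g = "\<lambda>t. exp (\<theta> * (v - D * t) - \<bar>\<theta>\<bar> * \<beta>) * hill \<beta> \<omega> (v - D * t)"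
  have "open {t. \<bar>v - D * t\<bar> < \<beta>}" by (intro open_Collect_less continuous_intros)
  then have ev: "eventually (\<lambda>t. tilted_hill \<theta> \<beta> \<omega> (v - D * t) = ?g t) (nhds t)"
    using eventually_nhds_in_open[of "{t. \<bar>v - D * t\<bar> < \<beta>}" t] assms
    by (auto elim!: eventually_mono simp: tilted_hill_def hill_pos_iff[OF assms(1,2), symmetric])
  have "(?g has_real_derivative
    - D * (exp (\<theta> * (v - D * t) - \<bar>\<theta>\<bar> * \<beta>) *
       (\<theta> * hill \<beta> \<omega> (v - D * t) - \<omega> / \<beta> * (v - D * t) * exp (- (\<omega> / \<beta>) * (v - D * t)\<^sup>2 / 2)))) (at t)"
  proof -
    define a where "a = \<omega> / \<beta>"
    show ?thesis
      unfolding hill_def a_def[symmetric]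
      by (auto intro!: derivative_eq_intros) (simp add: algebra_simps)
  qed
  then show ?thesis by (subst DERIV_cong_ev[OF refl ev refl])
qed

section \<open>Exponential barriers\<close>

definition barrier :: "real \<Rightarrow> real \<Rightarrow> real \<Rightarrow> real" where
  "barrier \<alpha> b v = max 0 (1 - exp (\<alpha> * (v - b)))"

lemma barrier_bounds: "0 \<le> barrier \<alpha> b v" "barrier \<alpha> b v \<le> 1"
  by (auto simp: barrier_def)

lemma barrier_pos_iff: "0 < \<alpha> \<Longrightarrow> 0 < barrier \<alpha> b v \<longleftrightarrow> v < b"
  by (auto simp: barrier_def less_max_iff_disj mult_less_0_iff)

lemma barrier_ge_half:
  assumes "0 < \<alpha>" "1 \<le> \<alpha> * (b - v)"
  shows "1 / 2 \<le> barrier \<alpha> b v"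
proof -
  have "exp (\<alpha> * (v - b)) \<le> 1 / 2" using exp_minus_le_half[OF assms(2)] by (simp add: algebra_simps)
  then show ?thesis unfolding barrier_def by (intro max.coboundedI2) simp
qed

text \<open>In the layer of width \<open>g\<close> below \<open>b\<close>, the condition
  \<open>la * exp \<alpha> \<le> \<mu>\<close> makes \<open>exp (\<alpha> * v)\<close> decrease on
  average, so nothing is lost. Further down the barrier is at least 1/2, while its loss rate is at
  most \<open>la * (exp \<alpha> - 1) * exp (- \<alpha> * g)\<close>, which \<open>q\<close>
  pays.\<close>

lemma barrier_generator:
  assumes \<alpha>: "0 < \<alpha>" and la: "0 < la" "0 \<le> \<mu>" and v: "v < b"
    and drift: "b - g \<le> v \<Longrightarrow> la * exp \<alpha> \<le> \<mu>"
    and g: "1 \<le> \<alpha> * g" "la * (exp \<alpha> - 1) * exp (- \<alpha> * g) \<le> q / 2"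
  shows "0 \<le> la * (barrier \<alpha> b (v + 1) - barrier \<alpha> b v) + \<mu> * (barrier \<alpha> b (v - 1) - barrier \<alpha> b v) + q * barrier \<alpha> b v"
proof -
  define E where "E = exp (\<alpha> * (v - b))"
  have E: "0 < E" "E < 1" using \<alpha> v by (auto simp: E_def mult_less_0_iff)
  have "0 \<le> la * (exp \<alpha> - 1) * exp (- \<alpha> * g)" using la \<alpha> by (intro mult_nonneg_nonneg) auto
  then have q: "0 \<le> q" using g(2) by linarith
  have bv: "barrier \<alpha> b v = 1 - E" using E by (simp add: barrier_def E_def)
  have up: "1 - E * exp \<alpha> \<le> barrier \<alpha> b (v + 1)"
    by (simp add: barrier_def E_def exp_add[symmetric] algebra_simps)
  have dn: "1 - E * exp (- \<alpha>) \<le> barrier \<alpha> b (v - 1)"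
    by (simp add: barrier_def E_def exp_add[symmetric] algebra_simps)
  have "0 \<le> la * (1 - E * exp \<alpha> - (1 - E)) + \<mu> * (1 - E * exp (- \<alpha>) - (1 - E)) + q * (1 - E)"
  proof (cases "b - g \<le> v")
    case True
    have "la * (exp \<alpha> - 1) = la * exp \<alpha> * (1 - exp (- \<alpha>))" by (simp add: exp_minus field_simps)
    also have "\<dots> \<le> \<mu> * (1 - exp (- \<alpha>))" using drift[OF True] \<alpha> by (intro mult_right_mono) auto
    finally have "0 \<le> E * (\<mu> * (1 - exp (- \<alpha>)) - la * (exp \<alpha> - 1)) + q * (1 - E)"
      using E q by (intro add_nonneg_nonneg mult_nonneg_nonneg) auto
    then show ?thesis by (simp add: algebra_simps)
  next
    case False
    have Eg: "E \<le> exp (- \<alpha> * g)"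
      unfolding E_def using False \<alpha> mult_left_mono[of "v - b" "- g" \<alpha>] by simp
    then have "E \<le> 1 / 2" using exp_minus_le_half[OF g(1)] by simp
    have "la * (exp \<alpha> - 1) * E \<le> la * (exp \<alpha> - 1) * exp (- \<alpha> * g)"
      using Eg la \<alpha> by (intro mult_left_mono) auto
    then have "la * (exp \<alpha> - 1) * E \<le> q * (1 - E)"
      using g(2) mult_left_mono[of "1 / 2" "1 - E" q] q \<open>E \<le> 1 / 2\<close> by simp
    moreover have "0 \<le> \<mu> * (E - E * exp (- \<alpha>))" using la \<alpha> E by (intro mult_nonneg_nonneg) auto
    ultimately show ?thesis by (simp add: algebra_simps)
  qed
  also have "\<dots> \<le> la * (barrier \<alpha> b (v + 1) - barrier \<alpha> b v) + \<mu> * (barrier \<alpha> b (v - 1) - barrier \<alpha> b v) + q * barrier \<alpha> b v"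
    unfolding bv using up dn la q by (intro add_mono mult_left_mono) auto
  finally show ?thesis .
qed

section \<open>Norms on finitely supported vectors\<close>

definition unit_vec :: "route \<Rightarrow> vec" where
  "unit_vec r = (\<lambda>s. if s = r then 1 else 0)"

lemma norm_add:
  "is_norm_on R nrm \<Longrightarrow> v \<in> Rsub R \<Longrightarrow> w \<in> Rsub R \<Longrightarrow> nrm (\<lambda>r. v r + w r) \<le> nrm v + nrm w"
  by (simp add: is_norm_on_def)

lemma norm_scale: "is_norm_on R nrm \<Longrightarrow> v \<in> Rsub R \<Longrightarrow> nrm (\<lambda>r. c * v r) = \<bar>c\<bar> * nrm v"
  by (simp add: is_norm_on_def)

text \<open>\<open>nrm\<close> obeys the norm axioms on \<open>Rsub R\<close> only, so the induction
  over the support keeps every intermediate vector in that subspace.\<close>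

lemma norm_le_sum:
  assumes nrm: "is_norm_on R nrm" and "finite R" "v \<in> Rsub R"
  shows "nrm v \<le> (\<Sum>r\<in>R. \<bar>v r\<bar> * nrm (unit_vec r))"
proof -
  have *: "nrm v \<le> (\<Sum>r\<in>A. \<bar>v r\<bar> * nrm (unit_vec r))" if "finite A" "A \<subseteq> R" "v \<in> Rsub A" for A v
    using that
  proof (induction A arbitrary: v rule: finite_induct)
    case empty
    then have "v = (\<lambda>_. 0)" by (auto simp: Rsub_def)
    moreover have "(\<lambda>_. 0) \<in> Rsub R" by (simp add: Rsub_def)
    ultimately have "nrm v = 0" using nrm unfolding is_norm_on_def by blast
    then show ?case by simp
  next
    case (insert r A)
    have e: "unit_vec r \<in> Rsub R" using insert.prems by (auto simp: unit_vec_def Rsub_def)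
    have w: "v(r := 0) \<in> Rsub R" "v(r := 0) \<in> Rsub A" using insert.prems by (auto simp: Rsub_def)
    have c: "(\<lambda>s. v r * unit_vec r s) \<in> Rsub R" using e by (simp add: Rsub_def)
    have "v = (\<lambda>s. (v(r := 0)) s + v r * unit_vec r s)" by (auto simp: unit_vec_def)
    then have "nrm v = nrm (\<lambda>s. (v(r := 0)) s + v r * unit_vec r s)" by simp
    also have "\<dots> \<le> nrm (v(r := 0)) + nrm (\<lambda>s. v r * unit_vec r s)"
      by (rule norm_add[OF nrm w(1) c])
    also have "nrm (\<lambda>s. v r * unit_vec r s) = \<bar>v r\<bar> * nrm (unit_vec r)"
      by (rule norm_scale[OF nrm e])
    also have "nrm (v(r := 0)) \<le> (\<Sum>s\<in>A. \<bar>(v(r := 0)) s\<bar> * nrm (unit_vec s))"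
      by (rule insert.IH[OF _ w(2)]) (use insert.prems in auto)
    also have "\<dots> = (\<Sum>s\<in>A. \<bar>v s\<bar> * nrm (unit_vec s))"
      using insert.hyps by (intro sum.cong) auto
    finally show ?case using insert.hyps by simp
  qed
  show ?thesis using * assms(2,3) by blast
qed

lemma norm_nonneg: "is_norm_on R nrm \<Longrightarrow> v \<in> Rsub R \<Longrightarrow> 0 \<le> nrm v"
  by (simp add: is_norm_on_def)

lemma unit_vec_Rsub: "r \<in> R \<Longrightarrow> unit_vec r \<in> Rsub R"
  by (auto simp: unit_vec_def Rsub_def)

lemma norm_upper:
  assumes nrm: "is_norm_on R nrm" and "finite R"
  obtains a where "0 < a" "\<And>v b. v \<in> Rsub R \<Longrightarrow> 0 \<le> b \<Longrightarrow> (\<And>r. r \<in> R \<Longrightarrow> \<bar>v r\<bar> \<le> b) \<Longrightarrow> nrm v \<le> a * b"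
proof (rule that[of "1 + (\<Sum>r\<in>R. nrm (unit_vec r))"])
  have n: "0 \<le> nrm (unit_vec r)" if "r \<in> R" for r
    using norm_nonneg[OF nrm unit_vec_Rsub[OF that]] .
  then have s: "0 \<le> (\<Sum>r\<in>R. nrm (unit_vec r))" by (intro sum_nonneg)
  then show "0 < 1 + (\<Sum>r\<in>R. nrm (unit_vec r))" by linarith
  fix v b assume v: "v \<in> Rsub R" "0 \<le> b" "\<And>r. r \<in> R \<Longrightarrow> \<bar>v r\<bar> \<le> b"
  have "nrm v \<le> (\<Sum>r\<in>R. \<bar>v r\<bar> * nrm (unit_vec r))" by (rule norm_le_sum[OF nrm assms(2) v(1)])
  also have "\<dots> \<le> (\<Sum>r\<in>R. b * nrm (unit_vec r))" using v n by (intro sum_mono mult_right_mono)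
  also have "\<dots> \<le> (1 + (\<Sum>r\<in>R. nrm (unit_vec r))) * b"
    using v(2) by (simp add: sum_distrib_left[symmetric] algebra_simps)
  finally show "nrm v \<le> (1 + (\<Sum>r\<in>R. nrm (unit_vec r))) * b" .
qed

lemma norm_diff_le:
  assumes nrm: "is_norm_on R nrm" and "v \<in> Rsub R" "w \<in> Rsub R"
  shows "\<bar>nrm v - nrm w\<bar> \<le> nrm (\<lambda>r. v r - w r)"
proof -
  have d: "(\<lambda>r. v r - w r) \<in> Rsub R" "(\<lambda>r. w r - v r) \<in> Rsub R" using assms(2,3) by (auto simp: Rsub_def)
  have "nrm (\<lambda>r. (v r - w r) + w r) \<le> nrm (\<lambda>r. v r - w r) + nrm w"
    "nrm (\<lambda>r. (w r - v r) + v r) \<le> nrm (\<lambda>r. w r - v r) + nrm v"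
    by (rule norm_add[OF nrm d(1) assms(3)], rule norm_add[OF nrm d(2) assms(2)])
  moreover have "nrm (\<lambda>r. (- 1) * (v r - w r)) = \<bar>- 1\<bar> * nrm (\<lambda>r. v r - w r)"
    by (rule norm_scale[OF nrm d(1)])
  ultimately show ?thesis by simp
qed

lemma continuous_on_norm:
  assumes nrm: "is_norm_on R nrm" and "finite R"
  shows "continuous_on (Rsub R) nrm"
  unfolding continuous_on_def
proof
  fix w assume w: "w \<in> Rsub R"
  have "((\<lambda>v. \<Sum>r\<in>R. \<bar>v r - w r\<bar> * nrm (unit_vec r)) \<longlongrightarrow> (\<Sum>r\<in>R. \<bar>w r - w r\<bar> * nrm (unit_vec r))) (at w within Rsub R)"
  proof (intro tendsto_intros)
    fix r
    have "continuous_on (Rsub R) (\<lambda>v::vec. v r)"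
      by (rule continuous_on_subset[OF continuous_on_product_coordinates]) simp
    then show "((\<lambda>v. v r) \<longlongrightarrow> w r) (at w within Rsub R)" using w by (simp add: continuous_on_def)
  qed
  then have lim: "((\<lambda>v. \<Sum>r\<in>R. \<bar>v r - w r\<bar> * nrm (unit_vec r)) \<longlongrightarrow> 0) (at w within Rsub R)" by simp
  have "((\<lambda>v. nrm v - nrm w) \<longlongrightarrow> 0) (at w within Rsub R)"
  proof (rule Lim_null_comparison[OF _ lim])
    show "\<forall>\<^sub>F v in at w within Rsub R. norm (nrm v - nrm w) \<le> (\<Sum>r\<in>R. \<bar>v r - w r\<bar> * nrm (unit_vec r))"
      unfolding eventually_at_filter
    proof (rule always_eventually, intro allI impI)
      fix v assume v: "v \<in> Rsub R"
      have "(\<lambda>r. v r - w r) \<in> Rsub R" using v w by (simp add: Rsub_def)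
      from norm_diff_le[OF nrm v w] norm_le_sum[OF nrm assms(2) this]
      show "norm (nrm v - nrm w) \<le> (\<Sum>r\<in>R. \<bar>v r - w r\<bar> * nrm (unit_vec r))" by simp
    qed
  qed
  then show "(nrm \<longlongrightarrow> nrm w) (at w within Rsub R)" by (simp add: LIM_zero_iff)
qed

text \<open>Half of the equivalence of norms in finite dimension. The unit cube supported on
  \<open>R\<close> is compact in the product topology, \<open>nrm\<close> is continuous there, and
  on each closed slice where coordinate \<open>r\<close> is 1 or -1 it attains a positive
  minimum.\<close>

lemma norm_lower:
  assumes nrm: "is_norm_on R nrm" and fin: "finite R"
  obtains a where "0 < a" "\<And>v r. v \<in> Rsub R \<Longrightarrow> r \<in> R \<Longrightarrow> \<bar>v r\<bar> \<le> a * nrm v"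
proof -
  define S where "S = (\<lambda>r. if r \<in> R then {-1..1::real} else {0})"
  define B where "B = PiE UNIV S"
  have B: "B = {v. (\<forall>r\<in>R. \<bar>v r\<bar> \<le> 1) \<and> (\<forall>r. r \<notin> R \<longrightarrow> v r = 0)}"
    by (force simp: B_def S_def PiE_def Pi_def abs_le_iff)
  have "compactin (product_topology (\<lambda>_. euclidean) UNIV) B"
    unfolding B_def compactin_PiE by (auto simp: S_def)
  then have cB: "compact B" by (simp add: euclidean_product_topology)
  have BR: "B \<subseteq> Rsub R" by (auto simp: B Rsub_def)
  have "\<exists>c>0. \<forall>v\<in>B. \<bar>v r\<bar> = 1 \<longrightarrow> c \<le> nrm v" if r: "r \<in> R" for r
  proof -
    define K where "K = B \<inter> (\<lambda>v. v r) -` {-1, 1}"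
    have "closed ((\<lambda>v::vec. v r) -` {-1, 1})"
      by (rule closed_vimage) (auto intro: continuous_on_product_coordinates)
    then have "compact K" unfolding K_def by (intro compact_Int_closed cB)
    moreover have "unit_vec r \<in> K" using r by (auto simp: K_def B unit_vec_def)
    moreover have "continuous_on K nrm"
      by (rule continuous_on_subset[OF continuous_on_norm[OF nrm fin]]) (use BR in \<open>auto simp: K_def\<close>)
    ultimately obtain v0 where v0: "v0 \<in> K" "\<And>v. v \<in> K \<Longrightarrow> nrm v0 \<le> nrm v"
      using continuous_attains_inf[of K nrm] by auto
    have "v0 \<in> Rsub R" "v0 \<noteq> (\<lambda>_. 0)" using v0(1) BR by (auto simp: K_def)
    then have "0 < nrm v0" using nrm unfolding is_norm_on_def by (metis less_le)
    moreover have "nrm v0 \<le> nrm v" if "v \<in> B" "\<bar>v r\<bar> = 1" for v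
      using that by (intro v0(2)) (auto simp: K_def abs_if split: if_splits)
    ultimately show ?thesis by blast
  qed
  then obtain c where c: "\<And>r. r \<in> R \<Longrightarrow> 0 < c r"
    "\<And>r v. r \<in> R \<Longrightarrow> v \<in> B \<Longrightarrow> \<bar>v r\<bar> = 1 \<Longrightarrow> c r \<le> nrm v"
    by metis
  define a where "a = 1 + (\<Sum>r\<in>R. 1 / c r)"
  have sn: "0 \<le> (\<Sum>r\<in>R. 1 / c r)" using c(1) by (intro sum_nonneg) (auto simp: less_imp_le)
  have ac: "1 / c r \<le> a" if "r \<in> R" for r
    unfolding a_def using member_le_sum[OF that, of "\<lambda>r. 1 / c r"] fin c(1) by (simp add: less_imp_le)
  show ?thesis
  proof (rule that[of a])
    show "0 < a" using sn by (simp add: a_def)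
    fix v r assume v: "v \<in> Rsub R" and r: "r \<in> R"
    have ne: "finite ((\<lambda>r. \<bar>v r\<bar>) ` R)" "(\<lambda>r. \<bar>v r\<bar>) ` R \<noteq> {}" using fin r by auto
    obtain q where q: "q \<in> R" "\<And>s. s \<in> R \<Longrightarrow> \<bar>v s\<bar> \<le> \<bar>v q\<bar>"
      using Max_in[OF ne] Max_ge[OF ne(1)] by (smt (verit) imageE imageI)
    show "\<bar>v r\<bar> \<le> a * nrm v"
    proof (cases "v q = 0")
      case True
      then show ?thesis using q(2)[OF r] norm_nonneg[OF nrm v] sn by (simp add: a_def)
    next
      case False
      \<comment> \<open>Division by the largest coordinate puts the vector on the slice of that
        coordinate \<open>q\<close>.\<close>
      have "(\<lambda>s. (1 / \<bar>v q\<bar>) * v s) \<in> B"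
        using v q(2) False by (auto simp: B Rsub_def abs_mult divide_le_eq)
      then have "c q \<le> nrm (\<lambda>s. (1 / \<bar>v q\<bar>) * v s)"
        using False by (intro c(2)[OF q(1)]) (auto simp: abs_mult)
      also have "\<dots> = \<bar>1 / \<bar>v q\<bar>\<bar> * nrm v" by (rule norm_scale[OF nrm v])
      finally have "\<bar>v q\<bar> * c q \<le> nrm v" using False by (simp add: field_simps)
      then have "\<bar>v q\<bar> \<le> 1 / c q * nrm v" using c(1)[OF q(1)] by (simp add: field_simps)
      also have "\<dots> \<le> a * nrm v" using ac[OF q(1)] norm_nonneg[OF nrm v] by (rule mult_right_mono)
      finally show ?thesis using q(2)[OF r] by linarith
    qed
  qed
qed

section \<open>Limits and finite minima\<close>

text \<open>Monotonicity alone yields the two inner limits in the extended reals and names them as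
  suprema and infima; only the limit in \<tau> requires estimates.\<close>

lemma antimono_tendsto_SUP:
  fixes f :: "real \<Rightarrow> ereal"
  assumes "\<And>a b. 0 < a \<Longrightarrow> a \<le> b \<Longrightarrow> f b \<le> f a"
  shows "(f \<longlongrightarrow> (SUP a\<in>{0<..}. f a)) (at_right 0)"
proof (rule order_tendstoI)
  fix c assume "c < (SUP a\<in>{0<..}. f a)"
  then obtain b where b: "0 < b" "c < f b" by (auto simp: less_SUP_iff)
  show "eventually (\<lambda>a. c < f a) (at_right 0)"
    by (rule eventually_at_rightI[of 0 b]) (use b assms in \<open>auto intro: less_le_trans less_imp_le\<close>)
next
  fix c assume c: "(SUP a\<in>{0<..}. f a) < c"
  have "f a < c" if "0 < a" for a
    using SUP_upper[of a "{0<..}" f] that c by (auto intro: le_less_trans)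
  then show "eventually (\<lambda>a. f a < c) (at_right 0)"
    by (intro eventually_at_rightI[of 0 1]) auto
qed

lemma mono_tendsto_INF:
  fixes f :: "real \<Rightarrow> ereal"
  assumes "\<And>a b. 0 < a \<Longrightarrow> a \<le> b \<Longrightarrow> f a \<le> f b"
  shows "(f \<longlongrightarrow> (INF a\<in>{0<..}. f a)) (at_right 0)"
proof (rule order_tendstoI)
  fix c assume "(INF a\<in>{0<..}. f a) < c"
  then obtain b where b: "0 < b" "f b < c" by (auto simp: INF_less_iff)
  show "eventually (\<lambda>a. f a < c) (at_right 0)"
    by (rule eventually_at_rightI[of 0 b]) (use b assms in \<open>auto intro: le_less_trans less_imp_le\<close>)
next
  fix c assume c: "c < (INF a\<in>{0<..}. f a)"
  have "c < f a" if "0 < a" for a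
    using INF_lower[of a "{0<..}" f] that c by (auto intro: less_le_trans)
  then show "eventually (\<lambda>a. c < f a) (at_right 0)"
    by (intro eventually_at_rightI[of 0 1]) auto
qed

lemma eventually_real_ge: "eventually (\<lambda>n. a \<le> s * real n) sequentially" if "0 < s" for a s :: real
proof -
  obtain k where "a / s \<le> real k" using real_arch_simple by blast
  then show ?thesis
    using that by (intro eventually_sequentiallyI[of k]) (simp add: divide_le_eq mult.commute, smt (verit) mult_left_mono of_nat_mono)
qed

lemma uniform_positive:
  assumes "finite A" "\<And>a. a \<in> A \<Longrightarrow> 0 < (f a :: real)"
  obtains g where "0 < g" "\<And>a. a \<in> A \<Longrightarrow> g \<le> f a"
proof (rule that[of "Min (insert 1 (f ` A))"])
  show "0 < Min (insert 1 (f ` A))" using assms by (subst Min_gr_iff) auto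
  show "Min (insert 1 (f ` A)) \<le> f a" if "a \<in> A" for a using assms that by (intro Min_le) auto
qed

lemma eln_mono: "p \<le> q \<Longrightarrow> eln p \<le> eln q"
  by (auto simp: eln_def)

lemma eln_exp [simp]: "eln (exp a) = ereal a"
  by (simp add: eln_def)

lemma scaled_ereal: "0 < c \<Longrightarrow> ereal (1 / c) * ereal (a * c) = ereal a"
  by simp

lemma scale_mono: "0 < c \<Longrightarrow> a \<le> b \<Longrightarrow> ereal (1 / c) * a \<le> ereal (1 / c) * b"
  by (intro ereal_mult_left_mono) auto

section \<open>The uniformized jump process\<close>

fun total_weight :: "(route \<times> real \<times> real) list \<Rightarrow> real" where
  "total_weight [] = 0"
| "total_weight ((r, s, w) # es) = w + total_weight es"

fun weighted_sum :: "((route \<times> real) option \<Rightarrow> ennreal) \<Rightarrow> (route \<times> real \<times> real) list \<Rightarrow> ennreal" where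
  "weighted_sum g [] = 0"
| "weighted_sum g ((r, s, w) # es) = ennreal w * g (Some (r, s)) + weighted_sum g es"

lemma measurable_pick [measurable]: "pick es \<in> borel \<rightarrow>\<^sub>M count_space UNIV"
proof (induction es)
  case Nil
  then show ?case by (simp cong: measurable_cong)
next
  case (Cons e es)
  obtain r s w where e: "e = (r, s, w)" by (cases e)
  note Cons.IH [measurable]
  have "(\<lambda>u. if u < w then Some (r, s) else pick es (u - w)) \<in> borel \<rightarrow>\<^sub>M count_space UNIV"
    by measurable
  then show ?case unfolding e by (simp cong: measurable_cong)
qed

text \<open>An event of weight 0 is never drawn. This keeps the chain in the nonnegative orthant,
  since a departure from an empty route has rate 0.\<close>

lemma pick_weight_pos:
  assumes "pick es u = Some (r, s)" "0 \<le> u"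
  shows "\<exists>w > 0. (r, s, w) \<in> set es"
  using assms
proof (induction es u rule: pick.induct)
  case (2 r' s' w es u)
  show ?case
  proof (cases "u < w")
    case True
    with 2 show ?thesis by (intro exI[of _ w]) auto
  next
    case False
    with 2 obtain w' where "0 < w'" "(r, s, w') \<in> set es" by auto
    then show ?thesis by auto
  qed
qed simp

lemma pick_mem:
  assumes "pick es u = Some (r, s)"
  shows "\<exists>w. (r, s, w) \<in> set es"
  using assms by (induction es u rule: pick.induct) (auto split: if_splits)

lemma total_weight_nonneg:
  assumes "\<And>r s w. (r, s, w) \<in> set es \<Longrightarrow> 0 \<le> w"
  shows "0 \<le> total_weight es"
  using assms
proof (induction es)
  case (Cons e es)
  obtain r s w where e: "e = (r, s, w)" by (cases e)
  have "0 \<le> w" "0 \<le> total_weight es"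
    using Cons.prems[of r s w] Cons.IH Cons.prems e by auto
  then show ?case by (simp add: e)
qed simp

text \<open>\<open>pick\<close> cuts \<open>{0..W}\<close> into consecutive intervals whose lengths
  are the weights, and the remainder gives \<open>None\<close>. The induction removes the first
  interval and shifts the rest by \<open>w\<close>.\<close>

lemma nn_integral_pick:
  assumes "\<And>r s w. (r, s, w) \<in> set es \<Longrightarrow> 0 \<le> w" "total_weight es \<le> W"
  shows "(\<integral>\<^sup>+v. g (pick es v) * indicator {0..W} v \<partial>lborel) =
    weighted_sum g es + ennreal (W - total_weight es) * g None"
  using assms
proof (induction es arbitrary: W)
  case Nil
  then show ?case by (simp add: nn_integral_cmult ac_simps)
next
  case (Cons e es)
  obtain r s w where e: "e = (r, s, w)" by (cases e)
  have w: "0 \<le> w" using Cons.prems(1)[of r s w] e by simp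
  have tw: "0 \<le> total_weight es" using Cons.prems(1) by (intro total_weight_nonneg) auto
  have wW: "w \<le> W" "total_weight es \<le> W - w" using Cons.prems(2) tw e by auto
  have "(\<integral>\<^sup>+v. g (pick (e # es) v) * indicator {0..W} v \<partial>lborel)
      = (\<integral>\<^sup>+v. g (Some (r, s)) * indicator {0..<w} v
          + g (pick es (v - w)) * indicator {w..W} v \<partial>lborel)"
    using w wW by (intro nn_integral_cong) (auto simp: e indicator_def)
  also have "\<dots> = (\<integral>\<^sup>+v. g (Some (r, s)) * indicator {0..<w} v \<partial>lborel)
      + (\<integral>\<^sup>+v. g (pick es (v - w)) * indicator {w..W} v \<partial>lborel)"
  proof (intro nn_integral_add)
    have [measurable]: "(\<lambda>v. g (pick es (v - w))) \<in> borel_measurable borel"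
      by (rule measurable_compose[where g=g and N="count_space UNIV"]) measurable
    show "(\<lambda>v. g (pick es (v - w)) * indicator {w..W} v) \<in> borel_measurable lborel"
      by measurable
  qed measurable
  also have "(\<integral>\<^sup>+v. g (Some (r, s)) * indicator {0..<w} v \<partial>lborel) = ennreal w * g (Some (r, s))"
    using w by (subst nn_integral_cmult) (auto simp: mult.commute)
  also have "(\<integral>\<^sup>+v. g (pick es (v - w)) * indicator {w..W} v \<partial>lborel)
      = (\<integral>\<^sup>+v. g (pick es v) * indicator {0..W - w} v \<partial>lborel)"
  proof (subst nn_integral_real_affine[where c=1 and t=w])
    have [measurable]: "(\<lambda>v. g (pick es (v - w))) \<in> borel_measurable borel"
      by (rule measurable_compose[where g=g and N="count_space UNIV"]) measurable
    show "(\<lambda>v. g (pick es (v - w)) * indicator {w..W} v) \<in> borel_measurable borel"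
      by measurable
  qed (auto intro!: nn_integral_cong simp: indicator_def)
  also have "\<dots> = weighted_sum g es + ennreal (W - w - total_weight es) * g None"
    using Cons.prems(1) wW by (intro Cons.IH) auto
  finally show ?case by (simp add: e algebra_simps)
qed

lemma total_weight_append: "total_weight (xs @ ys) = total_weight xs + total_weight ys"
  by (induction xs rule: total_weight.induct) auto

lemma weighted_sum_append: "weighted_sum g (xs @ ys) = weighted_sum g xs + weighted_sum g ys"
  by (induction g xs rule: weighted_sum.induct) (auto simp: ac_simps)

lemma on_ch_endpoints: "on_ch (fst r) r" "on_ch (snd r) r"
  by (auto simp: on_ch_def)

section \<open>Rates, jump chain and one-step averages\<close>

locale star_network =
  fixes N :: nat and C :: "nat \<Rightarrow> real" and lam mu :: "route \<Rightarrow> real"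
  assumes C_pos: "\<forall>i\<in>{1..N}. C i > 0"
    and lam_nonneg: "\<forall>r\<in>routes N. lam r \<ge> 0"
    and mu_pos: "\<forall>r\<in>routes N. mu r > 0"
begin

abbreviation "R \<equiv> active N lam"
abbreviation "W \<equiv> unif_rate N C lam mu"
abbreviation "m \<equiv> murate R C mu"
abbreviation "step' \<equiv> step N C lam mu"
abbreviation "chain' \<equiv> chain N C lam mu"
abbreviation "Q \<equiv> Qproc N C lam mu"
abbreviation "P \<equiv> path_space N C lam mu"

lemma finite_routes: "finite (routes N)"
  by (rule finite_subset[of _ "{0..N} \<times> {0..N}"]) (auto simp: routes_def)

lemma finite_R [simp, intro]: "finite R"
  using finite_routes by (simp add: active_def)

lemma R_D:
  assumes "r \<in> R"
  shows "lam r > 0" "mu r > 0" "C (fst r) > 0" "C (snd r) > 0"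
    "fst r \<in> {1..N}" "snd r \<in> {1..N}" "fst r \<noteq> snd r"
  using assms C_pos mu_pos by (auto simp: active_def routes_def)

lemma Zplus_Rplus: "x \<in> Zplus R \<Longrightarrow> x \<in> Rplus R"
  by (auto simp: Zplus_def Rplus_def Nats_def)

lemma load_ge: "x \<in> Rplus R \<Longrightarrow> r \<in> R \<Longrightarrow> on_ch i r \<Longrightarrow> x r \<le> load R x i"
  unfolding load_def by (rule member_le_sum) (auto simp: Rplus_def)

text \<open>As \<open>x r\<close> never exceeds the load of either of its channels, the share served
  is at most a capacity. Bounded rates are what makes uniformization with a constant
  \<open>W\<close> legitimate.\<close>

lemma m_bounds:
  assumes "x \<in> Rplus R" "r \<in> R"
  shows "0 \<le> m x r" "m x r \<le> mu r * (C (fst r) + C (snd r))"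
proof -
  note r = R_D[OF assms(2)]
  have l: "x r \<le> load R x (fst r)" "x r \<le> load R x (snd r)"
    using load_ge[OF assms] on_ch_endpoints by auto
  show "0 \<le> m x r" using l r by (auto simp: murate_def nu_def)
  have "nu R C x r \<le> C (fst r) + C (snd r)"
  proof (cases "x r > 0")
    case True
    have "x r * min (C (fst r) / load R x (fst r)) (C (snd r) / load R x (snd r))
        \<le> load R x (fst r) * (C (fst r) / load R x (fst r))"
      using True l r by (intro mult_mono) auto
    also have "\<dots> = C (fst r)" using True l by simp
    finally show ?thesis using True r by (simp add: nu_def)
  qed (use r in \<open>simp add: nu_def\<close>)
  then show "m x r \<le> mu r * (C (fst r) + C (snd r))"
    using r by (simp add: murate_def)
qed

lemma W_pos: "W \<ge> 1"
proof -
  have "0 \<le> (\<Sum>r\<in>R. lam r + mu r * (C (fst r) + C (snd r)))"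
    by (intro sum_nonneg add_nonneg_nonneg mult_nonneg_nonneg) (use R_D in \<open>auto intro: less_imp_le\<close>)
  then show ?thesis by (simp add: unif_rate_def)
qed

lemma rates_le_W:
  assumes "x \<in> Rplus R"
  shows "(\<Sum>r\<in>R. lam r + m x r) \<le> W"
proof -
  have "(\<Sum>r\<in>R. lam r + m x r) \<le> (\<Sum>r\<in>R. lam r + mu r * (C (fst r) + C (snd r)))"
    by (intro sum_mono) (use m_bounds[OF assms] in auto)
  then show ?thesis by (simp add: unif_rate_def)
qed

lemma rate_le_W:
  assumes "x \<in> Rplus R" "r \<in> R"
  shows "lam r + m x r \<le> W" "lam r \<le> W"
proof -
  have "lam r + m x r \<le> (\<Sum>r\<in>R. lam r + m x r)"
    using assms m_bounds(1) R_D(1) by (intro member_le_sum) (auto simp: less_imp_le)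
  then show "lam r + m x r \<le> W" using rates_le_W[OF assms(1)] by linarith
  then show "lam r \<le> W" using m_bounds(1)[OF assms] by linarith
qed

definition route_list :: "route list" where
  "route_list = [(i, j). i \<leftarrow> [1..<N+1], j \<leftarrow> [i+1..<N+1], lam (i, j) > 0]"

lemma set_route_list: "set route_list = R"
  by (auto simp: route_list_def active_def routes_def)

text \<open>Distinctness turns sums over the event list into sums over the set
  \<open>R\<close>.\<close>

lemma distinct_route_list: "distinct route_list"
proof -
  have *: "distinct (concat (map (\<lambda>i. map (\<lambda>j. (i, j)) (filter (p i) (f i))) xs))"
    if "distinct xs" "\<And>i. distinct (f i)" for p and f :: "nat \<Rightarrow> nat list" and xs :: "nat list"
    using that(1)
  proof (induction xs)
    case (Cons i xs)
    have "distinct (map (\<lambda>j. (i, j)) (filter (p i) (f i)))"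
      using that(2) by (simp add: distinct_map inj_on_def)
    moreover have "set (map (\<lambda>j. (i, j)) (filter (p i) (f i))) \<inter>
        set (concat (map (\<lambda>i. map (\<lambda>j. (i, j)) (filter (p i) (f i))) xs)) = {}"
      using Cons.prems by auto
    ultimately show ?case using Cons by simp
  qed simp
  have filt: "concat (map (\<lambda>j. if q j then [g j] else []) xs) = map g (filter q xs)"
    for q and g :: "nat \<Rightarrow> route" and xs
    by (induction xs) auto
  show ?thesis
    unfolding route_list_def filt
    using *[of "[1..<N + 1]" "\<lambda>i. [i + 1..<N + 1]" "\<lambda>i j. lam (i, j) > 0"] by simp
qed

lemma events_eq:
  "events N C lam mu x = concat (map (\<lambda>r. [(r, 1, lam r), (r, -1, m x r)]) route_list)"
  by (simp add: events_def route_list_def)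

lemma events_sums:
  "total_weight (events N C lam mu x) = (\<Sum>r\<in>R. lam r + m x r)"
  "weighted_sum g (events N C lam mu x) =
     (\<Sum>r\<in>R. ennreal (lam r) * g (Some (r, 1)) + ennreal (m x r) * g (Some (r, -1)))"
proof -
  have "total_weight (concat (map (\<lambda>r. [(r, 1, lam r), (r, -1, m x r)]) xs)) = (\<Sum>r\<in>set xs. lam r + m x r)"
    "weighted_sum g (concat (map (\<lambda>r. [(r, 1, lam r), (r, -1, m x r)]) xs)) =
     (\<Sum>r\<in>set xs. ennreal (lam r) * g (Some (r, 1)) + ennreal (m x r) * g (Some (r, -1)))"
    if "distinct xs" for xs
    using that by (induction xs) (auto simp: ac_simps)
  from this[OF distinct_route_list]
  show "total_weight (events N C lam mu x) = (\<Sum>r\<in>R. lam r + m x r)"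
    "weighted_sum g (events N C lam mu x) =
     (\<Sum>r\<in>R. ennreal (lam r) * g (Some (r, 1)) + ennreal (m x r) * g (Some (r, -1)))"
    by (simp_all add: events_eq set_route_list)
qed

lemma events_mem:
  "(r, s, w) \<in> set (events N C lam mu x) \<longleftrightarrow> r \<in> R \<and> (s = 1 \<and> w = lam r \<or> s = -1 \<and> w = m x r)"
  by (auto simp: events_eq set_route_list)

text \<open>The expectation of \<open>h\<close> after one step of the jump chain from
  \<open>x\<close>; the last summand belongs to the fictitious jumps that leave \<open>x\<close>
  unchanged.\<close>

definition avg :: "(vec \<Rightarrow> real) \<Rightarrow> vec \<Rightarrow> real" where
  "avg h x = ((\<Sum>r\<in>R. lam r * h (x(r := x r + 1)) + m x r * h (x(r := x r - 1)))
     + (W - (\<Sum>r\<in>R. lam r + m x r)) * h x) / W"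

abbreviation "unif \<equiv> uniform_measure lborel {0..1::real}"

definition apply_event :: "vec \<Rightarrow> (route \<times> real) option \<Rightarrow> vec" where
  "apply_event x o' = (case o' of None \<Rightarrow> x | Some (r, s) \<Rightarrow> x(r := x r + s))"

lemma step_eq: "step' x u = apply_event x (pick (events N C lam mu x) (u * W))"
  by (simp add: step_def apply_event_def)

text \<open>The substitution \<open>v = u * W\<close> turns the uniform variable into a point of
  \<open>{0..W}\<close>, where \<open>nn_integral_pick\<close> applies.\<close>

lemma nn_integral_step:
  assumes x: "x \<in> Rplus R" and h: "\<And>z. 0 \<le> h z"
  shows "(\<integral>\<^sup>+u. ennreal (h (step' x u)) \<partial>unif) = ennreal (avg h x)"
proof -
  define g where "g o' = ennreal (h (apply_event x o'))" for o'
  let ?es = "events N C lam mu x"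
  have W: "W > 0" using W_pos by simp
  have pm [measurable]: "(\<lambda>v. g (pick ?es v)) \<in> borel_measurable borel"
    by (rule measurable_compose[where g=g and N="count_space UNIV"]) measurable
  have "(\<integral>\<^sup>+u. ennreal (h (step' x u)) \<partial>unif) = (\<integral>\<^sup>+u. g (pick ?es (u * W)) \<partial>unif)"
    by (simp add: g_def step_eq)
  also have "\<dots> = (\<integral>\<^sup>+u. g (pick ?es (u * W)) * indicator {0..1} u \<partial>lborel)"
    by (subst nn_integral_uniform_measure) (auto simp: divide_ennreal_def)
  finally have "ennreal W * (\<integral>\<^sup>+u. ennreal (h (step' x u)) \<partial>unif)
      = ennreal W * (\<integral>\<^sup>+u. g (pick ?es (u * W)) * indicator {0..1} u \<partial>lborel)" by simp
  also have "\<dots> = (\<integral>\<^sup>+v. g (pick ?es v) * indicator {0..W} v \<partial>lborel)"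
  proof (subst (2) nn_integral_real_affine[where c=W and t=0])
    have "indicator {0..W} (W * x) = (indicator {0..1} x :: ennreal)" for x
      using W by (auto simp: indicator_def zero_le_mult_iff)
    then show "ennreal W * (\<integral>\<^sup>+u. g (pick ?es (u * W)) * indicator {0..1} u \<partial>lborel) =
        ennreal \<bar>W\<bar> * (\<integral>\<^sup>+x. g (pick ?es (0 + W * x)) * indicator {0..W} (0 + W * x) \<partial>lborel)"
      using W by (simp add: mult.commute)
  qed (use W in auto)
  also have "\<dots> = weighted_sum g ?es + ennreal (W - total_weight ?es) * g None"
    using x lam_nonneg by (intro nn_integral_pick)
      (auto simp: events_mem events_sums rates_le_W m_bounds dest: R_D)
  also have "\<dots> = ennreal ((\<Sum>r\<in>R. lam r * h (x(r := x r + 1)) + m x r * h (x(r := x r - 1)))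
     + (W - (\<Sum>r\<in>R. lam r + m x r)) * h x)"
  proof -
    have "weighted_sum g ?es = (\<Sum>r\<in>R. ennreal (lam r * h (x(r := x r + 1)) + m x r * h (x(r := x r - 1))))"
      unfolding events_sums using h m_bounds[OF x] R_D(1)
      by (intro sum.cong refl) (auto simp: g_def apply_event_def ennreal_mult ennreal_plus less_imp_le)
    also have "\<dots> = ennreal (\<Sum>r\<in>R. lam r * h (x(r := x r + 1)) + m x r * h (x(r := x r - 1)))"
      using h m_bounds[OF x] R_D(1) by (intro sum_ennreal) (auto simp: less_imp_le)
    finally have 1: "weighted_sum g ?es = \<dots>" .
    have 2: "ennreal (W - total_weight ?es) * g None = ennreal ((W - (\<Sum>r\<in>R. lam r + m x r)) * h x)"
      using rates_le_W[OF x] h by (simp add: events_sums g_def apply_event_def ennreal_mult)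
    show ?thesis unfolding 1 2 using h m_bounds[OF x] R_D(1) rates_le_W[OF x]
      by (subst ennreal_plus) (auto intro!: sum_nonneg add_nonneg_nonneg mult_nonneg_nonneg simp: less_imp_le)
  qed
  also have "\<dots> = ennreal (W * avg h x)" using W by (simp add: avg_def)
  also have "\<dots> = ennreal W * ennreal (avg h x)" using W by (simp add: ennreal_mult')
  finally show ?thesis using W by (simp add: ennreal_mult_cancel_left)
qed

lemma murate_pos_D: "m x r > 0 \<Longrightarrow> x r > 0"
  by (auto simp: murate_def nu_def split: if_splits)

lemma step_Zplus:
  assumes "x \<in> Zplus R" "0 \<le> u"
  shows "step' x u \<in> Zplus R"
proof (cases "pick (events N C lam mu x) (u * W)")
  case None
  then show ?thesis using assms by (simp add: step_eq apply_event_def)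
next
  case (Some p)
  obtain r s where p: "p = (r, s)" by (cases p)
  obtain w where w: "w > 0" "(r, s, w) \<in> set (events N C lam mu x)"
    using pick_weight_pos[OF Some[unfolded p]] assms W_pos by auto
  then have r: "r \<in> R" and "s = 1 \<or> s = -1 \<and> x r > 0"
    by (auto simp: events_mem dest: murate_pos_D)
  moreover have "x r \<in> \<nat>" using assms r by (auto simp: Zplus_def)
  then obtain k where k: "x r = real k" by (auto simp: Nats_def)
  have "real k - 1 \<in> \<nat>" if "k > 0"
    using that by (cases k) auto
  ultimately have "x r + s \<in> \<nat>" using k by auto
  then show ?thesis using assms r
    by (auto simp: step_eq Some p apply_event_def Zplus_def)
qed

text \<open>A countable set preserved by every step for every real \<open>u\<close>. Preservation of
  \<open>Zplus R\<close> is shown for \<open>0 \<le> u\<close>, which holds almost surely, whereas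
  measurability is argued for all sample points.\<close>

definition Zgrid :: "vec set" where
  "Zgrid = {x. (\<forall>r\<in>R. x r \<in> \<int>) \<and> (\<forall>r. r \<notin> R \<longrightarrow> x r = 0)}"

lemma countable_Zgrid: "countable Zgrid"
proof -
  have "Zgrid \<subseteq> (\<lambda>g r. if r \<in> R then g r else 0) ` (PiE R (\<lambda>_. \<int>))"
  proof
    fix x assume x: "x \<in> Zgrid"
    then show "x \<in> (\<lambda>g r. if r \<in> R then g r else 0) ` (PiE R (\<lambda>_. \<int>))"
      by (intro image_eqI[where x="restrict x R"]) (auto simp: Zgrid_def fun_eq_iff)
  qed
  moreover have "countable (PiE R (\<lambda>_. \<int> :: real set))"
  proof (rule countable_PiE)
    show "countable (\<int> :: real set)" unfolding Ints_def by (rule countable_image) simp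
  qed simp
  ultimately show ?thesis by (rule countable_subset[OF _ countable_image])
qed

lemma Zplus_Zgrid: "x \<in> Zplus R \<Longrightarrow> x \<in> Zgrid"
  by (auto simp: Zplus_def Zgrid_def Nats_def)

lemma step_Zgrid:
  assumes "x \<in> Zgrid"
  shows "step' x u \<in> Zgrid"
proof (cases "pick (events N C lam mu x) (u * W)")
  case (Some p)
  obtain r s where p: "p = (r, s)" by (cases p)
  obtain w where "(r, s, w) \<in> set (events N C lam mu x)"
    using pick_mem[OF Some[unfolded p]] by auto
  then show ?thesis using assms
    by (auto simp: events_mem step_eq Some p apply_event_def Zgrid_def)
qed (use assms in \<open>simp add: step_eq apply_event_def\<close>)

section \<open>Path space and measurability of the tube event\<close>

abbreviation "base \<equiv> base_measure W"
abbreviation "expo \<equiv> density lborel (\<lambda>t. ennreal (exponential_density W t))"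

lemma prob_space_expo: "prob_space expo"
  using W_pos by (intro prob_space_exponential_density) simp

lemma prob_space_unif: "prob_space unif"
  by (intro prob_space_uniform_measure) auto

lemma prob_space_base: "prob_space base"
proof -
  interpret E: prob_space expo by (rule prob_space_expo)
  interpret U: prob_space unif by (rule prob_space_unif)
  interpret pair_prob_space expo unif ..
  show ?thesis unfolding base_measure_def by (rule prob_space_axioms)
qed

sublocale seq: sequence_space base
proof -
  interpret B: prob_space base by (rule prob_space_base)
  show "sequence_space base" by unfold_locales
qed

lemma P_eq: "P = seq.S"
  by (simp add: path_space_def)

lemma prob_space_P: "prob_space P"
  unfolding path_space_def by (intro prob_space_PiM prob_space_base)

lemma sets_base [measurable_cong]: "sets base = sets (borel \<Otimes>\<^sub>M borel)"
  unfolding base_measure_def by (intro sets_pair_measure_cong) auto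

lemma space_base [simp]: "space base = UNIV"
  by (simp add: base_measure_def space_pair_measure)

lemma space_P [simp]: "space P = UNIV"
  by (simp add: path_space_def space_PiM)

lemma sets_P [measurable_cong]: "sets P = sets (\<Pi>\<^sub>M k\<in>UNIV. borel \<Otimes>\<^sub>M borel)"
  unfolding path_space_def by (intro sets_PiM_cong refl sets_base)

lemma measurable_coord [measurable]:
  "(\<lambda>\<omega>. fst (\<omega> k)) \<in> borel_measurable P" "(\<lambda>\<omega>. snd (\<omega> k)) \<in> borel_measurable P"
  by measurable

lemma measurable_jtime [measurable]: "(\<lambda>\<omega>. jtime \<omega> k) \<in> borel_measurable P"
  unfolding jtime_def by measurable

lemma measurable_into_Zgrid:
  assumes "\<And>x. x \<in> space M \<Longrightarrow> f x \<in> Zgrid" "f \<in> M \<rightarrow>\<^sub>M count_space UNIV"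
  shows "f \<in> M \<rightarrow>\<^sub>M count_space Zgrid"
  using assms measurable_sets[OF assms(2)]
  by (subst measurable_count_space_eq_countable) (auto simp: countable_Zgrid)

lemma measurable_step: "x \<in> Zgrid \<Longrightarrow> step' x \<in> borel \<rightarrow>\<^sub>M count_space Zgrid"
proof (rule measurable_into_Zgrid)
  have "(\<lambda>u. apply_event x (pick (events N C lam mu x) (u * W))) \<in> borel \<rightarrow>\<^sub>M count_space UNIV"
    by (rule measurable_compose[where N="count_space UNIV"]) measurable
  then show "step' x \<in> borel \<rightarrow>\<^sub>M count_space UNIV" by (simp add: step_eq cong: measurable_cong)
qed (rule step_Zgrid)

lemma measurable_chain:
  assumes "y \<in> Zgrid"
  shows "(\<lambda>\<omega>. chain' y \<omega> k) \<in> P \<rightarrow>\<^sub>M count_space Zgrid"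
proof (induction k)
  case 0
  then show ?case using assms by simp
next
  case (Suc k)
  have "(\<lambda>\<omega>. step' (chain' y \<omega> k) (snd (\<omega> k))) \<in> P \<rightarrow>\<^sub>M count_space Zgrid"
    by (rule measurable_compose_countable'[OF _ Suc countable_Zgrid])
       (rule measurable_compose[OF measurable_coord(2) measurable_step])
  then show ?case by simp
qed

definition jumps :: "(nat \<Rightarrow> real \<times> real) \<Rightarrow> real \<Rightarrow> nat set" where
  "jumps \<omega> t = {k. 1 \<le> k \<and> jtime \<omega> k \<le> t}"

lemma Q_eq: "Q y \<omega> t = chain' y \<omega> (card (jumps \<omega> t))"
  by (simp add: Qproc_def jumps_def)

text \<open>The time is random because the path will be evaluated at its own jump times.\<close>

lemma measurable_Q_at:
  assumes "y \<in> Zgrid" and "\<theta> \<in> borel_measurable P"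
  shows "(\<lambda>\<omega>. Q y \<omega> (\<theta> \<omega>)) \<in> P \<rightarrow>\<^sub>M count_space Zgrid"
proof -
  have "{\<omega> \<in> space P. i \<in> jumps \<omega> (\<theta> \<omega>)} \<in> sets P" for i
    using borel_measurable_le[OF measurable_jtime[of i] assms(2)] by (cases "1 \<le> i") (simp_all add: jumps_def)
  then have *: "(\<lambda>\<omega>. card (jumps \<omega> (\<theta> \<omega>))) \<in> P \<rightarrow>\<^sub>M count_space UNIV"
    by (rule measurable_card)
  show ?thesis unfolding Q_eq
    by (rule measurable_compose_countable[where f="\<lambda>k \<omega>. chain' y \<omega> k", OF measurable_chain[OF assms(1)] *])
qed

text \<open>Projection onto \<open>{s..T}\<close>; it lets all rationals and all jump times serve as
  evaluation times.\<close>

definition clip :: "real \<Rightarrow> real \<Rightarrow> real \<Rightarrow> real" where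
  "clip s T t = max s (min T t)"

lemma clip_in: "s \<le> T \<Longrightarrow> clip s T t \<in> {s..T}"
  by (auto simp: clip_def)

lemma clip_id: "t \<in> {s..T} \<Longrightarrow> clip s T t = t"
  by (auto simp: clip_def)

lemma measurable_tube_at:
  assumes y: "y \<in> Zgrid" and [measurable]: "\<theta> \<in> borel_measurable P"
    and \<theta>: "\<And>\<omega>. \<theta> \<omega> \<in> {s..T}"
    and \<phi>: "\<And>z. z \<in> Zgrid \<Longrightarrow> continuous_on {s..T} (\<phi> z)"
  shows "(\<lambda>\<omega>. ereal (\<phi> (Q y \<omega> (\<theta> \<omega> - s)) (\<theta> \<omega>))) \<in> borel_measurable P"
proof -
  have "s \<le> T" using \<theta>[of undefined] by auto
  have "(\<lambda>\<omega>. \<phi> (Q y \<omega> (\<theta> \<omega> - s)) (clip s T (\<theta> \<omega>))) \<in> borel_measurable P"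
  proof (rule measurable_compose_countable'[OF _ measurable_Q_at[OF y] countable_Zgrid])
    fix z assume "z \<in> Zgrid"
    then have "continuous_on UNIV (\<phi> z \<circ> clip s T)"
      using clip_in[OF \<open>s \<le> T\<close>]
      by (intro continuous_on_compose) (auto simp: clip_def[abs_def] intro!: continuous_intros continuous_on_subset[OF \<phi>])
    from borel_measurable_continuous_onI[OF this]
    show "(\<lambda>\<omega>. \<phi> z (clip s T (\<theta> \<omega>))) \<in> borel_measurable P"
      by (intro measurable_compose[OF \<open>\<theta> \<in> borel_measurable P\<close>]) (simp add: comp_def)
  qed measurable
  then show ?thesis by (simp add: clip_id[OF \<theta>])
qed

text \<open>The tube event for a path that sits in \<open>x\<close> at the absolute time
  \<open>s\<close>: the clock of the process reads \<open>t - s\<close>, while the centre of the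
  tube moves with \<open>t\<close>. Its measure as a function of both \<open>x\<close> and
  \<open>s\<close> is what the contraction acts on.\<close>

definition tub :: "(vec \<Rightarrow> real \<Rightarrow> real) \<Rightarrow> real \<Rightarrow> real \<Rightarrow> vec \<Rightarrow> real \<Rightarrow> (nat \<Rightarrow> real \<times> real) set" where
  "tub \<phi> T c x s = {\<omega>. (SUP t\<in>{s..T}. ereal (\<phi> (Q x \<omega> (t - s)) t)) < ereal c}"

text \<open>While the path is frozen, the deviation is a continuous function \<open>g\<close> of
  time, so rationals in the open interval control its value at \<open>t\<close>, even if
  \<open>t\<close> is an endpoint of the interval.\<close>

lemma locally_constant_SUP_le:
  fixes g :: "real \<Rightarrow> real"
  assumes "l < u" "t \<in> {l..u}" "{l..u} \<subseteq> {s..T}" "continuous_on {s..T} g"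
    and B: "\<And>q. q \<in> \<rat> \<Longrightarrow> l < q \<Longrightarrow> q < u \<Longrightarrow> ereal (g q) \<le> B"
  shows "ereal (g t) \<le> B"
proof (rule ccontr)
  assume "\<not> ereal (g t) \<le> B"
  then obtain b where b: "B < ereal b" "b < g t"
    using ereal_dense2[of B "ereal (g t)"] by (auto simp: not_le)
  have cont: "continuous_on {l..u} g" by (rule continuous_on_subset[OF assms(4,3)])
  have "\<exists>d>0. \<forall>t'\<in>{l..u}. dist t' t < d \<longrightarrow> dist (g t') (g t) < g t - b"
    by (rule cont[unfolded continuous_on_iff, rule_format]) (use assms(2) b(2) in auto)
  then obtain d where d: "d > 0" "\<And>t'. t' \<in> {l..u} \<Longrightarrow> dist t' t < d \<Longrightarrow> dist (g t') (g t) < g t - b"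
    by blast
  have "max l (t - d) < min u (t + d)" using assms(1,2) d(1) by auto
  then obtain q where q: "q \<in> \<rat>" "max l (t - d) < q" "q < min u (t + d)"
    using Rats_dense_in_real by blast
  have "dist q t < d" using q by (auto simp: dist_real_def)
  then have "dist (g q) (g t) < g t - b" using d(2)[of q] q by auto
  then have "b < g q" by (auto simp: dist_real_def)
  moreover have "ereal (g q) < ereal b" using le_less_trans[OF B[of q] b(1)] q by auto
  ultimately show False by simp
qed

text \<open>Measurability of the tube event is needed for every \<open>\<omega>\<close>, including explosive ones and negative
holding times, since \<open>measure\<close> assigns the junk value 0 to a nonmeasurable set. If infinitely many
jumps precede \<open>t\<close>, then the \<open>card\<close> in \<open>Qproc\<close> is 0 and the path sits at its starting point.\<close>

lemma SUP_countable_times: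
  assumes "s \<le> T" and \<phi>: "\<And>z. z \<in> Zgrid \<Longrightarrow> continuous_on {s..T} (\<phi> z)" and x: "x \<in> Zgrid"
  defines "g \<equiv> \<lambda>\<omega> t. ereal (\<phi> (Q x \<omega> (t - s)) t)"
  shows "(SUP t\<in>{s..T}. g \<omega> t) =
    sup (SUP i. g \<omega> (clip s T (real_of_rat (from_nat i)))) (SUP k. g \<omega> (clip s T (s + jtime \<omega> k)))"
    (is "_ = ?B")
proof (rule antisym)
  show "?B \<le> (SUP t\<in>{s..T}. g \<omega> t)"
    using clip_in[OF \<open>s \<le> T\<close>] by (intro sup_least SUP_least SUP_upper) auto
  have chain_Zgrid: "chain' x \<omega> k \<in> Zgrid" for k
    using x by (induction k) (auto intro: step_Zgrid)
  have rat: "g \<omega> (clip s T q) \<le> ?B" if "q \<in> \<rat>" for q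
  proof -
    obtain p where p: "q = real_of_rat p" using \<open>q \<in> \<rat>\<close> Rats_cases by metis
    have "g \<omega> (clip s T (real_of_rat (from_nat (to_nat p)))) \<le> (SUP i. g \<omega> (clip s T (real_of_rat (from_nat i))))"
      by (rule SUP_upper) simp
    then have "g \<omega> (clip s T q) \<le> (SUP i. g \<omega> (clip s T (real_of_rat (from_nat i))))" by (simp add: p)
    then show ?thesis by (rule le_supI1)
  qed
  have jmp: "g \<omega> (clip s T (s + jtime \<omega> k)) \<le> ?B" for k
    by (rule le_supI2, rule SUP_upper) simp
  show "(SUP t\<in>{s..T}. g \<omega> t) \<le> ?B"
  proof (rule SUP_least)
    fix t assume t: "t \<in> {s..T}"
    consider "t = s" | "t = T" | k where "k \<ge> 1" "t = s + jtime \<omega> k"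
      | "s < t" "t < T" "\<And>k. k \<ge> 1 \<Longrightarrow> t \<noteq> s + jtime \<omega> k"
      using t by (metis atLeastAtMost_iff order_le_less)
    then show "g \<omega> t \<le> ?B"
    proof cases
      case 1
      obtain q where "q \<in> \<rat>" "q < s" using Rats_dense_in_real[of "s - 1" s] by auto
      then show ?thesis using rat[of q] 1 t by (auto simp: clip_def)
    next
      case 2
      obtain q where "q \<in> \<rat>" "T < q" using Rats_dense_in_real[of "T" "T + 1"] by auto
      then show ?thesis using rat[of q] 2 t by (auto simp: clip_def)
    next
      case (3 k)
      then show ?thesis using jmp[of k] t by (simp add: clip_id)
    next
      case 4
      have "\<exists>l u. l < u \<and> t \<in> {l..u} \<and> {l..u} \<subseteq> {s..T} \<and>
          (\<forall>q. l < q \<and> q < u \<longrightarrow> card (jumps \<omega> (q - s)) = card (jumps \<omega> (t - s)))"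
      proof (cases "finite (jumps \<omega> (t - s))")
        \<comment> \<open>With finitely many jumps up to \<open>t\<close>, and \<open>t\<close> not
          a jump time, the path is constant on an interval to the left of \<open>t\<close>. To the
          right this may fail, as with negative holding times jump times could accumulate at
          \<open>t\<close> from above.\<close>
        case True
        define a where "a = Max (insert s ((\<lambda>k. s + jtime \<omega> k) ` jumps \<omega> (t - s)))"
        have fin: "finite (insert s ((\<lambda>k. s + jtime \<omega> k) ` jumps \<omega> (t - s)))" using True by simp
        have "s \<le> a" unfolding a_def using fin by (intro Max_ge) auto
        have le_a: "s + jtime \<omega> k \<le> a" if "k \<in> jumps \<omega> (t - s)" for k
          unfolding a_def using fin that by (intro Max_ge) auto
        have "a < t" unfolding a_def using fin 4 by (subst Max_less_iff) (force simp: jumps_def)+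
        have "jumps \<omega> (q - s) = jumps \<omega> (t - s)" if "a < q" "q < t" for q
          using le_a that unfolding jumps_def by force
        then show ?thesis using \<open>a < t\<close> \<open>s \<le> a\<close> 4 by (intro exI[of _ a] exI[of _ t]) auto
      next
        \<comment> \<open>Infinitely many jumps up to \<open>t\<close> are also infinitely many up
          to any later time, so \<open>card\<close> is 0 there and the path is constant to the right
          of \<open>t\<close>.\<close>
        case False
        have "infinite (jumps \<omega> (q - s))" if "t < q" for q
          using that False by (rule_tac infinite_super[of "jumps \<omega> (t - s)"]) (auto simp: jumps_def)
        then show ?thesis using False 4 by (intro exI[of _ t] exI[of _ T]) auto
      qed
      then obtain l u where lu: "l < u" "t \<in> {l..u}" "{l..u} \<subseteq> {s..T}"
        "\<And>q. l < q \<Longrightarrow> q < u \<Longrightarrow> card (jumps \<omega> (q - s)) = card (jumps \<omega> (t - s))" by auto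
      have "ereal (\<phi> (Q x \<omega> (t - s)) t) \<le> ?B"
      proof (rule locally_constant_SUP_le[OF lu(1-3), where g="\<phi> (Q x \<omega> (t - s))"])
        show "continuous_on {s..T} (\<phi> (Q x \<omega> (t - s)))" unfolding Q_eq by (rule \<phi>[OF chain_Zgrid])
        fix q assume q: "q \<in> \<rat>" "l < q" "q < u"
        then have "q \<in> {s..T}" using lu(3) by auto
        then show "ereal (\<phi> (Q x \<omega> (t - s)) q) \<le> ?B"
          using rat[OF q(1)] lu(4)[OF q(2,3)] by (simp add: clip_id g_def Q_eq)
      qed
      then show ?thesis by (simp add: g_def)
    qed
  qed
qed

lemma sets_tub:
  assumes "s \<le> T" and \<phi>: "\<And>z. z \<in> Zgrid \<Longrightarrow> continuous_on {s..T} (\<phi> z)" and x: "x \<in> Zgrid"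
  shows "tub \<phi> T c x s \<in> sets P"
proof -
  have [measurable]: "(\<lambda>\<omega>. ereal (\<phi> (Q x \<omega> (clip s T t - s)) (clip s T t))) \<in> borel_measurable P" for t
    by (rule measurable_tube_at[OF x _ clip_in[OF \<open>s \<le> T\<close>] \<phi>]) auto
  have [measurable]: "(\<lambda>\<omega>. ereal (\<phi> (Q x \<omega> (clip s T (s + jtime \<omega> k) - s)) (clip s T (s + jtime \<omega> k)))) \<in> borel_measurable P" for k
    by (rule measurable_tube_at[OF x _ clip_in[OF \<open>s \<le> T\<close>] \<phi>]) (auto simp: clip_def[abs_def])
  have "{\<omega> \<in> space P. (SUP t\<in>{s..T}. ereal (\<phi> (Q x \<omega> (t - s)) t)) < ereal c} \<in> sets P"
    by (subst SUP_countable_times[OF assms]) measurable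
  then show ?thesis by (simp add: tub_def)
qed

section \<open>Splitting off the first jump, and non-explosion\<close>

text \<open>The sequence space is the image under \<open>case_nat\<close> of the product of one pair
  and an independent copy of the sequence. This plays the part of the Markov property at the first
  jump.\<close>

lemma emeasure_P_iter:
  assumes A: "A \<in> sets P"
  shows "emeasure P A = (\<integral>\<^sup>+p. emeasure P {\<omega>. case_nat p \<omega> \<in> A} \<partial>base)"
    and "(\<lambda>p. emeasure P {\<omega>. case_nat p \<omega> \<in> A}) \<in> borel_measurable base"
    and "\<And>p. {\<omega>. case_nat p \<omega> \<in> A} \<in> sets P"
proof -
  interpret PP: prob_space P by (rule prob_space_P)
  let ?f = "\<lambda>(s :: real \<times> real, \<omega>). case_nat s \<omega>"
  have f: "?f \<in> base \<Otimes>\<^sub>M P \<rightarrow>\<^sub>M P"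
    unfolding P_eq by measurable
  define X where "X = ?f -` A \<inter> space (base \<Otimes>\<^sub>M P)"
  have X: "X \<in> sets (base \<Otimes>\<^sub>M P)" unfolding X_def using measurable_sets[OF f A] .
  have sec: "Pair p -` X = {\<omega>. case_nat p \<omega> \<in> A}" for p
    by (auto simp: X_def space_pair_measure)
  have "emeasure P A = emeasure (distr (base \<Otimes>\<^sub>M P) P ?f) A"
    using seq.PiM_iter by (simp add: P_eq)
  also have "\<dots> = emeasure (base \<Otimes>\<^sub>M P) X"
    unfolding X_def by (rule emeasure_distr[OF f A])
  also have "\<dots> = (\<integral>\<^sup>+p. emeasure P (Pair p -` X) \<partial>base)"
    by (rule PP.emeasure_pair_measure_alt[OF X])
  finally show "emeasure P A = (\<integral>\<^sup>+p. emeasure P {\<omega>. case_nat p \<omega> \<in> A} \<partial>base)"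
    by (simp add: sec)
  show "(\<lambda>p. emeasure P {\<omega>. case_nat p \<omega> \<in> A}) \<in> borel_measurable base"
    using PP.measurable_emeasure_Pair[OF X] by (simp add: sec)
  show "{\<omega>. case_nat p \<omega> \<in> A} \<in> sets P" for p
    using sets_Pair1[OF X, of p] by (simp add: sec)
qed

lemma emeasure_P_step:
  assumes A: "A \<in> sets P"
  shows "emeasure P A = (\<integral>\<^sup>+e. ennreal (exponential_density W e) *
     (\<integral>\<^sup>+u. emeasure P {\<omega>. case_nat (e, u) \<omega> \<in> A} \<partial>unif) \<partial>lborel)"
    and "(\<lambda>e. \<integral>\<^sup>+u. emeasure P {\<omega>. case_nat (e, u) \<omega> \<in> A} \<partial>unif) \<in> borel_measurable borel"
proof -
  interpret U: prob_space unif by (rule prob_space_unif)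
  have [measurable]: "(\<lambda>p. emeasure P {\<omega>. case_nat p \<omega> \<in> A}) \<in> borel_measurable (expo \<Otimes>\<^sub>M unif)"
    using emeasure_P_iter(2)[OF A] by (simp add: base_measure_def)
  have *: "(\<lambda>e. \<integral>\<^sup>+u. emeasure P {\<omega>. case_nat (e, u) \<omega> \<in> A} \<partial>unif) \<in> borel_measurable expo"
    by measurable
  then show m [measurable]: "(\<lambda>e. \<integral>\<^sup>+u. emeasure P {\<omega>. case_nat (e, u) \<omega> \<in> A} \<partial>unif) \<in> borel_measurable borel"
    by simp
  have "emeasure P A = (\<integral>\<^sup>+e. (\<integral>\<^sup>+u. emeasure P {\<omega>. case_nat (e, u) \<omega> \<in> A} \<partial>unif) \<partial>expo)"
    unfolding emeasure_P_iter(1)[OF A] base_measure_def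
    by (subst U.nn_integral_fst[symmetric]) auto
  also have "\<dots> = (\<integral>\<^sup>+e. ennreal (exponential_density W e) *
     (\<integral>\<^sup>+u. emeasure P {\<omega>. case_nat (e, u) \<omega> \<in> A} \<partial>unif) \<partial>lborel)"
    by (rule nn_integral_density) (use m in \<open>auto simp: exponential_density_def\<close>)
  finally show "emeasure P A = (\<integral>\<^sup>+e. ennreal (exponential_density W e) *
     (\<integral>\<^sup>+u. emeasure P {\<omega>. case_nat (e, u) \<omega> \<in> A} \<partial>unif) \<partial>lborel)" .
qed

lemma jtime_case_nat: "jtime (case_nat p \<omega>) (Suc k) = fst p + jtime \<omega> k"
  by (simp add: jtime_def lessThan_Suc_eq_insert_0 zero_notin_Suc_image sum.reindex comp_def)

lemma expo_interval:
  assumes "0 \<le> a"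
  shows "(\<integral>\<^sup>+e. ennreal (exponential_density W e) * indicator {0..a} e \<partial>lborel) = ennreal (1 - exp (- W * a))"
proof -
  have "(\<integral>\<^sup>+e. ennreal (exponential_density W e) * indicator {0..a} e \<partial>lborel) =
      (\<integral>\<^sup>+e. ennreal (W * exp (- W * e)) * indicator {0..a} e \<partial>lborel)"
    by (intro nn_integral_cong) (auto simp: exponential_density_def indicator_def mult.commute)
  also have "\<dots> = ennreal ((- exp (- W * a)) - (- exp (- W * 0)))"
    using assms W_pos by (intro nn_integral_FTC_Icc) (auto intro!: derivative_eq_intros)
  finally show ?thesis by simp
qed

text \<open>The almost sure event on which the path can be restarted at its first jump; finiteness
  excludes the default value 0 of \<open>card\<close>.\<close>

definition good :: "(nat \<Rightarrow> real \<times> real) \<Rightarrow> bool" where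
  "good \<omega> \<longleftrightarrow> (\<forall>k. 0 \<le> fst (\<omega> k)) \<and> (\<forall>t. finite (jumps \<omega> t))"

lemma AE_expo_nonneg: "AE e in expo. 0 \<le> e"
  by (subst AE_density) (auto simp: exponential_density_def)

lemma AE_nonneg: "AE \<omega> in P. \<forall>k. 0 \<le> fst (\<omega> k)"
proof -
  interpret E: prob_space expo by (rule prob_space_expo)
  interpret U: prob_space unif by (rule prob_space_unif)
  interpret pair_prob_space expo unif ..
  have "AE p in expo \<Otimes>\<^sub>M unif. 0 \<le> fst p"
  proof (rule AE_pair_measure)
    show "AE e in expo. AE u in unif. 0 \<le> fst (e, u)" using AE_expo_nonneg by simp
  qed measurable
  then have "AE p in base. 0 \<le> fst p" by (simp only: base_measure_def)
  then have "AE \<omega> in P. 0 \<le> fst (\<omega> k)" for k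
    unfolding path_space_def by (intro AE_PiM_component prob_space_base) auto
  then show ?thesis by (simp add: AE_all_countable)
qed

text \<open>If all jump times stay below \<open>t\<close> and the first holding time is nonnegative,
  then this time lies in \<open>{0..t}\<close> and the jump times of the shifted sequence stay below
  \<open>t\<close> as well. Hence the probability \<open>p\<close> satisfies
  \<open>p \<le> p * (1 - exp (- W * t))\<close>, which forces \<open>p = 0\<close>.\<close>

lemma jtimes_bounded_null:
  assumes "0 \<le> t"
  shows "emeasure P {\<omega>. \<forall>k. jtime \<omega> k \<le> t} = 0"
proof -
  interpret PP: prob_space P by (rule prob_space_P)
  interpret U: prob_space unif by (rule prob_space_unif)
  let ?A = "{\<omega>. \<forall>k. jtime \<omega> k \<le> t}"
  have "{\<omega> \<in> space P. \<forall>k. jtime \<omega> k \<le> t} \<in> sets P" by measurable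
  then have A: "?A \<in> sets P" by simp
  have "emeasure P ?A \<le> (\<integral>\<^sup>+e. emeasure P ?A * (ennreal (exponential_density W e) * indicator {0..t} e) \<partial>lborel)"
    unfolding emeasure_P_step(1)[OF A]
  proof (rule nn_integral_mono)
    fix e :: real
    show "ennreal (exponential_density W e) * (\<integral>\<^sup>+u. emeasure P {\<omega>. case_nat (e, u) \<omega> \<in> ?A} \<partial>unif)
      \<le> (\<integral>\<^sup>+e. ennreal (exponential_density W e) * (\<integral>\<^sup>+u. emeasure P {\<omega>. case_nat (e, u) \<omega> \<in> ?A} \<partial>unif) \<partial>lborel) *
        (ennreal (exponential_density W e) * indicator {0..t} e)"
      unfolding emeasure_P_step(1)[OF A, symmetric]
    proof (cases "e \<in> {0..t}")
      case True
      have "(\<integral>\<^sup>+u. emeasure P {\<omega>. case_nat (e, u) \<omega> \<in> ?A} \<partial>unif) \<le> (\<integral>\<^sup>+u. emeasure P ?A \<partial>unif)"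
      proof (intro nn_integral_mono emeasure_mono A subsetI)
        fix u \<omega> assume "\<omega> \<in> {\<omega>. case_nat (e, u) \<omega> \<in> ?A}"
        then have "jtime (case_nat (e, u) \<omega>) (Suc k) \<le> t" for k by blast
        then show "\<omega> \<in> ?A" using True by (auto simp: jtime_case_nat) (smt (verit))
      qed
      also have "\<dots> = emeasure P ?A" using U.emeasure_space_1 by (simp add: nn_integral_const)
      finally show "ennreal (exponential_density W e) * (\<integral>\<^sup>+u. emeasure P {\<omega>. case_nat (e, u) \<omega> \<in> ?A} \<partial>unif)
        \<le> emeasure P ?A * (ennreal (exponential_density W e) * indicator {0..t} e)"
        using True mult_left_mono[of _ "emeasure P ?A" "ennreal (exponential_density W e)"]
        by (simp add: mult.commute[of "emeasure P _"])
    next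
      case False
      have "(\<integral>\<^sup>+u. emeasure P {\<omega>. case_nat (e, u) \<omega> \<in> ?A} \<partial>unif) = 0" if "t < e"
      proof -
        have "{\<omega>. case_nat (e, u) \<omega> \<in> ?A} = {}" for u
          using that jtime_case_nat[of "(e, u)" _ 0] by (auto simp: jtime_def intro!: exI[of _ "Suc 0"])
        then show ?thesis by (simp only: emeasure_empty nn_integral_const mult_zero_left)
      qed
      then show "ennreal (exponential_density W e) * (\<integral>\<^sup>+u. emeasure P {\<omega>. case_nat (e, u) \<omega> \<in> ?A} \<partial>unif)
        \<le> emeasure P ?A * (ennreal (exponential_density W e) * indicator {0..t} e)"
        using False by (cases "t < e") (auto simp: exponential_density_def)
    qed
  qed
  also have "\<dots> = emeasure P ?A * ennreal (1 - exp (- W * t))"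
    using expo_interval[OF assms] by (subst nn_integral_cmult) (auto simp: exponential_density_def)
  finally have "emeasure P ?A \<le> emeasure P ?A * ennreal (1 - exp (- W * t))" .
  then have "PP.prob ?A \<le> PP.prob ?A * (1 - exp (- W * t))"
    using assms W_pos by (simp add: PP.emeasure_eq_measure ennreal_mult[symmetric])
  then have "PP.prob ?A * exp (- W * t) \<le> 0" by (simp add: algebra_simps)
  then have "PP.prob ?A = 0"
    using measure_nonneg[of P ?A] by (simp add: mult_le_0_iff)
  then show ?thesis by (simp add: PP.emeasure_eq_measure)
qed

lemma AE_good: "AE \<omega> in P. good \<omega>"
proof -
  have "AE \<omega> in P. \<not> (\<forall>k. jtime \<omega> k \<le> real n)" for n
  proof (rule AE_I[where N="{\<omega>. \<forall>k. jtime \<omega> k \<le> real n}"])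
    have "{\<omega> \<in> space P. \<forall>k. jtime \<omega> k \<le> real n} \<in> sets P" by measurable
    then show "{\<omega>. \<forall>k. jtime \<omega> k \<le> real n} \<in> sets P" by simp
  qed (use jtimes_bounded_null in auto)
  then have "AE \<omega> in P. \<forall>n. \<not> (\<forall>k. jtime \<omega> k \<le> real n)" by (simp only: AE_all_countable) simp
  then show ?thesis using AE_nonneg
  proof eventually_elim
    case (elim \<omega>)
    have mono: "jtime \<omega> i \<le> jtime \<omega> j" if "i \<le> j" for i j
      unfolding jtime_def using elim that by (intro sum_mono2) auto
    have "finite (jumps \<omega> t)" for t
    proof -
      obtain n where n: "t \<le> real n" using real_arch_simple by blast
      obtain k where k: "real n < jtime \<omega> k" using elim by (meson not_le)
      have "jumps \<omega> t \<subseteq> {..k}"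
      proof
        fix j assume "j \<in> jumps \<omega> t"
        then show "j \<in> {..k}" using mono[of k j] n k by (force simp: jumps_def)
      qed
      then show ?thesis using finite_subset by blast
    qed
    then show ?case using elim by (simp add: good_def)
  qed
qed

lemma chain_case_nat: "chain' y (case_nat p \<omega>) (Suc k) = chain' (step' y (snd p)) \<omega> k"
  by (induction k) auto

text \<open>Prefixing a pair shifts the indices by one. Index 0, which \<open>jumps\<close> leaves
  out, becomes the first jump at time \<open>e\<close>; hence the additional 1 in the count, which
  \<open>card\<close> registers because the set is finite.\<close>

lemma Q_case_nat:
  assumes "good \<omega>" "0 \<le> e"
  shows "t < e \<Longrightarrow> Q x (case_nat (e, u) \<omega>) t = x"
    and "e \<le> t \<Longrightarrow> Q x (case_nat (e, u) \<omega>) t = Q (step' x u) \<omega> (t - e)"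
proof -
  have nonneg: "0 \<le> jtime \<omega> k" for k
    using assms(1) by (auto simp: jtime_def good_def intro!: sum_nonneg)
  have J: "jumps (case_nat (e, u) \<omega>) t = Suc ` {k. jtime \<omega> k \<le> t - e}"
  proof (intro set_eqI iffI)
    fix k assume k: "k \<in> jumps (case_nat (e, u) \<omega>) t"
    then obtain j where j: "k = Suc j" by (cases k) (auto simp: jumps_def)
    then show "k \<in> Suc ` {k. jtime \<omega> k \<le> t - e}" using k by (auto simp: jumps_def jtime_case_nat)
  qed (auto simp: jumps_def jtime_case_nat)
  show "Q x (case_nat (e, u) \<omega>) t = x" if "t < e"
  proof -
    have "{k. jtime \<omega> k \<le> t - e} = {}"
    proof (intro equals0I)
      fix k assume "k \<in> {k. jtime \<omega> k \<le> t - e}"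
      then show False using nonneg[of k] that by simp
    qed
    then show ?thesis by (simp add: Q_eq J)
  qed
  show "Q x (case_nat (e, u) \<omega>) t = Q (step' x u) \<omega> (t - e)" if "e \<le> t"
  proof -
    have "{k. jtime \<omega> k \<le> t - e} = insert 0 (jumps \<omega> (t - e))"
      using that by (auto simp: jumps_def jtime_def Suc_le_eq)
    moreover have "finite (jumps \<omega> (t - e))" "0 \<notin> jumps \<omega> (t - e)"
      using assms(1) by (auto simp: good_def jumps_def)
    moreover have "card (jumps (case_nat (e, u) \<omega>) t) = card {k. jtime \<omega> k \<le> t - e}"
      unfolding J by (rule card_image) simp
    ultimately have "card (jumps (case_nat (e, u) \<omega>) t) = Suc (card (jumps \<omega> (t - e)))"
      by simp
    then show ?thesis unfolding Q_eq by (simp only: chain_case_nat snd_conv)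
  qed
qed

section \<open>Comparison with sub- and supersolutions\<close>

lemma tail_expo:
  assumes "0 \<le> a"
  shows "(\<integral>\<^sup>+e. ennreal (exponential_density W e) * indicator {a<..} e \<partial>lborel) = ennreal (exp (- W * a))"
proof -
  interpret E: prob_space expo by (rule prob_space_expo)
  have "1 = emeasure expo UNIV" using E.emeasure_space_1 by simp
  also have "\<dots> = (\<integral>\<^sup>+e. ennreal (exponential_density W e) \<partial>lborel)"
    by (subst emeasure_density) (auto simp: exponential_density_def)
  also have "\<dots> = (\<integral>\<^sup>+e. ennreal (exponential_density W e) * indicator {0..a} e
      + ennreal (exponential_density W e) * indicator {a<..} e \<partial>lborel)"
    using assms by (intro nn_integral_cong) (auto simp: exponential_density_def indicator_def)
  also have "\<dots> = (\<integral>\<^sup>+e. ennreal (exponential_density W e) * indicator {0..a} e \<partial>lborel)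
      + (\<integral>\<^sup>+e. ennreal (exponential_density W e) * indicator {a<..} e \<partial>lborel)"
    by (intro nn_integral_add) (auto simp: exponential_density_def)
  also have "\<dots> = ennreal (1 - exp (- W * a)) + (\<integral>\<^sup>+e. ennreal (exponential_density W e) * indicator {a<..} e \<partial>lborel)"
    unfolding expo_interval[OF assms] ..
  finally have "1 = ennreal (1 - exp (- W * a)) + (\<integral>\<^sup>+e. ennreal (exponential_density W e) * indicator {a<..} e \<partial>lborel)" .
  then have "(\<integral>\<^sup>+e. ennreal (exponential_density W e) * indicator {a<..} e \<partial>lborel) = 1 - ennreal (1 - exp (- W * a))"
    by (metis ennreal_add_diff_cancel_left ennreal_neq_top)
  also have "\<dots> = ennreal (1 - (1 - exp (- W * a)))"
    using assms W_pos by (subst ennreal_1[symmetric], subst ennreal_minus) auto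
  finally show ?thesis by simp
qed

text \<open>Variation of constants over the first jump time.\<close>

lemma duhamel:
  fixes F g :: "real \<Rightarrow> real"
  assumes "0 \<le> a" and g: "continuous_on UNIV g" "\<And>e. 0 \<le> g e"
  obtains I where
    "(\<integral>\<^sup>+e. ennreal (exponential_density W e) * (ennreal (g e) * indicator {0..a} e) \<partial>lborel) = ennreal I" "0 \<le> I"
    "\<And>F. continuous_on {0..a} F \<Longrightarrow>
       (\<And>e. 0 < e \<Longrightarrow> e < a \<Longrightarrow> \<exists>d. (F has_real_derivative d) (at e) \<and> 0 \<le> d + W * (g e - F e))
       \<Longrightarrow> F 0 \<le> exp (- W * a) * F a + I"
    "\<And>F. continuous_on {0..a} F \<Longrightarrow>
       (\<And>e. 0 < e \<Longrightarrow> e < a \<Longrightarrow> \<exists>d. (F has_real_derivative d) (at e) \<and> d + W * (g e - F e) \<le> 0)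
       \<Longrightarrow> exp (- W * a) * F a + I \<le> F 0"
proof -
  define k where "k e = W * exp (- W * e) * g e" for e
  \<comment> \<open>Starting the integral at -1 gives \<open>J\<close> a two-sided derivative at
    0.\<close>
  define J where "J e = integral {-1..e} k" for e
  have k: "continuous_on A k" for A
    unfolding k_def using g(1) by (intro continuous_intros) (auto intro: continuous_on_subset)
  have J: "(J has_real_derivative k e) (at e)" if "0 \<le> e" "e \<le> a" for e
  proof -
    have "(J has_real_derivative k e) (at e within {-1..a + 1})"
      unfolding J_def using that by (intro integral_has_real_derivative k) auto
    then show ?thesis using that by (subst (asm) at_within_Icc_at) auto
  qed
  have k0: "0 \<le> k e" for e using W_pos g(2) by (simp add: k_def)
  have "(\<integral>\<^sup>+e. ennreal (exponential_density W e) * (ennreal (g e) * indicator {0..a} e) \<partial>lborel) =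
      (\<integral>\<^sup>+e. ennreal (k e) * indicator {0..a} e \<partial>lborel)"
    using g(2) W_pos
    by (intro nn_integral_cong) (auto simp: exponential_density_def indicator_def k_def ennreal_mult[symmetric] mult_ac)
  also have "\<dots> = ennreal (J a - J 0)"
    using assms(1) k0 J by (intro nn_integral_FTC_Icc borel_measurable_continuous_onI k) auto
  finally have 1: "(\<integral>\<^sup>+e. ennreal (exponential_density W e) * (ennreal (g e) * indicator {0..a} e) \<partial>lborel)
     = ennreal (J a - J 0)" .
  have J_mono: "J 0 \<le> J a"
    by (rule DERIV_nonneg_imp_nondecreasing[OF assms(1)]) (use J k0 in blast)
  have contJ: "continuous_on {0..a} J"
    by (rule DERIV_continuous_on[where D=k], rule has_field_derivative_at_within, rule J) auto
  \<comment> \<open>The integrating factor \<open>exp (- W * e)\<close> turns both differential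
    inequalities into monotonicity of this one function.\<close>
  have der: "((\<lambda>e. exp (- W * e) * F e + J e) has_real_derivative exp (- W * e) * (d + W * (g e - F e))) (at e)"
    if "(F has_real_derivative d) (at e)" "0 < e" "e < a" for F d e
    using that J[of e] by (auto intro!: derivative_eq_intros simp: k_def algebra_simps)
  show ?thesis
  proof (rule that[of "J a - J 0"])
    fix F assume F: "continuous_on {0..a} F"
      "\<And>e. 0 < e \<Longrightarrow> e < a \<Longrightarrow> \<exists>d. (F has_real_derivative d) (at e) \<and> 0 \<le> d + W * (g e - F e)"
    have "exp (- W * 0) * F 0 + J 0 \<le> exp (- W * a) * F a + J a"
    proof (rule DERIV_nonneg_imp_increasing_open[OF assms(1)])
      show "continuous_on {0..a} (\<lambda>e. exp (- W * e) * F e + J e)"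
        by (intro continuous_intros F contJ)
      fix e assume e: "0 < e" "e < a"
      obtain d where d: "(F has_real_derivative d) (at e)" "0 \<le> d + W * (g e - F e)"
        using F(2)[OF e] by blast
      show "\<exists>y. ((\<lambda>e. exp (- W * e) * F e + J e) has_real_derivative y) (at e) \<and> 0 \<le> y"
        by (rule exI, rule conjI, rule der[OF d(1) e]) (use d(2) in auto)
    qed
    then show "F 0 \<le> exp (- W * a) * F a + (J a - J 0)" by simp
  next
    fix F assume F: "continuous_on {0..a} F"
      "\<And>e. 0 < e \<Longrightarrow> e < a \<Longrightarrow> \<exists>d. (F has_real_derivative d) (at e) \<and> d + W * (g e - F e) \<le> 0"
    have "exp (- W * a) * F a + J a \<le> exp (- W * 0) * F 0 + J 0"
    proof (rule DERIV_nonpos_imp_decreasing_open[OF assms(1)])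
      show "continuous_on {0..a} (\<lambda>e. exp (- W * e) * F e + J e)"
        by (intro continuous_intros F contJ)
      fix e assume e: "0 < e" "e < a"
      obtain d where d: "(F has_real_derivative d) (at e)" "d + W * (g e - F e) \<le> 0"
        using F(2)[OF e] by blast
      show "\<exists>y. ((\<lambda>e. exp (- W * e) * F e + J e) has_real_derivative y) (at e) \<and> y \<le> 0"
        by (rule exI, rule conjI, rule der[OF d(1) e]) (use d(2) in \<open>auto simp: mult_nonneg_nonpos\<close>)
    qed
    then show "exp (- W * a) * F a + (J a - J 0) \<le> F 0" by simp
  qed (use 1 J_mono in auto)
qed

definition gen :: "(vec \<Rightarrow> real) \<Rightarrow> vec \<Rightarrow> real" where
  "gen h x = (\<Sum>r\<in>R. lam r * (h (x(r := x r + 1)) - h x) + m x r * (h (x(r := x r - 1)) - h x))"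

text \<open>The fictitious jumps cancel. This links the backward equation, stated with
  \<open>gen\<close>, to the first-jump formula, stated with \<open>avg\<close>.\<close>

lemma gen_avg: "gen h x = W * (avg h x - h x)"
proof -
  have "gen h x = (\<Sum>r\<in>R. lam r * h (x(r := x r + 1)) + m x r * h (x(r := x r - 1))) - (\<Sum>r\<in>R. lam r + m x r) * h x"
    unfolding gen_def sum_distrib_right sum_subtractf[symmetric] by (intro sum.cong) (auto simp: algebra_simps)
  moreover have "W * avg h x = (\<Sum>r\<in>R. lam r * h (x(r := x r + 1)) + m x r * h (x(r := x r - 1)))
     + (W - (\<Sum>r\<in>R. lam r + m x r)) * h x"
    using W_pos by (simp add: avg_def)
  ultimately show ?thesis by (simp add: algebra_simps)
qed

lemma avg_nonneg:
  assumes "x \<in> Rplus R" "\<And>z. 0 \<le> h z"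
  shows "0 \<le> avg h x"
  unfolding avg_def using assms W_pos rates_le_W m_bounds R_D(1)
  by (intro divide_nonneg_nonneg add_nonneg_nonneg sum_nonneg mult_nonneg_nonneg) (auto simp: less_imp_le)

lemma avg_add_const: "avg (\<lambda>z. h z + M) x = avg h x + M"
proof -
  have "W * avg (\<lambda>z. h z + M) x = W * (avg h x + M)"
    using gen_avg[of "\<lambda>z. h z + M" x] gen_avg[of h x] by (simp add: gen_def algebra_simps)
  then show ?thesis using W_pos by simp
qed

lemma continuous_avg:
  fixes f :: "vec \<Rightarrow> real \<Rightarrow> real"
  assumes "\<And>z. continuous_on UNIV (f z)"
  shows "continuous_on UNIV (\<lambda>e. avg (\<lambda>z. f z (s + e)) x)"
proof -
  have "continuous_on UNIV (\<lambda>e. f z (s + e))" for z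
    by (rule continuous_on_compose2[OF assms, where f="\<lambda>e. s + e"])
       (rule continuous_on_add[OF continuous_on_const continuous_on_id], simp)
  then show ?thesis unfolding avg_def using W_pos by (intro continuous_intros) auto
qed

lemma AE_unif_nonneg: "AE u in unif. 0 \<le> u"
  by (rule AE_uniform_measureI) auto

section \<open>Sections of the tube event over the first jump\<close>

context
  fixes \<phi> :: "vec \<Rightarrow> real \<Rightarrow> real" and T c :: real
  assumes \<phi>: "\<And>z. z \<in> Zgrid \<Longrightarrow> continuous_on {0..T} (\<phi> z)" and T: "0 \<le> T"
begin

lemma sets_tub' [intro]: "x \<in> Zplus R \<Longrightarrow> 0 \<le> s \<Longrightarrow> s \<le> T \<Longrightarrow> tub \<phi> T c x s \<in> sets P"
  by (rule sets_tub[OF _ continuous_on_subset[OF \<phi>] Zplus_Zgrid]) auto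

text \<open>\<open>tub\<close> asks for a supremum strictly below \<open>c\<close>, which pointwise
  bounds below \<open>c\<close> would not give; hence the margin \<open>c' < c\<close>.\<close>

lemma tub_shift_lower:
  assumes "good \<omega>" "0 \<le> e" "s + e \<le> T" "\<And>t. s \<le> t \<Longrightarrow> t < s + e \<Longrightarrow> \<phi> x t \<le> c'" "c' < c"
    "\<omega> \<in> tub \<phi> T c (step' x u) (s + e)"
  shows "case_nat (e, u) \<omega> \<in> tub \<phi> T c x s"
proof -
  let ?B = "SUP t\<in>{s + e..T}. ereal (\<phi> (Q (step' x u) \<omega> (t - (s + e))) t)"
  have "(SUP t\<in>{s..T}. ereal (\<phi> (Q x (case_nat (e, u) \<omega>) (t - s)) t)) \<le> max (ereal c') ?B"
  proof (rule SUP_least)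
    fix t assume t: "t \<in> {s..T}"
    show "ereal (\<phi> (Q x (case_nat (e, u) \<omega>) (t - s)) t) \<le> max (ereal c') ?B"
    proof (cases "t < s + e")
      case True
      then show ?thesis using Q_case_nat(1)[OF assms(1,2), of "t - s" x u] t assms(4)[of t]
        by (auto intro!: max.coboundedI1)
    next
      case False
      have "ereal (\<phi> (Q (step' x u) \<omega> (t - (s + e))) t) \<le> ?B"
        using False t by (intro SUP_upper) auto
      then show ?thesis using Q_case_nat(2)[OF assms(1,2), of "t - s" x u] False
        by (auto intro!: max.coboundedI2 simp: algebra_simps)
    qed
  qed
  also have "\<dots> < ereal c" using assms(5,6) by (simp add: tub_def)
  finally show ?thesis by (simp add: tub_def)
qed

lemma tub_shift_upper:
  assumes "good \<omega>" "0 \<le> e" "s + e \<le> T" "case_nat (e, u) \<omega> \<in> tub \<phi> T c x s"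
  shows "\<omega> \<in> tub \<phi> T c (step' x u) (s + e)"
proof -
  have "(SUP t\<in>{s + e..T}. ereal (\<phi> (Q (step' x u) \<omega> (t - (s + e))) t))
      \<le> (SUP t\<in>{s..T}. ereal (\<phi> (Q x (case_nat (e, u) \<omega>) (t - s)) t))"
  proof (rule SUP_mono)
    fix t assume t: "t \<in> {s + e..T}"
    then show "\<exists>t'\<in>{s..T}. ereal (\<phi> (Q (step' x u) \<omega> (t - (s + e))) t) \<le> ereal (\<phi> (Q x (case_nat (e, u) \<omega>) (t' - s)) t')"
      using Q_case_nat(2)[OF assms(1,2), of "t - s" x u] assms(2)
      by (intro bexI[of _ t]) (auto simp: algebra_simps)
  qed
  then show ?thesis using assms(4) by (auto simp: tub_def intro: le_less_trans)
qed

lemma tub_last_lower: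
  assumes "good \<omega>" "0 \<le> e" "T < s + e" "\<And>t. s \<le> t \<Longrightarrow> t \<le> T \<Longrightarrow> \<phi> x t \<le> c'" "c' < c"
  shows "case_nat (e, u) \<omega> \<in> tub \<phi> T c x s"
proof -
  have "(SUP t\<in>{s..T}. ereal (\<phi> (Q x (case_nat (e, u) \<omega>) (t - s)) t)) \<le> ereal c'"
    using Q_case_nat(1)[OF assms(1,2), of _ x u] assms(3,4) by (intro SUP_least) auto
  also have "\<dots> < ereal c" using assms(5) by simp
  finally show ?thesis by (simp add: tub_def)
qed

lemma tub_before_jump:
  assumes "good \<omega>" "0 \<le> e" "s \<le> t" "t \<le> T" "t < s + e" "case_nat (e, u) \<omega> \<in> tub \<phi> T c x s"
  shows "\<phi> x t < c"
proof -
  have "ereal (\<phi> (Q x (case_nat (e, u) \<omega>) (t - s)) t) \<le> (SUP t\<in>{s..T}. ereal (\<phi> (Q x (case_nat (e, u) \<omega>) (t - s)) t))"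
    using assms(3,4) by (intro SUP_upper) auto
  also have "\<dots> < ereal c" using assms(6) by (simp add: tub_def)
  finally show ?thesis using Q_case_nat(1)[OF assms(1,2), of "t - s" x u] assms(5) by simp
qed

abbreviation "S x s \<equiv> measure P (tub \<phi> T c x s)"
abbreviation "sec x s e u \<equiv> {\<omega>. case_nat (e, u) \<omega> \<in> tub \<phi> T c x s}"

text \<open>Integrates the inclusion at the first jump over the uniform variable. \<open>M\<close>
  is the error of the current iterate and passes through the average unchanged.\<close>

lemma section_ge:
  assumes x: "x \<in> Zplus R" and e: "0 \<le> e" "0 \<le> s" "s + e \<le> T"
    and tube: "\<And>t. s \<le> t \<Longrightarrow> t < s + e \<Longrightarrow> \<phi> x t \<le> c'" "c' < c"
    and h: "\<And>z. 0 \<le> h z" "\<And>z. z \<in> Zplus R \<Longrightarrow> h z \<le> S z (s + e) + M" and M: "0 \<le> M"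
  shows "ennreal (avg h x) \<le> (\<integral>\<^sup>+u. emeasure P (sec x s e u) \<partial>unif) + ennreal M"
proof -
  interpret PP: prob_space P by (rule prob_space_P)
  interpret U: prob_space unif by (rule prob_space_unif)
  have A: "tub \<phi> T c x s \<in> sets P" using x e by auto
  have meas: "(\<lambda>u. emeasure P (sec x s e u)) \<in> borel_measurable unif"
    by (rule measurable_compose[OF _ emeasure_P_iter(2)[OF A]]) measurable
  have "ennreal (avg h x) = (\<integral>\<^sup>+u. ennreal (h (step' x u)) \<partial>unif)"
    by (rule nn_integral_step[OF Zplus_Rplus[OF x] h(1), symmetric])
  also have "\<dots> \<le> (\<integral>\<^sup>+u. emeasure P (sec x s e u) + ennreal M \<partial>unif)"
  proof (rule nn_integral_mono_AE, use AE_unif_nonneg in eventually_elim)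
    fix u :: real assume "0 \<le> u"
    then have z: "step' x u \<in> Zplus R" by (rule step_Zplus[OF x])
    have "ennreal (h (step' x u)) \<le> ennreal (S (step' x u) (s + e) + M)"
      by (intro ennreal_leI h(2) z)
    also have "\<dots> = emeasure P (tub \<phi> T c (step' x u) (s + e)) + ennreal M"
      using M by (simp add: PP.emeasure_eq_measure)
    also have "emeasure P (tub \<phi> T c (step' x u) (s + e)) \<le> emeasure P (sec x s e u)"
      using AE_good tub_shift_lower[where x=x and s=s and e=e and u=u] e tube
      by (intro emeasure_mono_AE emeasure_P_iter(3)[OF A]) (auto elim!: eventually_mono)
    finally show "ennreal (h (step' x u)) \<le> emeasure P (sec x s e u) + ennreal M"
      by (simp add: add_right_mono)
  qed
  also have "\<dots> = (\<integral>\<^sup>+u. emeasure P (sec x s e u) \<partial>unif) + ennreal M"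
    using meas by (subst nn_integral_add) (auto simp: U.emeasure_space_1[simplified])
  finally show ?thesis .
qed

lemma section_last_ge:
  assumes x: "x \<in> Zplus R" and e: "0 \<le> e" "0 \<le> s" "s \<le> T" "T < s + e"
    and tube: "\<And>t. s \<le> t \<Longrightarrow> t \<le> T \<Longrightarrow> \<phi> x t \<le> c'" "c' < c"
  shows "1 \<le> (\<integral>\<^sup>+u. emeasure P (sec x s e u) \<partial>unif)"
proof -
  interpret PP: prob_space P by (rule prob_space_P)
  interpret U: prob_space unif by (rule prob_space_unif)
  have A: "tub \<phi> T c x s \<in> sets P" using x e by auto
  have "emeasure P (space P) \<le> emeasure P (sec x s e u)" for u
    using AE_good tub_last_lower[where x=x and s=s and e=e and u=u] e tube
    by (intro emeasure_mono_AE emeasure_P_iter(3)[OF A]) (auto elim!: eventually_mono)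
  then have "(\<integral>\<^sup>+u. 1 \<partial>unif) \<le> (\<integral>\<^sup>+u. emeasure P (sec x s e u) \<partial>unif)"
    using PP.emeasure_space_1 by (intro nn_integral_mono) auto
  then show ?thesis using U.emeasure_space_1 by simp
qed

lemma section_le:
  assumes x: "x \<in> Zplus R" and e: "0 \<le> e" "0 \<le> s" "s + e \<le> T"
    and h: "\<And>z. 0 \<le> h z" "\<And>z. z \<in> Zplus R \<Longrightarrow> S z (s + e) \<le> h z + M" and M: "0 \<le> M"
  shows "(\<integral>\<^sup>+u. emeasure P (sec x s e u) \<partial>unif) \<le> ennreal (avg h x + M)"
proof -
  interpret PP: prob_space P by (rule prob_space_P)
  have A: "tub \<phi> T c x s \<in> sets P" using x e by auto
  have "(\<integral>\<^sup>+u. emeasure P (sec x s e u) \<partial>unif) \<le> (\<integral>\<^sup>+u. ennreal (h (step' x u) + M) \<partial>unif)"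
  proof (rule nn_integral_mono_AE, use AE_unif_nonneg in eventually_elim)
    fix u :: real assume "0 \<le> u"
    then have z: "step' x u \<in> Zplus R" by (rule step_Zplus[OF x])
    have "emeasure P (sec x s e u) \<le> emeasure P (tub \<phi> T c (step' x u) (s + e))"
      using AE_good tub_shift_upper[where x=x and s=s and e=e and u=u] e z
      by (intro emeasure_mono_AE sets_tub') (auto elim!: eventually_mono)
    also have "\<dots> \<le> ennreal (h (step' x u) + M)"
      unfolding PP.emeasure_eq_measure by (intro ennreal_leI h(2) z)
    finally show "emeasure P (sec x s e u) \<le> ennreal (h (step' x u) + M)" .
  qed
  also have "\<dots> = ennreal (avg (\<lambda>z. h z + M) x)"
    using h(1) M by (intro nn_integral_step[OF Zplus_Rplus[OF x]]) auto
  finally show ?thesis by (simp add: avg_add_const)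
qed

text \<open>Used twice: with \<open>t = s\<close> it shows that starts outside the tube contribute
  nothing, and with \<open>t = T\<close> it gives the terminal condition when no jump occurs before
  the horizon.\<close>

lemma section_before_jump_le:
  assumes x: "x \<in> Zplus R" and "0 \<le> e" "s \<le> t" "t \<le> T" "t < s + e"
  shows "(\<integral>\<^sup>+u. emeasure P (sec x s e u) \<partial>unif) \<le> (if \<phi> x t < c then 1 else 0)"
proof -
  interpret PP: prob_space P by (rule prob_space_P)
  interpret U: prob_space unif by (rule prob_space_unif)
  have "emeasure P (sec x s e u) \<le> (if \<phi> x t < c then 1 else 0)" for u
  proof (cases "\<phi> x t < c")
    case False
    have "emeasure P (sec x s e u) \<le> emeasure P {}"
      using AE_good tub_before_jump[where x=x and s=s and e=e and u=u and t=t] assms(2-) False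
      by (intro emeasure_mono_AE) (auto elim!: eventually_mono)
    then show ?thesis using False by simp
  qed (simp add: PP.measure_le_1)
  then have "(\<integral>\<^sup>+u. emeasure P (sec x s e u) \<partial>unif) \<le> (\<integral>\<^sup>+u. (if \<phi> x t < c then 1 else 0) \<partial>unif)"
    by (intro nn_integral_mono)
  also have "\<dots> = (if \<phi> x t < c then 1 else 0)" using U.emeasure_space_1 by simp
  finally show ?thesis .
qed

section \<open>One step of the contraction and its iteration\<close>

lemma lower_step:
  assumes c': "c' < c"
    and f0: "\<And>z t. 0 \<le> f z t" and f1: "\<And>z t. f z t \<le> 1"
    and cont: "\<And>z. continuous_on UNIV (f z)"
    and tube: "\<And>z t. z \<in> Zplus R \<Longrightarrow> 0 \<le> t \<Longrightarrow> t \<le> T \<Longrightarrow> 0 < f z t \<Longrightarrow> \<phi> z t \<le> c'"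
    and sub: "\<And>z t. z \<in> Zplus R \<Longrightarrow> 0 < t \<Longrightarrow> t < T \<Longrightarrow> 0 < f z t \<Longrightarrow>
       \<exists>d. (f z has_real_derivative d) (at t) \<and> 0 \<le> d + gen (\<lambda>w. f w t) z"
    and M: "0 \<le> M" "\<And>z t. z \<in> Zplus R \<Longrightarrow> 0 \<le> t \<Longrightarrow> t \<le> T \<Longrightarrow> f z t \<le> S z t + M"
    and x: "x \<in> Zplus R" and s: "0 \<le> s" "s \<le> T"
  shows "f x s \<le> S x s + (1 - exp (- W * T)) * M"
proof (cases "f x s = 0")
  case True
  then show ?thesis using M(1) T W_pos by (auto intro!: add_nonneg_nonneg mult_nonneg_nonneg)
next
  case False
  interpret PP: prob_space P by (rule prob_space_P)
  have pos: "0 < f x s" using False f0[of x s] by simp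
  \<comment> \<open>\<open>k\<close> bounds \<open>f x\<close> at \<rho>: it is 0 if
    \<open>f x\<close> vanishes there, and 1 if \<open>f x\<close> stays positive up to
    \<open>T\<close>, in which case a path that never jumps before \<open>T\<close> does satisfy the
    tube event.\<close>
  have "\<exists>\<rho> k. s \<le> \<rho> \<and> \<rho> \<le> T \<and> (\<forall>t. s \<le> t \<longrightarrow> t < \<rho> \<longrightarrow> 0 < f x t) \<and> 0 \<le> (k::real) \<and> f x \<rho> \<le> k \<and>
      (k = 0 \<or> k = 1 \<and> \<rho> = T \<and> (\<forall>t. s \<le> t \<longrightarrow> t \<le> T \<longrightarrow> 0 < f x t))"
  proof (cases "\<exists>t\<in>{s..T}. f x t = 0")
    case True
    define Zs where "Zs = {t \<in> {s..T}. f x t = 0}"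
    have "closed Zs"
      unfolding Zs_def using cont[of x]
      by (intro continuous_closed_preimage_constant) (auto intro: continuous_on_subset)
    then have "compact Zs" unfolding Zs_def
      by (metis (no_types, lifting) compact_Icc compact_Int_closed inf.absorb_iff2 mem_Collect_eq subsetI)
    then obtain \<rho> where \<rho>: "\<rho> \<in> Zs" "\<And>t. t \<in> Zs \<Longrightarrow> \<rho> \<le> t"
      using compact_attains_inf[of Zs] True unfolding Zs_def by blast
    have "0 < f x t" if "s \<le> t" "t < \<rho>" for t
      using \<rho>(2)[of t] that \<rho>(1) f0[of x t] by (auto simp: Zs_def less_le)
    then show ?thesis using \<rho>(1) by (intro exI[of _ \<rho>] exI[of _ 0]) (auto simp: Zs_def)
  next
    case False
    then have "0 < f x t" if "s \<le> t" "t \<le> T" for t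
      using that f0[of x t] by (auto simp: less_le)
    then show ?thesis using f1 s by (intro exI[of _ T] exI[of _ 1]) auto
  qed
  then obtain \<rho> k where \<rho>: "s \<le> \<rho>" "\<rho> \<le> T" "\<And>t. s \<le> t \<Longrightarrow> t < \<rho> \<Longrightarrow> 0 < f x t"
    and k: "0 \<le> (k::real)" "f x \<rho> \<le> k"
      "k = 0 \<or> k = 1 \<and> \<rho> = T \<and> (\<forall>t. s \<le> t \<longrightarrow> t \<le> T \<longrightarrow> 0 < f x t)"
    by blast
  define a where "a = \<rho> - s"
  define g where "g e = avg (\<lambda>z. f z (s + e)) x" for e
  define w where "w e = ennreal (exponential_density W e)" for e
  define B where "B e = (\<integral>\<^sup>+u. emeasure P (sec x s e u) \<partial>unif)" for e
  have a: "0 \<le> a" "a \<le> T - s" using \<rho> by (auto simp: a_def)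
  have A: "tub \<phi> T c x s \<in> sets P" using x s by auto
  have [measurable]: "w \<in> borel_measurable borel" unfolding w_def by measurable
  have [measurable]: "B \<in> borel_measurable borel" unfolding B_def by (rule emeasure_P_step(2)[OF A])
  have g: "continuous_on UNIV g" "\<And>e. 0 \<le> g e"
    unfolding g_def by (intro continuous_avg cont, intro avg_nonneg Zplus_Rplus x f0)
  have [measurable]: "g \<in> borel_measurable borel" by (rule borel_measurable_continuous_onI[OF g(1)])
  obtain I where I: "(\<integral>\<^sup>+e. w e * (ennreal (g e) * indicator {0..a} e) \<partial>lborel) = ennreal I" "0 \<le> I"
    "\<And>F. continuous_on {0..a} F \<Longrightarrow>
       (\<And>e. 0 < e \<Longrightarrow> e < a \<Longrightarrow> \<exists>d. (F has_real_derivative d) (at e) \<and> 0 \<le> d + W * (g e - F e))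
       \<Longrightarrow> F 0 \<le> exp (- W * a) * F a + I"
    unfolding w_def by (rule duhamel[OF a(1) g]) blast
  have "f x (s + 0) \<le> exp (- W * a) * f x (s + a) + I"
  proof (rule I(3))
    show "continuous_on {0..a} (\<lambda>e. f x (s + e))"
      by (rule continuous_on_compose2[OF cont]) (auto intro!: continuous_intros)
    fix e assume e: "0 < e" "e < a"
    then obtain d where d: "(f x has_real_derivative d) (at (e + s))" "0 \<le> d + gen (\<lambda>w. f w (e + s)) x"
      using sub[OF x, of "e + s"] \<rho>(3)[of "e + s"] s a by (auto simp: a_def)
    then have "((\<lambda>e. f x (s + e)) has_real_derivative d) (at e)"
      by (simp add: DERIV_shift add.commute[of s])
    then show "\<exists>d. ((\<lambda>e. f x (s + e)) has_real_derivative d) (at e) \<and> 0 \<le> d + W * (g e - f x (s + e))"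
      using d(2) by (intro exI[of _ d]) (simp add: gen_avg g_def add.commute)
  qed
  also have "\<dots> \<le> exp (- W * a) * k + I" using k(2) by (simp add: a_def)
  finally have fxs: "f x s \<le> exp (- W * a) * k + I" by simp
  have "ennreal (exp (- W * a) * k + I) =
      (\<integral>\<^sup>+e. w e * (ennreal (g e) * indicator {0..a} e) \<partial>lborel) + ennreal k * (\<integral>\<^sup>+e. w e * indicator {a<..} e \<partial>lborel)"
    unfolding I(1) using I(2) k(1) tail_expo[OF a(1)]
    by (simp add: w_def ennreal_plus ennreal_mult mult.commute add.commute)
  also have "\<dots> = (\<integral>\<^sup>+e. w e * (ennreal (g e) * indicator {0..a} e) + ennreal k * (w e * indicator {a<..} e) \<partial>lborel)"
    by (subst nn_integral_add) (auto simp: nn_integral_cmult)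
  also have "\<dots> \<le> (\<integral>\<^sup>+e. w e * B e + ennreal M * (w e * indicator {0..T - s} e) \<partial>lborel)"
  proof (rule nn_integral_mono)
    fix e :: real
    consider "e < 0" | "0 \<le> e" "e \<le> a" | "a < e" by linarith
    then show "w e * (ennreal (g e) * indicator {0..a} e) + ennreal k * (w e * indicator {a<..} e)
      \<le> w e * B e + ennreal M * (w e * indicator {0..T - s} e)"
    proof cases
      case 1
      then show ?thesis using a(1) by (simp add: indicator_def)
    next
      case 2
      have "ennreal (g e) \<le> B e + ennreal M"
        unfolding g_def B_def
      proof (rule section_ge[OF x 2(1) s(1) _ _ c' f0 _ M(1)])
        show "\<phi> x t \<le> c'" if "s \<le> t" "t < s + e" for t
          using tube[OF x, of t] \<rho>(3)[of t] that 2 a s by (auto simp: a_def)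
        show "f z (s + e) \<le> S z (s + e) + M" if "z \<in> Zplus R" for z
          using M(2)[OF that, of "s + e"] 2 a s by auto
      qed (use 2 a in auto)
      then have "w e * ennreal (g e) \<le> w e * (B e + ennreal M)" by (rule mult_left_mono) simp
      then show ?thesis using 2 a by (simp add: indicator_def distrib_left mult.commute)
    next
      case 3
      show ?thesis
      proof (cases "k = 0")
        case True
        then show ?thesis using 3 by simp
      next
        case False
        then have last: "k = 1" "\<rho> = T" "\<And>t. s \<le> t \<Longrightarrow> t \<le> T \<Longrightarrow> 0 < f x t" using k(3) by auto
        have "1 \<le> B e" unfolding B_def
          by (rule section_last_ge[OF x _ s _ _ c']) (use 3 a tube[OF x] last s in \<open>auto simp: a_def\<close>)
        then have "w e * 1 \<le> w e * B e" by (rule mult_left_mono) simp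
        then show ?thesis using 3 last by (simp add: a_def indicator_def)
      qed
    qed
  qed
  also have "\<dots> = emeasure P (tub \<phi> T c x s) + ennreal M * ennreal (1 - exp (- W * (T - s)))"
    unfolding emeasure_P_step(1)[OF A] B_def[symmetric] w_def[symmetric]
    using expo_interval[of "T - s"] s
    by (subst nn_integral_add) (auto simp: nn_integral_cmult w_def[symmetric])
  also have "\<dots> = ennreal (S x s + M * (1 - exp (- W * (T - s))))"
    using M(1) s W_pos by (simp add: PP.emeasure_eq_measure ennreal_mult[symmetric] ennreal_plus[symmetric] del: ennreal_plus)
  finally have "exp (- W * a) * k + I \<le> S x s + M * (1 - exp (- W * (T - s)))"
    using M(1) s W_pos by (subst (asm) ennreal_le_iff) auto
  also have "\<dots> \<le> S x s + (1 - exp (- W * T)) * M"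
    using M(1) s W_pos by (auto simp: mult.commute intro!: mult_left_mono)
  finally show ?thesis using fxs by simp
qed

lemma upper_step:
  assumes f0: "\<And>z t. 0 \<le> f z t"
    and cont: "\<And>z. continuous_on UNIV (f z)"
    and final: "\<And>z. z \<in> Zplus R \<Longrightarrow> \<phi> z T < c \<Longrightarrow> 1 \<le> f z T"
    and super: "\<And>z t t'. z \<in> Zplus R \<Longrightarrow> 0 \<le> t' \<Longrightarrow> t' \<le> T \<Longrightarrow> \<phi> z t' < c \<Longrightarrow>
       \<exists>d. (f z has_real_derivative d) (at t) \<and> d + gen (\<lambda>w. f w t) z \<le> 0"
    and M: "0 \<le> M" "\<And>z t. z \<in> Zplus R \<Longrightarrow> 0 \<le> t \<Longrightarrow> t \<le> T \<Longrightarrow> S z t \<le> f z t + M"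
    and x: "x \<in> Zplus R" and s: "0 \<le> s" "s \<le> T"
  shows "S x s \<le> f x s + (1 - exp (- W * T)) * M"
proof -
  interpret PP: prob_space P by (rule prob_space_P)
  define a where "a = T - s"
  define g where "g e = avg (\<lambda>z. f z (s + e)) x" for e
  define w where "w e = ennreal (exponential_density W e)" for e
  define B where "B e = (\<integral>\<^sup>+u. emeasure P (sec x s e u) \<partial>unif)" for e
  have a: "0 \<le> a" using s by (auto simp: a_def)
  have A: "tub \<phi> T c x s \<in> sets P" using x s by auto
  have [measurable]: "w \<in> borel_measurable borel" unfolding w_def by measurable
  have S_eq: "ennreal (S x s) = (\<integral>\<^sup>+e. w e * B e \<partial>lborel)"
    unfolding PP.emeasure_eq_measure[symmetric] B_def w_def by (rule emeasure_P_step(1)[OF A])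
  show ?thesis
  proof (cases "\<phi> x s < c")
    case False
    have "AE e in lborel. w e * B e = 0"
    proof (rule eventually_mono[OF AE_lborel_singleton[of 0]])
      fix e :: real assume "e \<noteq> 0"
      then consider "e < 0" | "0 < e" by linarith
      then show "w e * B e = 0"
      proof cases
        case 2
        then have "B e \<le> 0" unfolding B_def
          using section_before_jump_le[OF x, of e s s] False s by simp
        then show ?thesis by simp
      qed (simp add: w_def exponential_density_def)
    qed
    then have "ennreal (S x s) = 0" unfolding S_eq by (subst nn_integral_cong_AE[where v="\<lambda>_. 0"]) auto
    then have "S x s = 0" by (simp add: ennreal_eq_0_iff measure_le_0_iff)
    then show ?thesis using f0 M(1) T W_pos by (auto intro!: add_nonneg_nonneg mult_nonneg_nonneg)
  next
    case near: True
    have g: "continuous_on UNIV g" "\<And>e. 0 \<le> g e"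
      unfolding g_def by (intro continuous_avg cont, intro avg_nonneg Zplus_Rplus x f0)
    have [measurable]: "g \<in> borel_measurable borel" by (rule borel_measurable_continuous_onI[OF g(1)])
    obtain I where I: "(\<integral>\<^sup>+e. w e * (ennreal (g e) * indicator {0..a} e) \<partial>lborel) = ennreal I" "0 \<le> I"
      "\<And>F. continuous_on {0..a} F \<Longrightarrow>
         (\<And>e. 0 < e \<Longrightarrow> e < a \<Longrightarrow> \<exists>d. (F has_real_derivative d) (at e) \<and> d + W * (g e - F e) \<le> 0)
         \<Longrightarrow> exp (- W * a) * F a + I \<le> F 0"
      unfolding w_def by (rule duhamel[OF a(1) g]) blast
    have fxs: "exp (- W * a) * f x (s + a) + I \<le> f x (s + 0)"
    proof (rule I(3))
      show "continuous_on {0..a} (\<lambda>e. f x (s + e))"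
        by (rule continuous_on_compose2[OF cont]) (auto intro!: continuous_intros)
      fix e assume e: "0 < e" "e < a"
      obtain d where d: "(f x has_real_derivative d) (at (e + s))" "d + gen (\<lambda>w. f w (e + s)) x \<le> 0"
        using super[OF x s near] by blast
      then have "((\<lambda>e. f x (s + e)) has_real_derivative d) (at e)"
        by (simp add: DERIV_shift add.commute[of s])
      then show "\<exists>d. ((\<lambda>e. f x (s + e)) has_real_derivative d) (at e) \<and> d + W * (g e - f x (s + e)) \<le> 0"
        using d(2) by (intro exI[of _ d]) (simp add: gen_avg g_def add.commute)
    qed
    define f_end where "f_end = f x T"
    have "0 \<le> f_end" by (simp add: f_end_def f0)
    have "ennreal (S x s) \<le> (\<integral>\<^sup>+e. (w e * (ennreal (g e) * indicator {0..a} e) + ennreal M * (w e * indicator {0..a} e))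
        + ennreal f_end * (w e * indicator {a<..} e) \<partial>lborel)"
      unfolding S_eq
    proof (rule nn_integral_mono)
      fix e :: real
      consider "e < 0" | "0 \<le> e" "e \<le> a" | "a < e" by linarith
      then show "w e * B e \<le> (w e * (ennreal (g e) * indicator {0..a} e) + ennreal M * (w e * indicator {0..a} e))
        + ennreal f_end * (w e * indicator {a<..} e)"
      proof cases
        case 1
        then show ?thesis by (simp add: w_def exponential_density_def)
      next
        case 2
        have "B e \<le> ennreal (g e + M)"
          unfolding g_def B_def
        proof (rule section_le[OF x 2(1) s(1) _ f0 _ M(1)])
          show "S z (s + e) \<le> f z (s + e) + M" if "z \<in> Zplus R" for z
            using M(2)[OF that, of "s + e"] 2 s by (auto simp: a_def)
        qed (use 2 in \<open>auto simp: a_def\<close>)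
        then have "w e * B e \<le> w e * ennreal (g e + M)" by (rule mult_left_mono) simp
        then show ?thesis using 2 g(2)[of e] M(1) by (simp add: indicator_def distrib_left mult.commute ennreal_plus)
      next
        case 3
        have "B e \<le> (if \<phi> x T < c then 1 else 0)" unfolding B_def
          by (rule section_before_jump_le[OF x]) (use 3 a s in \<open>auto simp: a_def\<close>)
        also have "\<dots> \<le> ennreal f_end"
          using final[OF x] by (simp add: f_end_def)
        finally have "w e * B e \<le> w e * ennreal f_end" by (rule mult_left_mono) simp
        then show ?thesis using 3 a by (simp add: indicator_def mult.commute)
      qed
    qed
    also have "\<dots> = (\<integral>\<^sup>+e. w e * (ennreal (g e) * indicator {0..a} e) \<partial>lborel)
        + ennreal M * (\<integral>\<^sup>+e. w e * indicator {0..a} e \<partial>lborel) + ennreal f_end * (\<integral>\<^sup>+e. w e * indicator {a<..} e \<partial>lborel)"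
      by (subst nn_integral_add, simp, simp, subst nn_integral_add) (auto simp: nn_integral_cmult)
    also have "\<dots> = ennreal I + ennreal M * ennreal (1 - exp (- W * a)) + ennreal f_end * ennreal (exp (- W * a))"
      unfolding I(1) unfolding w_def expo_interval[OF a] tail_expo[OF a] ..
    also have "\<dots> = ennreal (I + M * (1 - exp (- W * a)) + f_end * exp (- W * a))"
      using I(2) M(1) a W_pos \<open>0 \<le> f_end\<close>
      by (simp add: ennreal_mult[symmetric] ennreal_plus[symmetric] del: ennreal_plus)
    finally have "S x s \<le> I + M * (1 - exp (- W * a)) + f_end * exp (- W * a)"
      using I(2) M(1) a W_pos \<open>0 \<le> f_end\<close> by (subst (asm) ennreal_le_iff) auto
    also have "\<dots> \<le> f x s + M * (1 - exp (- W * a))"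
      using fxs by (simp add: f_end_def a_def mult.commute)
    also have "\<dots> \<le> f x s + (1 - exp (- W * T)) * M"
      using M(1) s W_pos by (auto simp: mult.commute a_def intro!: mult_left_mono)
    finally show ?thesis .
  qed
qed

text \<open>The error 1 of the trivial bound shrinks by the factor
  \<open>1 - exp (- W * T) < 1\<close> in each step, uniformly in state and time, so it vanishes in
  the limit.\<close>

lemma contraction_le:
  fixes h S' :: "vec \<Rightarrow> real \<Rightarrow> real"
  assumes init: "\<And>z t. z \<in> Zplus R \<Longrightarrow> 0 \<le> t \<Longrightarrow> t \<le> T \<Longrightarrow> h z t \<le> S' z t + 1"
    and step: "\<And>M x s. 0 \<le> M \<Longrightarrow> (\<And>z t. z \<in> Zplus R \<Longrightarrow> 0 \<le> t \<Longrightarrow> t \<le> T \<Longrightarrow> h z t \<le> S' z t + M) \<Longrightarrow>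
      x \<in> Zplus R \<Longrightarrow> 0 \<le> s \<Longrightarrow> s \<le> T \<Longrightarrow> h x s \<le> S' x s + (1 - exp (- W * T)) * M"
    and x: "x \<in> Zplus R"
  shows "h x 0 \<le> S' x 0"
proof (rule ccontr)
  define q where "q = 1 - exp (- W * T)"
  have q: "0 \<le> q" "q < 1" using T W_pos by (auto simp: q_def)
  have "\<And>z t. z \<in> Zplus R \<Longrightarrow> 0 \<le> t \<Longrightarrow> t \<le> T \<Longrightarrow> h z t \<le> S' z t + q ^ k" for k
  proof (induction k)
    case 0
    then show ?case using init by simp
  next
    case (Suc k)
    show ?case using step[of "q ^ k", OF _ Suc.IH Suc.prems] q by (simp add: q_def)
  qed
  moreover assume "\<not> h x 0 \<le> S' x 0"
  then obtain k where "q ^ k < h x 0 - S' x 0" using real_arch_pow_inv[of "h x 0 - S' x 0" q] q by auto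
  ultimately show False using x T by (metis add.commute less_diff_eq not_less order_refl)
qed

theorem lower_comparison:
  assumes c': "c' < c"
    and f0: "\<And>z t. 0 \<le> f z t" and f1: "\<And>z t. f z t \<le> 1"
    and cont: "\<And>z. continuous_on UNIV (f z)"
    and tube: "\<And>z t. z \<in> Zplus R \<Longrightarrow> 0 \<le> t \<Longrightarrow> t \<le> T \<Longrightarrow> 0 < f z t \<Longrightarrow> \<phi> z t \<le> c'"
    and sub: "\<And>z t. z \<in> Zplus R \<Longrightarrow> 0 < t \<Longrightarrow> t < T \<Longrightarrow> 0 < f z t \<Longrightarrow>
       \<exists>d. (f z has_real_derivative d) (at t) \<and> 0 \<le> d + gen (\<lambda>w. f w t) z"
    and x: "x \<in> Zplus R"
  shows "f x 0 \<le> S x 0"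
proof (rule contraction_le[OF _ _ x])
  show "f z t \<le> S z t + 1" for z t
    using f1[of z t] measure_nonneg[of P "tub \<phi> T c z t"] by linarith
qed (rule lower_step[OF c' f0 f1 cont tube sub])

theorem upper_comparison:
  assumes f0: "\<And>z t. 0 \<le> f z t"
    and cont: "\<And>z. continuous_on UNIV (f z)"
    and final: "\<And>z. z \<in> Zplus R \<Longrightarrow> \<phi> z T < c \<Longrightarrow> 1 \<le> f z T"
    and super: "\<And>z t t'. z \<in> Zplus R \<Longrightarrow> 0 \<le> t' \<Longrightarrow> t' \<le> T \<Longrightarrow> \<phi> z t' < c \<Longrightarrow>
       \<exists>d. (f z has_real_derivative d) (at t) \<and> d + gen (\<lambda>w. f w t) z \<le> 0"
    and x: "x \<in> Zplus R"
  shows "S x 0 \<le> f x 0"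
proof (rule contraction_le[OF _ _ x])
  interpret PP: prob_space P by (rule prob_space_P)
  show "S z t \<le> f z t + 1" for z t
    using f0[of z t] PP.prob_le_1[of "tub \<phi> T c z t"] by linarith
qed (rule upper_step[OF f0 cont final super])

end

section \<open>Products of one-coordinate functions\<close>

text \<open>A jump changes a single coordinate, so the generator acts on a product like a
  derivation.\<close>

lemma gen_prod:
  "gen (\<lambda>w. k * (\<Prod>r\<in>R. F r (w r))) x =
   k * (\<Sum>r\<in>R. (\<Prod>s\<in>R - {r}. F s (x s)) *
     (lam r * (F r (x r + 1) - F r (x r)) + m x r * (F r (x r - 1) - F r (x r))))"
proof -
  have upd: "(\<Prod>s\<in>R. F s ((x(r := v)) s)) = F r v * (\<Prod>s\<in>R - {r}. F s (x s))" if "r \<in> R" for r v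
    using that by (subst prod.remove[OF finite_R that]) (auto intro!: prod.cong)
  have old: "(\<Prod>s\<in>R. F s (x s)) = F r (x r) * (\<Prod>s\<in>R - {r}. F s (x s))" if "r \<in> R" for r
    by (rule prod.remove[OF finite_R that])
  show ?thesis
    unfolding gen_def sum_distrib_left
  proof (rule sum.cong[OF refl])
    fix r assume r: "r \<in> R"
    show "lam r * (k * (\<Prod>s\<in>R. F s ((x(r := x r + 1)) s)) - k * (\<Prod>s\<in>R. F s (x s)))
      + m x r * (k * (\<Prod>s\<in>R. F s ((x(r := x r - 1)) s)) - k * (\<Prod>s\<in>R. F s (x s))) =
      k * ((\<Prod>s\<in>R - {r}. F s (x s)) *
        (lam r * (F r (x r + 1) - F r (x r)) + m x r * (F r (x r - 1) - F r (x r))))"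
      unfolding upd[OF r] old[OF r] by (simp add: algebra_simps)
  qed
qed

text \<open>The exponential is 1 at the horizon, and \<gamma> is the total rate of cost. The third
  argument of \<open>F\<close> is the absolute time, because the centre of the tube moves.\<close>

definition prod_fun :: "(route \<Rightarrow> real \<Rightarrow> real \<Rightarrow> real) \<Rightarrow> real \<Rightarrow> real \<Rightarrow> real \<Rightarrow> vec \<Rightarrow> real \<Rightarrow> real" where
  "prod_fun F k \<gamma> T z t = k * exp (- \<gamma> * (T - t)) * (\<Prod>r\<in>R. F r (z r) t)"

text \<open>The time derivative of the exponential contributes \<gamma> times the product; splitting
  \<gamma> into the shares \<open>cr r\<close> decouples the backward equation into one inequality
  per route.\<close>

lemma prod_fun_generator:
  assumes d: "\<And>r. r \<in> R \<Longrightarrow> (F r (z r) has_real_derivative d r) (at t)"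
    and \<gamma>: "\<gamma> = (\<Sum>r\<in>R. cr r)"
  shows "\<exists>D. (prod_fun F k \<gamma> T z has_real_derivative D) (at t) \<and>
    D + gen (\<lambda>w. prod_fun F k \<gamma> T w t) z =
      k * exp (- \<gamma> * (T - t)) * (\<Sum>r\<in>R. (\<Prod>s\<in>R - {r}. F s (z s) t) *
        (d r + (lam r * (F r (z r + 1) t - F r (z r) t) + m z r * (F r (z r - 1) t - F r (z r) t)) + cr r * F r (z r) t))"
proof -
  define p where "p r = (\<Prod>s\<in>R - {r}. F s (z s) t)" for r
  define E where "E = k * exp (- \<gamma> * (T - t))"
  have pr: "(\<Prod>s\<in>R. F s (z s) t) = F r (z r) t * p r" if "r \<in> R" for r
    unfolding p_def by (rule prod.remove[OF finite_R that])
  have "((\<lambda>t. \<Prod>r\<in>R. F r (z r) t) has_real_derivative (\<Sum>r\<in>R. d r * p r)) (at t)"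
    unfolding p_def by (rule has_field_derivative_prod) (rule d)
  then have D: "(prod_fun F k \<gamma> T z has_real_derivative
      (\<gamma> * E * (\<Prod>r\<in>R. F r (z r) t) + E * (\<Sum>r\<in>R. d r * p r))) (at t)"
    unfolding prod_fun_def[abs_def] E_def by (auto intro!: derivative_eq_intros simp: algebra_simps)
  have "\<gamma> * E * (\<Prod>r\<in>R. F r (z r) t) = E * (\<Sum>r\<in>R. p r * (cr r * F r (z r) t))"
    unfolding \<gamma> sum_distrib_left sum_distrib_right by (intro sum.cong refl) (simp add: pr)
  moreover have "gen (\<lambda>w. prod_fun F k \<gamma> T w t) z = E * (\<Sum>r\<in>R. p r *
      (lam r * (F r (z r + 1) t - F r (z r) t) + m z r * (F r (z r - 1) t - F r (z r) t)))"
    unfolding prod_fun_def E_def p_def by (rule gen_prod[of _ "\<lambda>r v. F r v t"])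
  moreover have "E * (\<Sum>r\<in>R. p r * (cr r * F r (z r) t)) + E * (\<Sum>r\<in>R. d r * p r) + E * (\<Sum>r\<in>R. p r *
      (lam r * (F r (z r + 1) t - F r (z r) t) + m z r * (F r (z r - 1) t - F r (z r) t))) =
     E * (\<Sum>r\<in>R. p r *
        (d r + (lam r * (F r (z r + 1) t - F r (z r) t) + m z r * (F r (z r - 1) t - F r (z r) t)) + cr r * F r (z r) t))"
    unfolding distrib_left[symmetric] sum.distrib[symmetric]
    by (intro arg_cong[where f="(*) E"] sum.cong refl) (simp add: algebra_simps)
  ultimately have "(\<gamma> * E * (\<Prod>r\<in>R. F r (z r) t) + E * (\<Sum>r\<in>R. d r * p r)) + gen (\<lambda>w. prod_fun F k \<gamma> T w t) z =
     E * (\<Sum>r\<in>R. p r *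
        (d r + (lam r * (F r (z r + 1) t - F r (z r) t) + m z r * (F r (z r - 1) t - F r (z r) t)) + cr r * F r (z r) t))"
    by (simp only:)
  then show ?thesis using D unfolding E_def p_def by blast
qed

lemma continuous_prod_fun:
  assumes "\<And>r v. r \<in> R \<Longrightarrow> continuous_on UNIV (F r v)"
  shows "continuous_on UNIV (prod_fun F k \<gamma> T z)"
  unfolding prod_fun_def[abs_def] by (intro continuous_intros assms)

text \<open>A product of nonnegative factors is positive only if every factor is, so the confinement
  of all coordinates may be used when the inequality of a single route is checked.\<close>

theorem lower_product:
  assumes \<phi>: "\<And>z. z \<in> Zgrid \<Longrightarrow> continuous_on {0..T} (\<phi> z)" and T: "0 \<le> T" and c': "c' < c"
    and F: "\<And>r v t. r \<in> R \<Longrightarrow> 0 \<le> F r v t \<and> F r v t \<le> 1"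
    and cont: "\<And>r v. r \<in> R \<Longrightarrow> continuous_on UNIV (F r v)"
    and cr: "\<And>r. r \<in> R \<Longrightarrow> 0 \<le> cr r"
    and tube: "\<And>z t. z \<in> Zplus R \<Longrightarrow> 0 \<le> t \<Longrightarrow> t \<le> T \<Longrightarrow> (\<And>r. r \<in> R \<Longrightarrow> 0 < F r (z r) t) \<Longrightarrow> \<phi> z t \<le> c'"
    and sub: "\<And>z t r. z \<in> Zplus R \<Longrightarrow> 0 < t \<Longrightarrow> t < T \<Longrightarrow> (\<And>r. r \<in> R \<Longrightarrow> 0 < F r (z r) t) \<Longrightarrow> r \<in> R \<Longrightarrow>
       \<exists>d. (F r (z r) has_real_derivative d) (at t) \<and>
         0 \<le> d + (lam r * (F r (z r + 1) t - F r (z r) t) + m z r * (F r (z r - 1) t - F r (z r) t)) + cr r * F r (z r) t"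
    and y: "y \<in> Zplus R"
  shows "exp (- (\<Sum>r\<in>R. cr r) * T) * (\<Prod>r\<in>R. F r (y r) 0) \<le> measure P (tub \<phi> T c y 0)"
proof -
  define \<gamma> where "\<gamma> = (\<Sum>r\<in>R. cr r)"
  have \<gamma>: "0 \<le> \<gamma>" unfolding \<gamma>_def by (intro sum_nonneg cr)
  \<comment> \<open>Freezing the time at \<open>T\<close> keeps \<open>f\<close> below 1 for all
    times, as the exponential may exceed 1 beyond the horizon.\<close>
  define f where "f z t = prod_fun F 1 \<gamma> T z (min t T)" for z t
  have pos: "\<And>r. r \<in> R \<Longrightarrow> 0 < F r (z r) t" if "0 < prod_fun F 1 \<gamma> T z t" for z t
  proof -
    fix r assume r: "r \<in> R"
    have "(\<Prod>r\<in>R. F r (z r) t) \<noteq> 0" using that unfolding prod_fun_def by (intro notI) simp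
    then have "F r (z r) t \<noteq> 0" using r finite_R by (metis prod_zero)
    then show "0 < F r (z r) t" using F[OF r, of "z r" t] by simp
  qed
  have "f y 0 \<le> measure P (tub \<phi> T c y 0)"
  proof (rule lower_comparison[OF \<phi> T c'])
    show "0 \<le> f z t" for z t
      unfolding f_def prod_fun_def using F by (intro mult_nonneg_nonneg prod_nonneg) auto
    show "f z t \<le> 1" for z t
    proof -
      have "f z t \<le> 1 * 1" unfolding f_def prod_fun_def
        using F \<gamma> by (intro mult_mono prod_le_1 prod_nonneg) auto
      then show ?thesis by simp
    qed
    show "continuous_on UNIV (f z)" for z unfolding f_def
      by (rule continuous_on_compose2[OF continuous_prod_fun[OF cont]]) (auto intro!: continuous_intros)
    show "\<phi> z t \<le> c'" if "z \<in> Zplus R" "0 \<le> t" "t \<le> T" "0 < f z t" for z t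
      using that by (intro tube pos) (auto simp: f_def)
    show "\<exists>d. (f z has_real_derivative d) (at t) \<and> 0 \<le> d + gen (\<lambda>w. f w t) z"
      if z: "z \<in> Zplus R" "0 < t" "t < T" "0 < f z t" for z t
    proof -
      have p: "\<And>r. r \<in> R \<Longrightarrow> 0 < F r (z r) t" using z by (intro pos) (auto simp: f_def)
      have "\<forall>r\<in>R. \<exists>d. (F r (z r) has_real_derivative d) (at t) \<and>
         0 \<le> d + (lam r * (F r (z r + 1) t - F r (z r) t) + m z r * (F r (z r - 1) t - F r (z r) t)) + cr r * F r (z r) t"
        using sub[OF z(1-3) p] by blast
      then obtain d where d: "\<And>r. r \<in> R \<Longrightarrow> (F r (z r) has_real_derivative d r) (at t)"
        "\<And>r. r \<in> R \<Longrightarrow> 0 \<le> d r + (lam r * (F r (z r + 1) t - F r (z r) t) + m z r * (F r (z r - 1) t - F r (z r) t)) + cr r * F r (z r) t"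
        by metis
      obtain D where D: "(prod_fun F 1 \<gamma> T z has_real_derivative D) (at t)"
        "D + gen (\<lambda>w. prod_fun F 1 \<gamma> T w t) z =
          1 * exp (- \<gamma> * (T - t)) * (\<Sum>r\<in>R. (\<Prod>s\<in>R - {r}. F s (z s) t) *
        (d r + (lam r * (F r (z r + 1) t - F r (z r) t) + m z r * (F r (z r - 1) t - F r (z r) t)) + cr r * F r (z r) t))"
        using prod_fun_generator[where F=F and d=d and cr=cr and z=z and t=t, OF d(1) \<gamma>_def] by blast
      have "0 \<le> D + gen (\<lambda>w. prod_fun F 1 \<gamma> T w t) z"
        unfolding D(2) using d(2) F by (intro mult_nonneg_nonneg sum_nonneg prod_nonneg) auto
      moreover have "(f z has_real_derivative D) (at t)"
        using D(1) by (rule DERIV_cong_ev[OF refl _ refl, THEN iffD2, rotated])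
          (use eventually_nhds_in_open[of "{..<T}" t] z in \<open>auto simp: f_def elim!: eventually_mono\<close>)
      ultimately show ?thesis using z by (intro exI[of _ D]) (simp add: f_def)
    qed
  qed (simp_all add: y)
  then show ?thesis using T by (simp add: f_def prod_fun_def \<gamma>_def)
qed

text \<open>The prefactor \<open>k\<close> lifts the product to at least 1 in the tube at the
  horizon, which the terminal condition demands.\<close>

theorem upper_product:
  assumes \<phi>: "\<And>z. z \<in> Zgrid \<Longrightarrow> continuous_on {0..T} (\<phi> z)" and T: "0 \<le> T"
    and F: "\<And>r v t. r \<in> R \<Longrightarrow> 0 \<le> F r v t" and k: "0 \<le> k"
    and cont: "\<And>r v. r \<in> R \<Longrightarrow> continuous_on UNIV (F r v)"
    and final: "\<And>z. z \<in> Zplus R \<Longrightarrow> \<phi> z T < c \<Longrightarrow> 1 \<le> k * (\<Prod>r\<in>R. F r (z r) T)"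
    and super: "\<And>z t t' r. z \<in> Zplus R \<Longrightarrow> 0 \<le> t' \<Longrightarrow> t' \<le> T \<Longrightarrow> \<phi> z t' < c \<Longrightarrow> r \<in> R \<Longrightarrow>
       \<exists>d. (F r (z r) has_real_derivative d) (at t) \<and>
         d + (lam r * (F r (z r + 1) t - F r (z r) t) + m z r * (F r (z r - 1) t - F r (z r) t)) + cr r * F r (z r) t \<le> 0"
    and y: "y \<in> Zplus R"
  shows "measure P (tub \<phi> T c y 0) \<le> k * exp (- (\<Sum>r\<in>R. cr r) * T) * (\<Prod>r\<in>R. F r (y r) 0)"
proof -
  define \<gamma> where "\<gamma> = (\<Sum>r\<in>R. cr r)"
  have "measure P (tub \<phi> T c y 0) \<le> prod_fun F k \<gamma> T y 0"
  proof (rule upper_comparison[OF \<phi> T])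
    show "0 \<le> prod_fun F k \<gamma> T z t" for z t
      unfolding prod_fun_def using F k by (intro mult_nonneg_nonneg prod_nonneg) auto
    show "continuous_on UNIV (prod_fun F k \<gamma> T z)" for z
      by (rule continuous_prod_fun[OF cont])
    show "1 \<le> prod_fun F k \<gamma> T z T" if "z \<in> Zplus R" "\<phi> z T < c" for z
      using final[OF that] by (simp add: prod_fun_def)
    show "\<exists>d. (prod_fun F k \<gamma> T z has_real_derivative d) (at t) \<and> d + gen (\<lambda>w. prod_fun F k \<gamma> T w t) z \<le> 0"
      if z: "z \<in> Zplus R" "0 \<le> t'" "t' \<le> T" "\<phi> z t' < c" for z t t'
    proof -
      have "\<forall>r\<in>R. \<exists>d. (F r (z r) has_real_derivative d) (at t) \<and>
         d + (lam r * (F r (z r + 1) t - F r (z r) t) + m z r * (F r (z r - 1) t - F r (z r) t)) + cr r * F r (z r) t \<le> 0"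
        using super[OF z] by blast
      then obtain d where d: "\<And>r. r \<in> R \<Longrightarrow> (F r (z r) has_real_derivative d r) (at t)"
        "\<And>r. r \<in> R \<Longrightarrow> d r + (lam r * (F r (z r + 1) t - F r (z r) t) + m z r * (F r (z r - 1) t - F r (z r) t)) + cr r * F r (z r) t \<le> 0"
        by metis
      obtain D where D: "(prod_fun F k \<gamma> T z has_real_derivative D) (at t)"
        "D + gen (\<lambda>w. prod_fun F k \<gamma> T w t) z =
          k * exp (- \<gamma> * (T - t)) * (\<Sum>r\<in>R. (\<Prod>s\<in>R - {r}. F s (z s) t) *
        (d r + (lam r * (F r (z r + 1) t - F r (z r) t) + m z r * (F r (z r - 1) t - F r (z r) t)) + cr r * F r (z r) t))"
        using prod_fun_generator[where F=F and d=d and cr=cr and z=z and t=t, OF d(1) \<gamma>_def] by blast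
      have "D + gen (\<lambda>w. prod_fun F k \<gamma> T w t) z \<le> 0"
        unfolding D(2) using d(2) F k by (intro mult_nonneg_nonpos sum_nonpos prod_nonneg) auto
      then show ?thesis using D(1) by blast
    qed
  qed (simp_all add: y)
  then show ?thesis by (simp add: prod_fun_def \<gamma>_def)
qed

section \<open>Service rates near a face\<close>

lemma load_scale: "load A (\<lambda>r. z r / c) i = load A z i / c"
  by (simp add: load_def sum_divide_distrib)

text \<open>The rates are homogeneous of degree 0, so a state of order \<open>n\<close> can be
  compared with \<open>x\<close> after division by \<open>n\<close>.\<close>

lemma m_scale:
  assumes "0 < c"
  shows "m (\<lambda>r. z r / c) r = m z r"
proof -
  have "z r / c * min (C (fst r) / (load R z (fst r) / c)) (C (snd r) / (load R z (snd r) / c)) =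
     z r * min (C (fst r) / load R z (fst r)) (C (snd r) / load R z (snd r))"
  proof -
    have "min (c * a) (c * b) = c * min a b" for a b :: real using assms by (simp add: min_mult_distrib_left)
    from this[of "C (fst r) / load R z (fst r)" "C (snd r) / load R z (snd r)"]
    show ?thesis using assms by (simp add: mult.commute)
  qed
  then show ?thesis using assms by (simp add: murate_def nu_def load_scale zero_less_divide_iff)
qed

text \<open>Near \<open>x\<close> the load \<open>l\<close> of the channel is at least
  \<open>z r\<close>, hence at least \<open>mn / 2\<close>. The difference of the fractions is
  \<open>((z r - x r) + (x r / l') * (l' - l)) / l\<close>, and \<open>x r / l'\<close> is at most
  1.\<close>

lemma fraction_near:
  assumes x: "x \<in> Rplus R" and z: "z \<in> Rplus R" and r: "r \<in> R" "on_ch i r" and mn: "0 < mn" "mn \<le> x r"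
    and near: "\<And>s. s \<in> R \<Longrightarrow> \<bar>z s - x s\<bar> \<le> \<eta>" and \<eta>: "\<eta> \<le> mn / 2"
  shows "\<bar>z r / load R z i - x r / load R x i\<bar> \<le> 2 * (1 + real (card R)) * \<eta> / mn"
proof -
  define l where "l = load R z i"
  define l' where "l' = load R x i"
  have zr: "mn / 2 \<le> z r" using near[OF r(1)] \<eta> mn by (auto simp: abs_le_iff)
  have l: "mn / 2 \<le> l" using load_ge[OF z r] zr by (simp add: l_def)
  have l': "x r \<le> l'" "0 < l'" using load_ge[OF x r] mn by (auto simp: l'_def)
  have \<eta>0: "0 \<le> \<eta>" using near[OF r(1)] by linarith
  have "\<bar>l - l'\<bar> \<le> (\<Sum>s\<in>{s \<in> R. on_ch i s}. \<bar>z s - x s\<bar>)"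
    unfolding l_def l'_def load_def sum_subtractf[symmetric] by (rule sum_abs)
  also have "\<dots> \<le> (\<Sum>s\<in>{s \<in> R. on_ch i s}. \<eta>)" using near by (intro sum_mono) auto
  also have "\<dots> = real (card {s \<in> R. on_ch i s}) * \<eta>" by simp
  also have "\<dots> \<le> real (card R) * \<eta>"
    using \<eta>0 by (intro mult_right_mono) (auto intro!: card_mono)
  finally have ll: "\<bar>l - l'\<bar> \<le> real (card R) * \<eta>" .
  have lpos: "0 < l" using l mn by linarith
  have "z r / l - x r / l' = ((z r - x r) + (x r / l') * (l' - l)) / l"
    using lpos l'(2) by (simp add: field_simps)
  also have "\<bar>\<dots>\<bar> \<le> (\<eta> + 1 * (real (card R) * \<eta>)) / l"
  proof -
    have "\<bar>(x r / l') * (l' - l)\<bar> \<le> 1 * (real (card R) * \<eta>)"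
      unfolding abs_mult using l' ll mn by (intro mult_mono) (auto simp: abs_minus_commute)
    then have "\<bar>(z r - x r) + (x r / l') * (l' - l)\<bar> \<le> \<eta> + 1 * (real (card R) * \<eta>)"
      using near[OF r(1)] by linarith
    then show ?thesis unfolding abs_divide using lpos by (simp add: divide_right_mono)
  qed
  also have "\<dots> \<le> (\<eta> + 1 * (real (card R) * \<eta>)) / (mn / 2)"
    using l mn \<eta>0 by (intro divide_left_mono) auto
  finally show ?thesis unfolding l_def l'_def by (simp add: field_simps)
qed

lemma face1_channel:
  assumes "r \<in> face1 R L" "L \<subseteq> R"
  obtains i r' where "r' \<in> L" "on_ch i r'" "i = fst r \<or> i = snd r"
  using assms by (auto simp: face1_def joins_def)

text \<open>If a face route used a channel of \<open>r\<close>, then \<open>r\<close> would be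
  first-order: the other end of that route supplies the \<open>k\<close> in \<open>joins\<close>, as
  the two ends of a route differ.\<close>

lemma not_face1_channel:
  assumes "r \<in> R" "r \<notin> L" "r \<notin> face1 R L" "L \<subseteq> R" "r' \<in> L"
  shows "\<not> on_ch (fst r) r'" "\<not> on_ch (snd r) r'"
proof -
  have *: "\<exists>k. joins i k r'" if "on_ch i r'" for i
  proof (rule exI[of _ "if i = fst r' then snd r' else fst r'"])
    have "r' \<in> R" using assms by auto
    then show "joins i (if i = fst r' then snd r' else fst r') r'"
      using that R_D(7)[of r'] by (auto simp: joins_def on_ch_def)
  qed
  show "\<not> on_ch (fst r) r'" "\<not> on_ch (snd r) r'"
    using *[of "fst r"] *[of "snd r"] assms unfolding face1_def by blast+
qed

lemma nu_eq:
  "x r > 0 \<Longrightarrow> nu R C x r = min (C (fst r) * (x r / load R x (fst r))) (C (snd r) * (x r / load R x (snd r)))"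
  by (simp add: nu_def min_mult_distrib_left mult.commute)

text \<open>A modulus of continuity uniform over all points with face coordinates at least
  \<open>mn\<close>. On the face it is \<open>fraction_near\<close>. On a first-order route the rate
  at \<open>x\<close> is 0, and a single channel shared with the face, of load at least
  \<open>mn / 2\<close>, makes it small at \<open>z\<close>, because the policy takes a
  minimum.\<close>

lemma m_near:
  assumes L: "L \<subseteq> R" and mn: "0 < mn" and \<kappa>: "0 < \<kappa>"
  obtains \<eta> where "0 < \<eta>"
    "\<And>x z r. x \<in> Rplus R \<Longrightarrow> z \<in> Rplus R \<Longrightarrow> (\<And>s. s \<notin> L \<Longrightarrow> x s = 0) \<Longrightarrow> (\<And>s. s \<in> L \<Longrightarrow> mn \<le> x s) \<Longrightarrow>
      (\<And>s. s \<in> R \<Longrightarrow> \<bar>z s - x s\<bar> \<le> \<eta>) \<Longrightarrow> r \<in> L \<union> face1 R L \<Longrightarrow> \<bar>m z r - m x r\<bar> \<le> \<kappa>"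
proof -
  define A where "A = 2 * (1 + real (card R)) / mn"
  define \<eta> where "\<eta> = min (mn / 2) (\<kappa> / (W * A))"
  have A: "0 < A" using mn by (simp add: A_def)
  have W0: "0 < W" using W_pos by simp
  have \<eta>: "0 < \<eta>" "\<eta> \<le> mn / 2" "W * (A * \<eta>) \<le> \<kappa>"
  proof -
    show "0 < \<eta>" using mn \<kappa> A W0 by (auto simp: \<eta>_def)
    show "\<eta> \<le> mn / 2" unfolding \<eta>_def by (rule min.cobounded1)
    have "W * A * \<eta> \<le> W * A * (\<kappa> / (W * A))" using A W0 by (intro mult_left_mono) (auto simp: \<eta>_def)
    then show "W * (A * \<eta>) \<le> \<kappa>" using A W0 by simp
  qed
  have rW: "mu r * (C (fst r) + C (snd r)) \<le> W" if "r \<in> R" for r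
  proof -
    have "mu r * (C (fst r) + C (snd r)) \<le> lam r + mu r * (C (fst r) + C (snd r))" using R_D(1)[OF that] by simp
    also have "\<dots> \<le> (\<Sum>r\<in>R. lam r + mu r * (C (fst r) + C (snd r)))"
      using that
    proof (intro member_le_sum)
      fix s assume "s \<in> R - {r}"
      then show "0 \<le> lam s + mu s * (C (fst s) + C (snd s))" using R_D[of s] by auto
    qed auto
    finally show ?thesis by (simp add: unif_rate_def)
  qed
  show ?thesis
  proof (rule that[OF \<eta>(1)])
    fix x z r
    assume x: "x \<in> Rplus R" "\<And>s. s \<notin> L \<Longrightarrow> x s = 0" "\<And>s. s \<in> L \<Longrightarrow> mn \<le> x s" and z: "z \<in> Rplus R"
      and near: "\<And>s. s \<in> R \<Longrightarrow> \<bar>z s - x s\<bar> \<le> \<eta>" and r: "r \<in> L \<union> face1 R L"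
    have rR: "r \<in> R" using r L by (auto simp: face1_def)
    note pos = R_D[OF rR]
    have "\<bar>nu R C z r - nu R C x r\<bar> \<le> (C (fst r) + C (snd r)) * (A * \<eta>)"
    proof (cases "r \<in> L")
      case True
      have p: "0 < x r" "0 < z r" using x(3)[OF True] mn near[OF rR] \<eta>(2) by (auto simp: abs_le_iff)
      have fr: "\<bar>z r / load R z i - x r / load R x i\<bar> \<le> A * \<eta>" if "on_ch i r" for i
        using fraction_near[OF x(1) z rR that mn x(3)[OF True] near \<eta>(2)] by (simp add: A_def)
      have c: "\<bar>c * a - c * b\<bar> \<le> c * d" if "\<bar>a - b\<bar> \<le> d" "0 < c" for a b c d :: real
        unfolding right_diff_distrib[symmetric] abs_mult using that by simp
      have mm: "\<bar>min a b - min a' b'\<bar> \<le> \<bar>a - a'\<bar> + \<bar>b - b'\<bar>" for a b a' b' :: real by (auto simp: min_def abs_if)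
      show ?thesis
        unfolding nu_eq[where x=x and r=r, OF p(1)] nu_eq[where x=z and r=r, OF p(2)]
        using c[OF fr[OF on_ch_endpoints(1)] pos(3)] c[OF fr[OF on_ch_endpoints(2)] pos(4)]
        by (intro order_trans[OF mm]) (simp add: distrib_right)
    next
      case False
      then have r1: "r \<in> face1 R L" using r by simp
      have x0: "x r = 0" using x(2)[OF False] .
      obtain i r' where i: "r' \<in> L" "on_ch i r'" "i = fst r \<or> i = snd r" using face1_channel[OF r1 L] by blast
      have r'R: "r' \<in> R" using i L by auto
      have "mn / 2 \<le> z r'" using x(3)[OF i(1)] near[OF r'R] \<eta>(2) mn by (auto simp: abs_le_iff)
      then have l: "mn / 2 \<le> load R z i" using load_ge[OF z r'R i(2)] by simp
      have zr: "0 \<le> z r" "z r \<le> \<eta>" using z rR near[OF rR] x0 by (auto simp: Rplus_def)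
      have "nu R C x r = 0" using x0 by (simp add: nu_def)
      moreover have "0 \<le> nu R C z r" using m_bounds(1)[OF z rR] pos(2) by (simp add: murate_def zero_le_mult_iff)
      moreover have "nu R C z r \<le> (C (fst r) + C (snd r)) * (A * \<eta>)"
      proof (cases "0 < z r")
        case True
        have "nu R C z r \<le> C i * (z r / load R z i)" unfolding nu_eq[where x=z and r=r, OF True] using i(3) by auto
        also have "\<dots> \<le> (C (fst r) + C (snd r)) * (\<eta> / (mn / 2))"
          using i(3) pos zr l mn \<eta>(1) by (intro mult_mono frac_le) auto
        also have "\<dots> \<le> (C (fst r) + C (snd r)) * (A * \<eta>)"
        proof (intro mult_left_mono)
          have "2 * \<eta> \<le> 2 * (1 + real (card R)) * \<eta>" using \<eta>(1) by (intro mult_right_mono) auto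
          then show "\<eta> / (mn / 2) \<le> A * \<eta>" using mn by (simp add: A_def divide_right_mono mult.commute)
        qed (use pos in simp)
        finally show ?thesis .
      next
        case False
        then show ?thesis using pos A \<eta>(1) by (simp add: nu_def)
      qed
      ultimately show ?thesis by simp
    qed
    then have "\<bar>m z r - m x r\<bar> \<le> mu r * ((C (fst r) + C (snd r)) * (A * \<eta>))"
      using pos(2) by (simp add: murate_def right_diff_distrib[symmetric] abs_mult)
    also have "\<dots> = (mu r * (C (fst r) + C (snd r))) * (A * \<eta>)" by simp
    also have "\<dots> \<le> W * (A * \<eta>)" using rW[OF rR] A \<eta>(1) by (intro mult_right_mono) auto
    also have "\<dots> \<le> \<kappa>" by (rule \<eta>(3))
    finally show "\<bar>m z r - m x r\<bar> \<le> \<kappa>" .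
  qed
qed

text \<open>Loads are at most \<open>card R * mx\<close>, so the service rate of a face route stays
  away from 0; this keeps the tilts bounded over a box.\<close>

lemma m_lower:
  assumes r: "r \<in> R" and x: "x \<in> Rplus R" and mn: "0 < mn" "mn \<le> x r" and mx: "\<And>s. s \<in> R \<Longrightarrow> x s \<le> mx"
  shows "0 < mu r * (mn * (min (C (fst r)) (C (snd r)) / (real (card R) * mx)))"
    "mu r * (mn * (min (C (fst r)) (C (snd r)) / (real (card R) * mx))) \<le> m x r"
proof -
  note pos = R_D[OF r]
  have mx0: "0 < mx" using mn mx[OF r] by linarith
  have cR: "0 < real (card R)" using r finite_R by (auto simp: card_gt_0_iff)
  show "0 < mu r * (mn * (min (C (fst r)) (C (snd r)) / (real (card R) * mx)))"
    using pos mn mx0 cR by simp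
  have l: "x r \<le> load R x i" "load R x i \<le> real (card R) * mx" if "on_ch i r" for i
  proof -
    show "x r \<le> load R x i" by (rule load_ge[OF x r that])
    have "load R x i \<le> (\<Sum>s\<in>{s \<in> R. on_ch i s}. mx)" unfolding load_def using mx by (intro sum_mono) auto
    also have "\<dots> \<le> real (card R) * mx" using mx0 by (auto intro!: mult_right_mono card_mono)
    finally show "load R x i \<le> real (card R) * mx" .
  qed
  have "min (C (fst r)) (C (snd r)) / (real (card R) * mx) \<le> C i / load R x i" if "on_ch i r" "i = fst r \<or> i = snd r" for i
    using l[OF that(1)] that(2) pos mn by (intro frac_le) auto
  then have "mn * (min (C (fst r)) (C (snd r)) / (real (card R) * mx))
      \<le> x r * min (C (fst r) / load R x (fst r)) (C (snd r) / load R x (snd r))"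
    using mn pos mx0 cR on_ch_endpoints[of r] by (intro mult_mono min.boundedI) auto
  then show "mu r * (mn * (min (C (fst r)) (C (snd r)) / (real (card R) * mx))) \<le> m x r"
    using pos mn unfolding murate_def nu_def by (intro mult_left_mono) auto
qed

lemma ergodic_margin:
  assumes "ergodic N C lam mu"
  obtains \<theta> where "0 < \<theta>" "\<theta> < 1" "\<And>i. i \<in> {1..N} \<Longrightarrow> (\<Sum>r\<in>{r \<in> R. on_ch i r}. lam r / mu r) \<le> \<theta> * C i"
proof -
  define f where "f i = (\<Sum>r\<in>{r \<in> R. on_ch i r}. lam r / mu r) / C i" for i
  \<comment> \<open>The value 1/2 keeps \<theta> positive and the set nonempty.\<close>
  define \<theta> where "\<theta> = Max (insert (1/2) (f ` {1..N}))"
  have "f i < 1" if "i \<in> {1..N}" for i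
    using assms C_pos that by (simp add: ergodic_def f_def)
  then have "\<theta> < 1" unfolding \<theta>_def by (subst Max_less_iff) auto
  moreover have "1 / 2 \<le> \<theta>" unfolding \<theta>_def by (intro Max_ge) auto
  moreover have "(\<Sum>r\<in>{r \<in> R. on_ch i r}. lam r / mu r) \<le> \<theta> * C i" if i: "i \<in> {1..N}" for i
  proof -
    have "f i \<le> \<theta>" unfolding \<theta>_def using i by (intro Max_ge) auto
    then show ?thesis using C_pos i by (simp add: f_def divide_le_eq)
  qed
  ultimately show ?thesis using that[of \<theta>] by auto
qed

text \<open>The ratios \<open>z r * mu r / lam r\<close> act as a Lyapunov function: a second-order route whose
ratio is close to the maximal one is served faster than it is fed, even in the presence of a few
customers on the first-order routes.\<close>

lemma interior_service:
  assumes z: "z \<in> Rplus R" and L: "L \<subseteq> R" and r: "r \<in> R" "r \<notin> L" "r \<notin> face1 R L"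
    and b: "0 < b" and second: "\<And>s. s \<in> R \<Longrightarrow> s \<notin> L \<Longrightarrow> s \<notin> face1 R L \<Longrightarrow> z s \<le> lam s / mu s * b"
    and first: "\<And>s. s \<in> face1 R L \<Longrightarrow> z s \<le> \<epsilon>" and \<epsilon>: "0 \<le> \<epsilon>"
    and \<theta>: "\<And>i. i \<in> {1..N} \<Longrightarrow> (\<Sum>r\<in>{r \<in> R. on_ch i r}. lam r / mu r) \<le> \<theta> * C i"
    and small: "\<And>i. i = fst r \<or> i = snd r \<Longrightarrow> real (card R) * \<epsilon> \<le> b * (\<theta>' - \<theta>) * C i" and \<theta>': "0 < \<theta>'"
    and \<theta>'': "0 < \<theta>''" "\<theta>'' * (lam r / mu r * b) \<le> z r"
  shows "lam r * (\<theta>'' / \<theta>') \<le> m z r"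
proof -
  note pos = R_D[OF r(1)]
  have "0 < \<theta>'' * (lam r / mu r * b)" using \<theta>'' b pos by simp
  then have zr: "0 < z r" using \<theta>''(2) by linarith
  have ld: "0 < load R z i" "load R z i \<le> b * \<theta>' * C i" if i: "i = fst r \<or> i = snd r" for i
  proof -
    have "on_ch i r" using i by (auto simp: on_ch_def)
    then show "0 < load R z i" using load_ge[OF z r(1)] zr by (meson less_le_trans)
    \<comment> \<open>No face route uses channel \<open>i\<close>. Its load is at most
      \<open>b\<close> times the sum of \<open>lam s / mu s\<close>, plus a little from first-order
      routes, which the passage from \<theta> to \<theta>' absorbs.\<close>
    have "load R z i \<le> (\<Sum>s\<in>{s \<in> R. on_ch i s}. lam s / mu s * b + \<epsilon>)"
      unfolding load_def
    proof (rule sum_mono)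
      fix s assume s: "s \<in> {s \<in> R. on_ch i s}"
      then have "s \<notin> L" using not_face1_channel[OF r L, of s] i by auto
      have "0 \<le> lam s / mu s * b" using R_D[of s] s b by simp
      then show "z s \<le> lam s / mu s * b + \<epsilon>"
        using second[of s] first[of s] \<epsilon> s \<open>s \<notin> L\<close> by fastforce
    qed
    also have "\<dots> = b * (\<Sum>s\<in>{s \<in> R. on_ch i s}. lam s / mu s) + real (card {s \<in> R. on_ch i s}) * \<epsilon>"
      by (simp add: sum.distrib sum_distrib_left mult.commute)
    also have "\<dots> \<le> b * (\<theta> * C i) + real (card R) * \<epsilon>"
      using \<theta>[of i] i pos b \<epsilon> by (intro add_mono mult_left_mono mult_right_mono) (auto intro!: card_mono)
    also have "\<dots> \<le> b * \<theta>' * C i" using small[OF i] by (simp add: algebra_simps)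
    finally show "load R z i \<le> b * \<theta>' * C i" .
  qed
  have "1 / (b * \<theta>') \<le> C i / load R z i" if i: "i = fst r \<or> i = snd r" for i
    using ld[OF i] b \<theta>' pos i by (auto simp: field_simps)
  then have mn: "1 / (b * \<theta>') \<le> min (C (fst r) / load R z (fst r)) (C (snd r) / load R z (snd r))" by simp
  have "lam r * (\<theta>'' / \<theta>') = mu r * (\<theta>'' * (lam r / mu r * b) * (1 / (b * \<theta>')))"
    using b pos \<theta>' by simp
  also have "\<dots> \<le> mu r * (z r * min (C (fst r) / load R z (fst r)) (C (snd r) / load R z (snd r)))"
    using \<theta>'' mn b \<theta>' zr pos by (intro mult_left_mono mult_mono) auto
  also have "\<dots> = m z r" using zr by (simp add: murate_def nu_def)
  finally show ?thesis .
qed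

section \<open>Exponential bounds for tube probabilities\<close>

text \<open>A box inside the face, bounded away from its boundary and from infinity. The constants
  that determine \<tau> depend on the box, not on the point.\<close>

definition base_pts :: "route set \<Rightarrow> real \<Rightarrow> real \<Rightarrow> vec set" where
  "base_pts L mn mx = {x \<in> faceset L. \<forall>r\<in>L. mn \<le> x r \<and> x r \<le> mx}"

definition face_cost :: "route set \<Rightarrow> vec \<Rightarrow> vec \<Rightarrow> real" where
  "face_cost L D x = (\<Sum>r\<in>L \<union> face1 R L. lfun (D r) (lam r) (m x r))"

abbreviation "tprob \<equiv> tube_prob N C lam mu"
abbreviation "deviation nrm D n x \<equiv> (\<lambda>z t. nrm (\<lambda>r. z r - real n * x r - D r * t))"

lemma tube_prob_eq:
  "tprob nrm y n x D \<tau> \<delta> = measure P (tub (deviation nrm D n x) (real n * \<tau>) (\<delta> * real n) y 0)"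
  by (simp add: tube_prob_def tub_def)

lemma base_pts_D:
  assumes "x \<in> base_pts L mn mx" "L \<subseteq> R"
  shows "x \<in> Rplus R" "\<And>s. s \<notin> L \<Longrightarrow> x s = 0" "\<And>s. s \<in> L \<Longrightarrow> mn \<le> x s" "\<And>s. s \<in> L \<Longrightarrow> x s \<le> mx"
  using assms unfolding base_pts_def faceset_def Rplus_def
  by (force intro: less_imp_le)+

context
  fixes nrm :: "vec \<Rightarrow> real" and L :: "route set" and D :: vec and mn mx :: real
  assumes nrm: "is_norm_on R nrm" and L: "L \<subseteq> R" and D: "D \<in> Rsub L" and mn: "0 < mn"
begin

lemma finite_face [simp]: "finite L"
  using finite_subset[OF L] by simp

lemma face_subset: "L \<union> face1 R L \<subseteq> R"
  using L by (auto simp: face1_def)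

lemma drift_zero: "r \<notin> L \<Longrightarrow> D r = 0"
  using D unfolding Rsub_def by blast

lemma deviation_Rsub:
  assumes "z \<in> Zgrid" "x \<in> base_pts L mn mx"
  shows "(\<lambda>r. z r - real n * x r - D r * t) \<in> Rsub R"
  unfolding Rsub_def
proof (intro CollectI allI impI)
  fix r assume r: "r \<notin> R"
  then have "r \<notin> L" using L by auto
  moreover have "z r = 0" using assms(1) r unfolding Zgrid_def by blast
  ultimately show "z r - real n * x r - D r * t = 0"
    using drift_zero base_pts_D(2)[OF assms(2) L] by simp
qed

lemma continuous_deviation:
  assumes z: "z \<in> Zgrid" and x: "x \<in> base_pts L mn mx"
  shows "continuous_on A (deviation nrm D n x z)"
proof -
  have DR: "D \<in> Rsub R" using D L by (auto simp: Rsub_def)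
  have "\<bar>deviation nrm D n x z t - deviation nrm D n x z t'\<bar> \<le> nrm D * \<bar>t - t'\<bar>" for t t'
  proof -
    have "\<bar>deviation nrm D n x z t - deviation nrm D n x z t'\<bar>
        \<le> nrm (\<lambda>r. (z r - real n * x r - D r * t) - (z r - real n * x r - D r * t'))"
      by (rule norm_diff_le[OF nrm deviation_Rsub[OF z x] deviation_Rsub[OF z x]])
    also have "(\<lambda>r. (z r - real n * x r - D r * t) - (z r - real n * x r - D r * t')) = (\<lambda>r. (t' - t) * D r)"
      by (simp add: algebra_simps)
    also have "nrm \<dots> = \<bar>t' - t\<bar> * nrm D" by (rule norm_scale[OF nrm DR])
    finally show ?thesis by (simp add: mult.commute abs_minus_commute)
  qed
  then have "(nrm D)-lipschitz_on A (deviation nrm D n x z)"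
    using norm_nonneg[OF nrm DR] by (intro lipschitz_onI) (auto simp: dist_real_def)
  then show ?thesis by (rule lipschitz_on_continuous_on)
qed

text \<open>Half of \<eta> is spent on the width of the tube, the other half on the displacement
  \<open>d * t\<close> of its centre over the time \<open>\<nu> * \<tau>\<close>.\<close>

lemma rescaled_near:
  fixes z x d t \<nu> p \<tau> \<eta> :: real
  assumes "0 < \<nu>" "\<bar>z - \<nu> * x - d * t\<bar> \<le> \<nu> * p" "0 \<le> t" "t \<le> \<nu> * \<tau>" "p \<le> \<eta> / 2" "\<bar>d\<bar> * \<tau> \<le> \<eta> / 2"
  shows "\<bar>z / \<nu> - x\<bar> \<le> \<eta>"
proof -
  have "\<bar>d * t\<bar> \<le> \<bar>d\<bar> * (\<nu> * \<tau>)" unfolding abs_mult using assms(3,4) by (intro mult_left_mono) auto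
  then have "\<bar>z - \<nu> * x\<bar> \<le> \<nu> * (p + \<bar>d\<bar> * \<tau>)" using assms(2) by (simp add: algebra_simps)
  also have "\<dots> \<le> \<nu> * \<eta>" using assms by (intro mult_left_mono) auto
  finally have "\<bar>(z - \<nu> * x) / \<nu>\<bar> \<le> \<eta>" using assms(1) by (simp add: divide_le_eq mult.commute)
  then show ?thesis using assms(1) by (simp add: diff_divide_distrib)
qed

lemma short_time:
  assumes "0 < \<eta>"
  obtains \<tau>0 where "0 < \<tau>0" "\<And>\<tau> r. 0 < \<tau> \<Longrightarrow> \<tau> < \<tau>0 \<Longrightarrow> r \<in> R \<Longrightarrow> \<bar>D r\<bar> * \<tau> \<le> \<eta> / 2"
proof -
  define B where "B = 1 + (\<Sum>r\<in>R. \<bar>D r\<bar>)"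
  have B: "1 \<le> B" by (simp add: B_def sum_nonneg)
  show ?thesis
  proof (rule that[of "\<eta> / (2 * B)"])
    show "0 < \<eta> / (2 * B)" using assms B by simp
    fix \<tau> r assume \<tau>: "0 < \<tau>" "\<tau> < \<eta> / (2 * B)" and r: "r \<in> R"
    have "\<bar>D r\<bar> \<le> (\<Sum>r\<in>R. \<bar>D r\<bar>)" using r by (intro member_le_sum) auto
    then have "\<bar>D r\<bar> * \<tau> \<le> B * (\<eta> / (2 * B))" using \<tau> B by (intro mult_mono) (auto simp: B_def)
    then show "\<bar>D r\<bar> * \<tau> \<le> \<eta> / 2" using B by simp
  qed
qed

lemma tilt_uniform:
  obtains E where "1 \<le> E"
    "\<And>x r. x \<in> base_pts L mn mx \<Longrightarrow> r \<in> L \<Longrightarrow> 0 < m x r \<and> tilt (D r) (lam r) (m x r) \<le> E \<and>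
       1 / tilt (D r) (lam r) (m x r) \<le> E \<and> \<bar>ln (tilt (D r) (lam r) (m x r))\<bar> \<le> E"
proof -
  have "\<exists>E\<ge>1. \<forall>x\<in>base_pts L mn mx. 0 < m x r \<and> tilt (D r) (lam r) (m x r) \<le> E \<and>
       1 / tilt (D r) (lam r) (m x r) \<le> E \<and> \<bar>ln (tilt (D r) (lam r) (m x r))\<bar> \<le> E" if r: "r \<in> L" for r
  proof (cases "base_pts L mn mx = {}")
    case True
    then show ?thesis by auto
  next
    case False
    have rR: "r \<in> R" using r L by auto
    \<comment> \<open>\<open>max mx 0\<close> also bounds the coordinates off the face, which are
      0.\<close>
    define m1 where "m1 = mu r * (mn * (min (C (fst r)) (C (snd r)) / (real (card R) * max mx 0)))"
    have m1: "0 < m1" "m1 \<le> m x r" if x: "x \<in> base_pts L mn mx" for x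
    proof -
      note xD = base_pts_D[OF x L]
      have "x s \<le> max mx 0" for s using xD(2,4)[of s] by (cases "s \<in> L") auto
      from m_lower[OF rR xD(1) mn xD(3)[OF r] this] show "0 < m1" "m1 \<le> m x r" by (auto simp: m1_def)
    qed
    have "0 < m1" using False m1(1) by auto
    obtain E where "1 \<le> E" and E: "\<And>\<mu>. m1 \<le> \<mu> \<Longrightarrow> \<mu> \<le> mu r * (C (fst r) + C (snd r)) \<Longrightarrow>
        tilt (D r) (lam r) \<mu> \<le> E \<and> 1 / tilt (D r) (lam r) \<mu> \<le> E \<and> \<bar>ln (tilt (D r) (lam r) \<mu>)\<bar> \<le> E"
      using tilt_bounded[OF R_D(1)[OF rR] \<open>0 < m1\<close>, of "mu r * (C (fst r) + C (snd r))" "D r"] by blast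
    show ?thesis
    proof (intro exI[of _ E] conjI ballI \<open>1 \<le> E\<close>)
      fix x assume x: "x \<in> base_pts L mn mx"
      from E[OF m1(2)[OF x] m_bounds(2)[OF base_pts_D(1)[OF x L] rR]]
      show "tilt (D r) (lam r) (m x r) \<le> E" "1 / tilt (D r) (lam r) (m x r) \<le> E"
        "\<bar>ln (tilt (D r) (lam r) (m x r))\<bar> \<le> E" by auto
      show "0 < m x r" using m1[OF x] by linarith
    qed
  qed
  then obtain E where E: "\<And>r. r \<in> L \<Longrightarrow> 1 \<le> E r" "\<And>r x. r \<in> L \<Longrightarrow> x \<in> base_pts L mn mx \<Longrightarrow>
      0 < m x r \<and> tilt (D r) (lam r) (m x r) \<le> E r \<and>
       1 / tilt (D r) (lam r) (m x r) \<le> E r \<and> \<bar>ln (tilt (D r) (lam r) (m x r))\<bar> \<le> E r"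
    by metis
  have le: "E r \<le> 1 + sum E L" if "r \<in> L" for r
  proof -
    have "E r \<le> sum E L" using that E(1) by (intro member_le_sum) (auto intro: order_trans[of 0 1])
    then show ?thesis by simp
  qed
  show ?thesis
  proof (rule that[of "1 + sum E L"])
    have "0 \<le> sum E L" using E(1) by (intro sum_nonneg) (auto intro: order_trans[of 0 1])
    then show "1 \<le> 1 + sum E L" by simp
  qed (use E(2) le in \<open>meson order_trans\<close>)
qed

lemma face_cost_split:
  assumes x: "x \<in> base_pts L mn mx"
  shows "face_cost L D x = (\<Sum>r\<in>R. if r \<in> L \<union> face1 R L then lfun (D r) (lam r) (m x r) else 0)"
  unfolding face_cost_def using face_subset
  by (subst sum.inter_restrict[symmetric]) (auto intro!: sum.cong)

text \<open>Off the face both the base point and the drift vanish, so the service rate at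
  \<open>x\<close> is 0 and the cost is that of having no arrivals at all.\<close>

lemma first_order_cost:
  assumes x: "x \<in> base_pts L mn mx" and r: "r \<in> face1 R L"
  shows "x r = 0" "D r = 0" "lfun (D r) (lam r) (m x r) = lam r"
proof -
  have rL: "r \<in> R" "r \<notin> L" using r by (auto simp: face1_def)
  show "x r = 0" "D r = 0" using rL base_pts_D(2)[OF x L] drift_zero by auto
  then show "lfun (D r) (lam r) (m x r) = lam r"
    using lfun_zero[OF R_D(1)[OF rL(1)]] by (simp add: murate_def nu_def)
qed

section \<open>The lower bound\<close>

text \<open>All smallness conditions are hypotheses, which separates the verification from the
  choice of constants. Per unit of \<open>n\<close>, \<open>b\<close> is the half-width on the face
  and sets the barrier heights, and \<epsilon>1 bounds the start off the face;
  \<open>\<kappa>0\<close> is the error of the rates, \<omega> the strength of the hump, and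
  \<open>e'\<close> the unit of error per route.\<close>

lemma tube_lower_core:
  fixes n :: nat
  assumes x: "x \<in> base_pts L mn mx" and y: "y \<in> Zplus R" and n: "0 < real n" and \<tau>: "0 < \<tau>"
    and E: "1 \<le> E" "\<And>r. r \<in> L \<Longrightarrow> 0 < m x r \<and> tilt (D r) (lam r) (m x r) \<le> E \<and>
       1 / tilt (D r) (lam r) (m x r) \<le> E \<and> \<bar>ln (tilt (D r) (lam r) (m x r))\<bar> \<le> E"
    and \<theta>: "\<And>i. i \<in> {1..N} \<Longrightarrow> (\<Sum>r\<in>{r \<in> R. on_ch i r}. lam r / mu r) \<le> \<theta> * C i"
      "0 < \<theta>" "\<theta> < \<theta>'" "\<theta>' < \<theta>''" "\<theta>'' < 1"
    and g0: "0 < g0" "\<And>r. r \<in> R \<Longrightarrow> g0 \<le> lam r \<and> g0 \<le> lam r / mu r \<and> g0 \<le> C (fst r) \<and> g0 \<le> C (snd r)"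
    and \<rho>m: "1 \<le> \<rho>m" "\<And>r. r \<in> R \<Longrightarrow> lam r / mu r \<le> \<rho>m"
    and e': "0 < e'" and \<omega>: "0 < \<omega>" "\<omega> \<le> 1" "W * E * \<omega> \<le> e'"
    and \<kappa>0: "0 \<le> \<kappa>0" "\<kappa>0 * E \<le> g0 / E * \<omega> / 16" "\<kappa>0 * (E + 1) \<le> e'"
    and near: "\<And>z r. z \<in> Rplus R \<Longrightarrow> (\<And>s. s \<in> R \<Longrightarrow> \<bar>z s - x s\<bar> \<le> \<eta>) \<Longrightarrow> r \<in> L \<Longrightarrow> \<bar>m z r - m x r\<bar> \<le> \<kappa>0"
    and b: "0 < b" "\<rho>m * b \<le> \<eta> / 2" "a2 * (\<rho>m * b) < \<delta>" and D\<tau>: "\<And>r. r \<in> R \<Longrightarrow> \<bar>D r\<bar> * \<tau> \<le> \<eta> / 2"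
    and a2: "\<And>v b. v \<in> Rsub R \<Longrightarrow> 0 \<le> b \<Longrightarrow> (\<And>r. r \<in> R \<Longrightarrow> \<bar>v r\<bar> \<le> b) \<Longrightarrow> nrm v \<le> a2 * b"
    and \<epsilon>1: "0 \<le> \<epsilon>1" "\<epsilon>1 \<le> b" "\<epsilon>1 \<le> g0 * b / 2" "real (card R) * \<epsilon>1 \<le> b * (\<theta>' - \<theta>) * g0"
    and yx: "\<And>r. r \<in> R \<Longrightarrow> \<bar>y r - real n * x r\<bar> \<le> \<epsilon>1 * real n" "\<And>r. r \<in> R \<Longrightarrow> \<bar>y r - real n * x r\<bar> \<le> b * real n / 2"
    and \<alpha>: "\<alpha> = ln (\<theta>'' / \<theta>')"
    and big: "48 \<le> \<omega> * (b * real n)" "1 \<le> \<alpha> * ((1 - \<theta>'') * (g0 * b * real n))"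
      "W * (exp \<alpha> - 1) * exp (- (\<alpha> * ((1 - \<theta>'') * (g0 * b * real n)))) \<le> e' / 2"
      "1 \<le> \<alpha> * (g0 * b * real n / 2)"
  shows "exp (- (face_cost L D x + 2 * real (card R) * e') * (real n * \<tau>)) * (exp (- (2 * E + 1) * (b * real n)) / 2) ^ card R
    \<le> tprob nrm y n x D \<tau> \<delta>"
proof -
  define \<nu> where "\<nu> = real n"
  define \<beta> where "\<beta> = b * \<nu>"
  define u where "u r = tilt (D r) (lam r) (m x r)" for r
  \<comment> \<open>On a first-order route the factor is an indicator: an arrival that would exceed
    the starting value kills it, departures do no harm, and the price is at most
    \<open>lam r\<close>. Barrier heights are proportional to \<open>lam r / mu r\<close>, so
    together they bound the Lyapunov function by \<beta>.\<close>
  define F where "F r v t = (if r \<in> L then tilted_hill (ln (u r)) \<beta> \<omega> (v - \<nu> * x r - D r * t)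
    else if r \<in> face1 R L then (if v \<le> y r then 1 else 0) else barrier \<alpha> (lam r / mu r * \<beta>) v)" for r v t
  \<comment> \<open>On the face one \<open>e'\<close> pays for using the rates at \<open>x\<close>
    instead of those at \<open>z\<close>, the other for the hump. On a second-order route they cover
    the loss of the barrier.\<close>
  define cr where "cr r = (if r \<in> L \<union> face1 R L then lfun (D r) (lam r) (m x r) else 0) + 2 * e'" for r
  note xD = base_pts_D[OF x L]
  have \<nu>: "0 < \<nu>" using n by (simp add: \<nu>_def)
  have \<beta>: "0 < \<beta>" using \<nu> b by (simp add: \<beta>_def)
  have \<theta>'0: "0 < \<theta>'" "0 < \<theta>''" using \<theta> by auto
  have \<alpha>0: "0 < \<alpha>" "exp \<alpha> = \<theta>'' / \<theta>'" using \<theta> \<theta>'0 by (auto simp: \<alpha>)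
  have out: "x r = 0" "D r = 0" if "r \<notin> L" for r using that xD(2) drift_zero by auto
  have u: "0 < u r" "u r \<le> E" "1 / u r \<le> E" "\<bar>ln (u r)\<bar> \<le> E" "0 < m x r" "r \<in> R" "0 < lam r" if "r \<in> L" for r
    using E(2)[OF that] tilt_props(1)[of "lam r" "m x r" "D r"] that L R_D(1)[of r] by (auto simp: u_def)
  \<comment> \<open>Positivity of all factors confines every coordinate, with the common width
    \<open>\<rho>m * \<beta>\<close>. This gives both the tube condition and, after division by
    \<open>n\<close>, the closeness of the rates.\<close>
  have region: "\<bar>z r - \<nu> * x r - D r * t\<bar> \<le> \<rho>m * \<beta>"
    "r \<in> L \<Longrightarrow> \<bar>z r - \<nu> * x r - D r * t\<bar> < \<beta>"
    "r \<in> face1 R L \<Longrightarrow> z r \<le> \<epsilon>1 * \<nu>"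
    "r \<notin> L \<Longrightarrow> r \<notin> face1 R L \<Longrightarrow> z r < lam r / mu r * \<beta>"
    if z: "z \<in> Zplus R" and p: "\<And>r. r \<in> R \<Longrightarrow> 0 < F r (z r) t" and r: "r \<in> R" for z t r
  proof -
    have zr: "0 \<le> z r" using Zplus_Rplus[OF z] r by (simp add: Rplus_def)
    show 1: "\<bar>z r - \<nu> * x r - D r * t\<bar> < \<beta>" if "r \<in> L"
      using p[OF r] that tilted_hill_pos_iff[OF \<beta> \<omega>(1)] by (simp add: F_def)
    show 2: "z r \<le> \<epsilon>1 * \<nu>" if "r \<in> face1 R L"
    proof -
      have "r \<notin> L" using that by (auto simp: face1_def)
      then have "z r \<le> y r" using p[OF r] that by (simp add: F_def split: if_splits)
      also have "\<dots> \<le> \<epsilon>1 * \<nu>" using yx(1)[OF r] out \<open>r \<notin> L\<close> by (simp add: \<nu>_def)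
      finally show ?thesis .
    qed
    show 3: "z r < lam r / mu r * \<beta>" if "r \<notin> L" "r \<notin> face1 R L"
      using p[OF r] that barrier_pos_iff[OF \<alpha>0(1)] by (simp add: F_def)
    have \<rho>: "\<beta> \<le> \<rho>m * \<beta>" "lam r / mu r * \<beta> \<le> \<rho>m * \<beta>" "\<epsilon>1 * \<nu> \<le> \<beta>"
      using \<rho>m r \<beta> \<epsilon>1(2) \<nu> mult_right_mono[of 1 \<rho>m \<beta>] mult_right_mono[of "lam r / mu r" \<rho>m \<beta>]
        mult_right_mono[of \<epsilon>1 b \<nu>] by (auto simp: \<beta>_def)
    show "\<bar>z r - \<nu> * x r - D r * t\<bar> \<le> \<rho>m * \<beta>"
    proof (cases "r \<in> L")
      case True
      then show ?thesis using 1 \<rho> by linarith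
    next
      case False
      then show ?thesis using 2 3 \<rho> zr out[OF False] by (cases "r \<in> face1 R L") auto
    qed
  qed
  have m_close: "\<bar>m z r - m x r\<bar> \<le> \<kappa>0"
    if z: "z \<in> Zplus R" and t: "0 \<le> t" "t \<le> \<nu> * \<tau>" and p: "\<And>r. r \<in> R \<Longrightarrow> 0 < F r (z r) t" and r: "r \<in> L" for z t r
  proof -
    have "\<bar>m (\<lambda>r. z r / \<nu>) r - m x r\<bar> \<le> \<kappa>0"
    proof (rule near[OF _ _ r])
      show "(\<lambda>r. z r / \<nu>) \<in> Rplus R" using Zplus_Rplus[OF z] \<nu> by (simp add: Rplus_def)
      fix s assume s: "s \<in> R"
      show "\<bar>z s / \<nu> - x s\<bar> \<le> \<eta>"
        by (rule rescaled_near[where p="\<rho>m * b", OF \<nu> _ t]) (use region(1)[OF z p s] b(2) D\<tau>[OF s] in \<open>auto simp: \<beta>_def mult_ac\<close>)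
    qed
    then show ?thesis by (simp add: m_scale[OF \<nu>])
  qed
  have lnn: "0 \<le> lfun (D r) (lam r) (m x r)" if "r \<in> L \<union> face1 R L" for r
  proof (cases "r \<in> L")
    case True
    then show ?thesis using lfun_nonneg u(5,7) by blast
  next
    case False
    then show ?thesis using that first_order_cost(3)[OF x, of r] R_D(1)[of r] by (auto simp: face1_def)
  qed
  have cr0: "0 \<le> cr r" for r using lnn e' by (auto simp: cr_def)
  have Fpos: "0 \<le> F r v t" "F r v t \<le> 1" for r v t
    using tilted_hill_bounds[OF \<beta> \<omega>(1)] barrier_bounds by (auto simp: F_def)
  have tub_ge: "exp (- (\<Sum>r\<in>R. cr r) * (\<nu> * \<tau>)) * (\<Prod>r\<in>R. F r (y r) 0)
      \<le> measure P (tub (deviation nrm D n x) (\<nu> * \<tau>) (\<delta> * \<nu>) y 0)"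
  proof (rule lower_product[where c'="a2 * (\<rho>m * \<beta>)"])
    show "continuous_on {0..\<nu> * \<tau>} (deviation nrm D n x z)" if "z \<in> Zgrid" for z
      by (rule continuous_deviation[OF that x])
    show "0 \<le> \<nu> * \<tau>" using \<nu> \<tau> by simp
    show "a2 * (\<rho>m * \<beta>) < \<delta> * \<nu>"
      using mult_strict_right_mono[OF b(3) \<nu>] by (simp add: \<beta>_def mult.assoc)
    show "0 \<le> F r v t \<and> F r v t \<le> 1" for r v t using Fpos by auto
    show "continuous_on UNIV (F r v)" for r v
      unfolding F_def using continuous_tilted_hill[of "ln (u r)" \<beta> \<omega> "v - \<nu> * x r" "D r"]
      by (cases "r \<in> L") simp_all
    show "0 \<le> cr r" for r by (rule cr0)
    show "deviation nrm D n x z t \<le> a2 * (\<rho>m * \<beta>)"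
      if z: "z \<in> Zplus R" "0 \<le> t" "t \<le> \<nu> * \<tau>" and p: "\<And>r. r \<in> R \<Longrightarrow> 0 < F r (z r) t" for z t
    proof (rule a2[OF deviation_Rsub[OF Zplus_Zgrid[OF z(1)] x]])
      show "0 \<le> \<rho>m * \<beta>" using \<rho>m(1) \<beta> by simp
      show "\<bar>z r - real n * x r - D r * t\<bar> \<le> \<rho>m * \<beta>" if "r \<in> R" for r
        using region(1)[OF z(1) p that] by (simp add: \<nu>_def)
    qed
    show "y \<in> Zplus R" by (rule y)
    fix z t r
    assume z: "z \<in> Zplus R" and t: "0 < t" "t < \<nu> * \<tau>" and p: "\<And>r. r \<in> R \<Longrightarrow> 0 < F r (z r) t" and r: "r \<in> R"
    have zR: "z \<in> Rplus R" by (rule Zplus_Rplus[OF z])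
    have m0: "0 \<le> m z r" by (rule m_bounds(1)[OF zR r])
    note pos = R_D[OF r]
    show "\<exists>d. (F r (z r) has_real_derivative d) (at t) \<and>
         0 \<le> d + (lam r * (F r (z r + 1) t - F r (z r) t) + m z r * (F r (z r - 1) t - F r (z r) t)) + cr r * F r (z r) t"
    proof (cases "r \<in> L")
      case True
      note uL = u[OF True]
      define v where "v = z r - \<nu> * x r"
      define d where "d = - D r * (exp (ln (u r) * (v - D r * t) - \<bar>ln (u r)\<bar> * \<beta>) *
        (ln (u r) * hill \<beta> \<omega> (v - D r * t) - \<omega> / \<beta> * (v - D r * t) * exp (- (\<omega> / \<beta>) * (v - D r * t)\<^sup>2 / 2)))"
      have reg: "\<bar>v - D r * t\<bar> < \<beta>" using region(2)[OF z p r True] by (simp add: v_def)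
      have Fv: "F r (z r) = (\<lambda>t. tilted_hill (ln (u r)) \<beta> \<omega> (v - D r * t))"
        using True by (simp add: F_def v_def fun_eq_iff)
      have "(F r (z r) has_real_derivative d) (at t)"
        unfolding Fv d_def by (rule tilted_hill_deriv[OF \<beta> \<omega>(1) reg])
      moreover have "0 \<le> d + (lam r * (tilted_hill (ln (u r)) \<beta> \<omega> ((v - D r * t) + 1) - tilted_hill (ln (u r)) \<beta> \<omega> (v - D r * t))
         + m z r * (tilted_hill (ln (u r)) \<beta> \<omega> ((v - D r * t) - 1) - tilted_hill (ln (u r)) \<beta> \<omega> (v - D r * t)))
         + cr r * tilted_hill (ln (u r)) \<beta> \<omega> (v - D r * t)"
      proof (rule tilted_hill_generator[OF \<beta> \<omega>(1,2) _ reg pos(1) m0 uL(1) _ _ _ refl d_def, where \<kappa>="\<kappa>0 * E"])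
        show "48 \<le> \<omega> * \<beta>" using big(1) by (simp add: \<beta>_def \<nu>_def)
        have dm: "\<bar>m z r - m x r\<bar> \<le> \<kappa>0" using t by (intro m_close[OF z _ _ p True]) auto
        \<comment> \<open>The tilt belongs to the base point \<open>x\<close>, the rate to the
          current state \<open>z\<close>; the mismatch in the drift is
          \<open>(m z r - m x r) / u r\<close>.\<close>
        have D_eq: "D r = lam r * u r - m x r / u r"
          using tilt_props(2)[OF pos(1) uL(5), of "D r"] by (simp add: u_def)
        have "D r - (lam r * u r - m z r / u r) = (m z r - m x r) * (1 / u r)"
          unfolding D_eq by (simp add: algebra_simps diff_divide_distrib)
        then have "\<bar>D r - (lam r * u r - m z r / u r)\<bar> = \<bar>m z r - m x r\<bar> * (1 / u r)"
          using uL(1) by (simp add: abs_mult)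
        also have "\<dots> \<le> \<kappa>0 * E" using dm uL(1,3) \<kappa>0(1) by (intro mult_mono) auto
        finally show "\<bar>D r - (lam r * u r - m z r / u r)\<bar> \<le> \<kappa>0 * E" .
        have "g0 / E \<le> lam r * u r"
        proof -
          have "1 / E \<le> u r" using uL(1,3) E(1) by (simp add: field_simps)
          then have "g0 * (1 / E) \<le> lam r * u r" using g0 r E(1) pos by (intro mult_mono) auto
          then show ?thesis by simp
        qed
        then have "g0 / E * \<omega> / 16 \<le> lam r * u r * \<omega> / 16" using \<omega> by (intro divide_right_mono mult_right_mono) auto
        then show "\<kappa>0 * E \<le> lam r * u r * \<omega> / 16" using \<kappa>0(2) by linarith
        \<comment> \<open>The Legendre expression is affine in the service rate, so the same
          mismatch changes the cost by \<open>(m x r - m z r) * (1 / u r - 1)\<close>.\<close>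
        have "ln (u r) * D r - lam r * (u r - 1) - m z r * (1 / u r - 1) =
          lfun (D r) (lam r) (m x r) + (m x r - m z r) * (1 / u r - 1)"
          using lfun_tilt[OF pos(1) uL(5), of "D r"] by (simp add: u_def[symmetric] algebra_simps diff_divide_distrib)
        also have "(m x r - m z r) * (1 / u r - 1) \<le> \<kappa>0 * (E + 1)"
        proof -
          have "\<bar>1 / u r - 1\<bar> \<le> E + 1" using uL(1,3) by (auto simp: abs_le_iff) (smt (verit) divide_pos_pos)
          then have "\<bar>(m x r - m z r) * (1 / u r - 1)\<bar> \<le> \<kappa>0 * (E + 1)"
            unfolding abs_mult using dm \<kappa>0(1) by (intro mult_mono) (auto simp: abs_minus_commute)
          then show ?thesis by linarith
        qed
        finally have 1: "ln (u r) * D r - lam r * (u r - 1) - m z r * (1 / u r - 1) \<le> lfun (D r) (lam r) (m x r) + e'"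
          using \<kappa>0(3) by linarith
        have "lam r * u r + m z r / u r \<le> lam r * E + m z r * E"
          using uL(1-3) pos m0 mult_left_mono[OF uL(3) m0] by (intro add_mono mult_left_mono) auto
        also have "\<dots> \<le> W * E"
        proof -
          have "(lam r + m z r) * E \<le> W * E" using E(1) rate_le_W[OF zR r] by (intro mult_right_mono) auto
          then show ?thesis by (simp add: distrib_right)
        qed
        finally have "lam r * u r + m z r / u r \<le> W * E" .
        moreover have "\<omega>\<^sup>2 / 8 \<le> \<omega>" using \<omega> by (simp add: power2_eq_square mult_le_one)
        ultimately have "(lam r * u r + m z r / u r) * (\<omega>\<^sup>2 / 8) \<le> (W * E) * \<omega>"
          using W_pos E(1) by (intro mult_mono) auto
        then have 2: "(lam r * u r + m z r / u r) * \<omega>\<^sup>2 / 8 \<le> e'" using \<omega>(3) by simp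
        show "ln (u r) * D r - lam r * (u r - 1) - m z r * (1 / u r - 1) + (lam r * u r + m z r / u r) * \<omega>\<^sup>2 / 8 \<le> cr r"
        proof -
          have "cr r = lfun (D r) (lam r) (m x r) + 2 * e'" using True by (simp add: cr_def)
          then show ?thesis using 1 2 by linarith
        qed
      qed
      then have "0 \<le> d + (lam r * (F r (z r + 1) t - F r (z r) t) + m z r * (F r (z r - 1) t - F r (z r) t)) + cr r * F r (z r) t"
        using True by (simp add: F_def v_def algebra_simps)
      ultimately show ?thesis by blast
    next
      case rL: False
      then have der: "(F r (z r) has_real_derivative 0) (at t)"
        by (cases "r \<in> face1 R L") (simp_all add: F_def[abs_def])
      show ?thesis
      proof (cases "r \<in> face1 R L")
        case True
        have "z r \<le> y r" using p[OF r] rL True by (simp add: F_def split: if_splits)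
        moreover have "lam r \<le> cr r" using True first_order_cost(3)[OF x True] e' by (simp add: cr_def)
        ultimately have "0 \<le> 0 + (lam r * (F r (z r + 1) t - F r (z r) t) + m z r * (F r (z r - 1) t - F r (z r) t)) + cr r * F r (z r) t"
          using rL True cr0[of r] by (simp add: F_def)
        then show ?thesis using der by blast
      next
        case False
        \<comment> \<open>The layer in which the barrier needs inward drift: there
          \<open>z r\<close> is at least the fraction \<theta>'' of the barrier height.\<close>
        define g where "g = (1 - \<theta>'') * (lam r / mu r * \<beta>)"
        have gs: "\<alpha> * ((1 - \<theta>'') * (g0 * b * real n)) \<le> \<alpha> * g"
        proof -
          have "g0 * b * real n \<le> lam r / mu r * \<beta>"
            using mult_right_mono[of g0 "lam r / mu r" \<beta>] g0(2)[OF r] \<beta> by (simp add: \<beta>_def \<nu>_def mult.assoc)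
          then show ?thesis unfolding g_def using \<alpha>0(1) \<theta>(5) by (intro mult_left_mono) auto
        qed
        have "0 \<le> lam r * (barrier \<alpha> (lam r / mu r * \<beta>) (z r + 1) - barrier \<alpha> (lam r / mu r * \<beta>) (z r))
          + m z r * (barrier \<alpha> (lam r / mu r * \<beta>) (z r - 1) - barrier \<alpha> (lam r / mu r * \<beta>) (z r))
          + e' * barrier \<alpha> (lam r / mu r * \<beta>) (z r)"
        proof (rule barrier_generator[OF \<alpha>0(1) pos(1) m0 region(4)[OF z p r rL False], where g=g])
          assume "lam r / mu r * \<beta> - g \<le> z r"
          moreover have "X - (1 - \<theta>'') * X = \<theta>'' * X" for X by (simp add: algebra_simps)
          ultimately have zl: "\<theta>'' * (lam r / mu r * \<beta>) \<le> z r" unfolding g_def by metis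
          \<comment> \<open>Service exceeds the arrival rate by the factor
            \<open>\<theta>'' / \<theta>'\<close>, whose logarithm is \<alpha>.\<close>
          have "lam r * (\<theta>'' / \<theta>') \<le> m z r"
          proof (rule interior_service[OF zR L r rL False \<beta> _ _ _ \<theta>(1) _ \<theta>'0 zl, where \<epsilon>="\<epsilon>1 * \<nu>"])
            show "z s \<le> lam s / mu s * \<beta>" if "s \<in> R" "s \<notin> L" "s \<notin> face1 R L" for s
              using region(4)[OF z p that] by simp
            show "z s \<le> \<epsilon>1 * \<nu>" if "s \<in> face1 R L" for s
              using region(3)[OF z p _ that] that by (auto simp: face1_def)
            show "0 \<le> \<epsilon>1 * \<nu>" using \<epsilon>1(1) \<nu> by simp
            show "real (card R) * (\<epsilon>1 * \<nu>) \<le> \<beta> * (\<theta>' - \<theta>) * C i" if i: "i = fst r \<or> i = snd r" for i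
            proof -
              have "real (card R) * \<epsilon>1 * \<nu> \<le> b * (\<theta>' - \<theta>) * g0 * \<nu>"
                using \<epsilon>1(4) \<nu> by (intro mult_right_mono) auto
              also have "\<dots> = (\<beta> * (\<theta>' - \<theta>)) * g0" by (simp add: \<beta>_def)
              also have "\<dots> \<le> (\<beta> * (\<theta>' - \<theta>)) * C i"
                using i g0(2)[OF r] \<beta> \<theta>(3) by (intro mult_left_mono) auto
              finally show ?thesis by (simp add: mult.assoc)
            qed
          qed
          then show "lam r * exp \<alpha> \<le> m z r" by (simp add: \<alpha>0(2))
        next
          show "1 \<le> \<alpha> * g" using gs big(2) by linarith
          have lW: "lam r \<le> W" by (rule rate_le_W[OF zR r])
          have "lam r * (exp \<alpha> - 1) * exp (- \<alpha> * g) \<le> W * (exp \<alpha> - 1) * exp (- (\<alpha> * ((1 - \<theta>'') * (g0 * b * real n))))"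
            using gs lW W_pos \<alpha>0(1) pos by (intro mult_mono) auto
          then show "lam r * (exp \<alpha> - 1) * exp (- \<alpha> * g) \<le> e' / 2" using big(3) by linarith
        qed
        moreover have "e' * barrier \<alpha> (lam r / mu r * \<beta>) (z r) \<le> cr r * barrier \<alpha> (lam r / mu r * \<beta>) (z r)"
          using barrier_bounds(1) rL False e' by (intro mult_right_mono) (auto simp: cr_def)
        ultimately have "0 \<le> 0 + (lam r * (F r (z r + 1) t - F r (z r) t) + m z r * (F r (z r - 1) t - F r (z r) t)) + cr r * F r (z r) t"
          using rL False by (simp add: F_def)
        then show ?thesis using der by blast
      qed
    qed
  qed
  have sum_cr: "(\<Sum>r\<in>R. cr r) = face_cost L D x + 2 * real (card R) * e'"
    unfolding cr_def face_cost_split[OF x] by (simp add: sum.distrib)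
  \<comment> \<open>The starting value. The face factors determine this common bound; off the face a
    factor is 1 or at least 1/2.\<close>
  have prod_ge: "(exp (- (2 * E + 1) * \<beta>) / 2) ^ card R \<le> (\<Prod>r\<in>R. F r (y r) 0)"
  proof -
    have "(\<Prod>r\<in>R. exp (- (2 * E + 1) * \<beta>) / 2) \<le> (\<Prod>r\<in>R. F r (y r) 0)"
    proof (rule prod_mono, intro conjI)
      fix r assume r: "r \<in> R"
      have E\<beta>: "exp (- (2 * E + 1) * \<beta>) \<le> 1" using E(1) \<beta> by (simp add: mult_nonpos_nonneg)
      show "exp (- (2 * E + 1) * \<beta>) / 2 \<le> F r (y r) 0"
      proof (cases "r \<in> L")
        case True
        have "exp (- (2 * E + 1) * \<beta>) / 2 \<le> exp (- (2 * \<bar>ln (u r)\<bar> + 1) * \<beta>) / 2"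
          using u(4)[OF True] \<beta> by (simp add: mult_right_mono)
        also have "\<dots> \<le> tilted_hill (ln (u r)) \<beta> \<omega> (y r - \<nu> * x r)"
          using yx(2)[OF r] big(1) by (intro tilted_hill_core \<beta> \<omega>(1,2)) (auto simp: \<beta>_def \<nu>_def)
        finally show ?thesis using True by (simp add: F_def)
      next
        case rL: False
        show ?thesis
        proof (cases "r \<in> face1 R L")
          case True
          then have "F r (y r) 0 = 1" using rL by (simp add: F_def)
          then show ?thesis using E\<beta> by linarith
        next
          case False
          have "y r \<le> \<epsilon>1 * \<nu>" using yx(1)[OF r] out[OF rL] by (simp add: \<nu>_def)
          also have "\<dots> \<le> g0 * b / 2 * \<nu>" using \<epsilon>1(3) \<nu> by (intro mult_right_mono) auto
          finally have "y r \<le> g0 * \<beta> / 2" by (simp add: \<beta>_def)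
          moreover have "g0 * \<beta> \<le> lam r / mu r * \<beta>" using g0(2)[OF r] \<beta> by (intro mult_right_mono) auto
          ultimately have "g0 * \<beta> / 2 \<le> lam r / mu r * \<beta> - y r" by linarith
          then have "\<alpha> * (g0 * \<beta> / 2) \<le> \<alpha> * (lam r / mu r * \<beta> - y r)" using \<alpha>0(1) by (intro mult_left_mono) auto
          moreover have "g0 * \<beta> / 2 = g0 * b * real n / 2" by (simp add: \<beta>_def \<nu>_def)
          ultimately have "1 \<le> \<alpha> * (lam r / mu r * \<beta> - y r)" using big(4) by (metis order_trans)
          then have "1 / 2 \<le> barrier \<alpha> (lam r / mu r * \<beta>) (y r)" by (rule barrier_ge_half[OF \<alpha>0(1)])
          then have "1 / 2 \<le> F r (y r) 0" using rL False by (simp add: F_def)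
          then show ?thesis using E\<beta> by linarith
        qed
      qed
    qed simp
    then show ?thesis by simp
  qed
  have "exp (- (face_cost L D x + 2 * real (card R) * e') * (\<nu> * \<tau>)) * (exp (- (2 * E + 1) * \<beta>) / 2) ^ card R
      \<le> exp (- (\<Sum>r\<in>R. cr r) * (\<nu> * \<tau>)) * (\<Prod>r\<in>R. F r (y r) 0)"
    unfolding sum_cr by (rule mult_left_mono[OF prod_ge]) simp
  also note tub_ge
  finally have "exp (- (face_cost L D x + 2 * real (card R) * e') * (\<nu> * \<tau>)) * (exp (- (2 * E + 1) * \<beta>) / 2) ^ card R
      \<le> measure P (tub (deviation nrm D n x) (\<nu> * \<tau>) (\<delta> * \<nu>) y 0)" .
  then show ?thesis by (simp add: tube_prob_eq \<beta>_def \<nu>_def)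
qed

text \<open>The quantifiers mirror the iterated limit: \<tau>0 serves all points of the box and all
  \<delta>, \<epsilon> may depend on \<tau>, \<open>x\<close> and \<delta>, and \<open>n\<close> is
  large depending on all of these.\<close>

theorem tube_lower:
  assumes erg: "ergodic N C lam mu" and e: "0 < e"
  obtains \<tau>0 where "0 < \<tau>0"
    "\<And>\<tau> x \<delta>. 0 < \<tau> \<Longrightarrow> \<tau> < \<tau>0 \<Longrightarrow> x \<in> base_pts L mn mx \<Longrightarrow> 0 < \<delta> \<Longrightarrow>
      \<exists>\<epsilon>>0. eventually (\<lambda>n. \<forall>y\<in>Zplus R. nrm (\<lambda>r. y r - real n * x r) < \<epsilon> * real n \<longrightarrow>
        exp (- (face_cost L D x + e) * (real n * \<tau>)) \<le> tprob nrm y n x D \<tau> \<delta>) sequentially"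
proof -
  obtain \<theta> where \<theta>: "0 < \<theta>" "\<theta> < 1"
    "\<And>i. i \<in> {1..N} \<Longrightarrow> (\<Sum>r\<in>{r \<in> R. on_ch i r}. lam r / mu r) \<le> \<theta> * C i"
    using ergodic_margin[OF erg] by blast
  \<comment> \<open>The room between \<theta> and 1 is used twice: \<theta>' absorbs the first-order
    load, \<theta>'' marks the layer under the barrier, and their ratio above 1 is the surplus of
    service.\<close>
  define \<theta>' where "\<theta>' = (1 + \<theta>) / 2"
  define \<theta>'' where "\<theta>'' = (1 + \<theta>') / 2"
  have th: "\<theta> < \<theta>'" "\<theta>' < \<theta>''" "\<theta>'' < 1" using \<theta> by (auto simp: \<theta>'_def \<theta>''_def)
  define \<alpha> where "\<alpha> = ln (\<theta>'' / \<theta>')"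
  have \<alpha>: "0 < \<alpha>" using th \<theta>(1) by (simp add: \<alpha>_def)
  obtain E where E: "1 \<le> E" "\<And>x r. x \<in> base_pts L mn mx \<Longrightarrow> r \<in> L \<Longrightarrow> 0 < m x r \<and> tilt (D r) (lam r) (m x r) \<le> E \<and>
       1 / tilt (D r) (lam r) (m x r) \<le> E \<and> \<bar>ln (tilt (D r) (lam r) (m x r))\<bar> \<le> E"
    using tilt_uniform by blast
  obtain g0 where g0: "0 < g0" "\<And>r. r \<in> R \<Longrightarrow> g0 \<le> min (min (lam r) (lam r / mu r)) (min (C (fst r)) (C (snd r)))"
    by (rule uniform_positive[OF finite_R, of "\<lambda>r. min (min (lam r) (lam r / mu r)) (min (C (fst r)) (C (snd r)))"])
      (use R_D in auto)
  define \<rho>m where "\<rho>m = 1 + (\<Sum>r\<in>R. lam r / mu r)"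
  have \<rho>m: "1 \<le> \<rho>m" "\<And>r. r \<in> R \<Longrightarrow> lam r / mu r \<le> \<rho>m"
  proof -
    have nn: "\<And>r. r \<in> R \<Longrightarrow> 0 \<le> lam r / mu r" using R_D by (simp add: less_imp_le)
    then show "1 \<le> \<rho>m" unfolding \<rho>m_def by (simp add: sum_nonneg)
    fix r assume "r \<in> R"
    then have "lam r / mu r \<le> (\<Sum>r\<in>R. lam r / mu r)" using nn by (intro member_le_sum) auto
    then show "lam r / mu r \<le> \<rho>m" by (simp add: \<rho>m_def)
  qed
  \<comment> \<open>Adding 1 avoids a division by 0 when there are no active routes.\<close>
  define d where "d = real (card R) + 1"
  have d: "1 \<le> d" "real (card R) \<le> d" by (auto simp: d_def)
  define e' where "e' = e / (4 * d)"
  have e': "0 < e'" "2 * real (card R) * e' \<le> e / 2"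
    using e d by (auto simp: e'_def field_simps)
  define \<omega> where "\<omega> = min 1 (e' / (W * E))"
  have WE: "0 < W * E" using W_pos E(1) by simp
  have \<omega>: "0 < \<omega>" "\<omega> \<le> 1" "W * E * \<omega> \<le> e'"
  proof -
    show "0 < \<omega>" "\<omega> \<le> 1" using e' WE by (auto simp: \<omega>_def)
    have "W * E * \<omega> \<le> W * E * (e' / (W * E))" using WE by (intro mult_left_mono) (auto simp: \<omega>_def)
    moreover have "w * (e' / w) = e'" if "0 < w" for w :: real using that by simp
    ultimately show "W * E * \<omega> \<le> e'" using WE by metis
  qed
  \<comment> \<open>The drift error must be dominated by the restoring force, which is proportional
    to \<omega>; so \<omega> is fixed before the neighbourhood \<eta> and the time \<tau>0.\<close>
  define \<kappa>0 where "\<kappa>0 = min (g0 / E * \<omega> / 16 / E) (e' / (E + 1))"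
  have \<kappa>0: "0 < \<kappa>0" "\<kappa>0 * E \<le> g0 / E * \<omega> / 16" "\<kappa>0 * (E + 1) \<le> e'"
  proof -
    show "0 < \<kappa>0" using g0 E \<omega> e' by (auto simp: \<kappa>0_def)
    have "\<kappa>0 * E \<le> (g0 / E * \<omega> / 16 / E) * E" using E by (intro mult_right_mono) (auto simp: \<kappa>0_def)
    then show "\<kappa>0 * E \<le> g0 / E * \<omega> / 16" using E by simp
    have "\<kappa>0 * (E + 1) \<le> (e' / (E + 1)) * (E + 1)" using E by (intro mult_right_mono) (auto simp: \<kappa>0_def)
    then show "\<kappa>0 * (E + 1) \<le> e'" using E by simp
  qed
  obtain \<eta> where \<eta>: "0 < \<eta>"
    "\<And>x z r. x \<in> Rplus R \<Longrightarrow> z \<in> Rplus R \<Longrightarrow> (\<And>s. s \<notin> L \<Longrightarrow> x s = 0) \<Longrightarrow> (\<And>s. s \<in> L \<Longrightarrow> mn \<le> x s) \<Longrightarrow>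
      (\<And>s. s \<in> R \<Longrightarrow> \<bar>z s - x s\<bar> \<le> \<eta>) \<Longrightarrow> r \<in> L \<union> face1 R L \<Longrightarrow> \<bar>m z r - m x r\<bar> \<le> \<kappa>0"
    using m_near[OF L mn \<kappa>0(1)] by blast
  obtain \<tau>0 where \<tau>0: "0 < \<tau>0" "\<And>\<tau> r. 0 < \<tau> \<Longrightarrow> \<tau> < \<tau>0 \<Longrightarrow> r \<in> R \<Longrightarrow> \<bar>D r\<bar> * \<tau> \<le> \<eta> / 2"
    using short_time[OF \<eta>(1)] by blast
  obtain a1 where a1: "0 < a1" "\<And>v r. v \<in> Rsub R \<Longrightarrow> r \<in> R \<Longrightarrow> \<bar>v r\<bar> \<le> a1 * nrm v"
    using norm_lower[OF nrm finite_R] by blast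
  obtain a2 where a2: "0 < a2" "\<And>v b. v \<in> Rsub R \<Longrightarrow> 0 \<le> b \<Longrightarrow> (\<And>r. r \<in> R \<Longrightarrow> \<bar>v r\<bar> \<le> b) \<Longrightarrow> nrm v \<le> a2 * b"
    using norm_upper[OF nrm finite_R] by blast
  show ?thesis
  proof (rule that[OF \<tau>0(1)])
    fix \<tau> x \<delta> assume \<tau>: "0 < \<tau>" "\<tau> < \<tau>0" and x: "x \<in> base_pts L mn mx" and \<delta>: "0 < (\<delta>::real)"
    note D\<tau> = \<tau>0(2)[OF \<tau>]
    \<comment> \<open>Three demands: the rates stay close to those at \<open>x\<close>, the whole
      support lies in the tube of width \<delta>, and the starting value costs at most a quarter of
      the budget \<open>\<tau> * e\<close> per unit of \<open>n\<close>.\<close>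
    define b where "b = min (min (\<eta> / (2 * \<rho>m)) (\<delta> / (2 * a2 * \<rho>m))) (\<tau> * e / (4 * d * (2 * E + 1)))"
    have b: "0 < b" "\<rho>m * b \<le> \<eta> / 2" "a2 * (\<rho>m * b) < \<delta>" "d * ((2 * E + 1) * b) \<le> \<tau> * e / 4"
    proof -
      show "0 < b" using \<eta>(1) \<rho>m(1) \<delta> a2(1) \<tau> e d E(1) by (auto simp: b_def)
      have "\<rho>m * b \<le> \<rho>m * (\<eta> / (2 * \<rho>m))" using \<rho>m(1) by (intro mult_left_mono) (auto simp: b_def)
      then show "\<rho>m * b \<le> \<eta> / 2" using \<rho>m(1) by simp
      have "a2 * \<rho>m * b \<le> a2 * \<rho>m * (\<delta> / (2 * a2 * \<rho>m))" using \<rho>m(1) a2(1) by (intro mult_left_mono) (auto simp: b_def)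
      also have "\<dots> < \<delta>" using \<rho>m(1) a2(1) \<delta> by simp
      finally show "a2 * (\<rho>m * b) < \<delta>" by (simp add: mult.assoc)
      have "d * (2 * E + 1) * b \<le> d * (2 * E + 1) * (\<tau> * e / (4 * d * (2 * E + 1)))"
        using d E(1) by (intro mult_left_mono) (auto simp: b_def)
      also have "\<dots> = \<tau> * e / 4"
      proof -
        have "p * (X / (4 * p)) = X / 4" if "0 < p" for p X :: real using that by simp
        from this[of "d * (2 * E + 1)" "\<tau> * e"] show ?thesis using d E(1) by (simp add: mult.assoc)
      qed
      finally show "d * ((2 * E + 1) * b) \<le> \<tau> * e / 4" by (simp add: mult.assoc)
    qed
    \<comment> \<open>Bounds the starting values off the face: at most the width \<open>b\<close>,
      at most half of every barrier height, and a first-order load that fits between \<theta> and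
      \<theta>'.\<close>
    define \<epsilon>1 where "\<epsilon>1 = b * min (min 1 (g0 / 2)) (g0 * (\<theta>' - \<theta>) / d)"
    have \<epsilon>1: "0 < \<epsilon>1" "\<epsilon>1 \<le> b" "\<epsilon>1 \<le> g0 * b / 2" "real (card R) * \<epsilon>1 \<le> b * (\<theta>' - \<theta>) * g0"
    proof -
      show "0 < \<epsilon>1" using b(1) g0(1) th d by (auto simp: \<epsilon>1_def)
      have "\<epsilon>1 \<le> b * 1" "\<epsilon>1 \<le> b * (g0 / 2)" "\<epsilon>1 \<le> b * (g0 * (\<theta>' - \<theta>) / d)"
        unfolding \<epsilon>1_def
        by (rule mult_left_mono[OF min.coboundedI1[OF min.cobounded1] less_imp_le[OF b(1)]],
            rule mult_left_mono[OF min.coboundedI1[OF min.cobounded2] less_imp_le[OF b(1)]],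
            rule mult_left_mono[OF min.cobounded2 less_imp_le[OF b(1)]])
      then show "\<epsilon>1 \<le> b" "\<epsilon>1 \<le> g0 * b / 2" by (auto simp: mult.commute)
      have "real (card R) * \<epsilon>1 \<le> d * (b * (g0 * (\<theta>' - \<theta>) / d))"
        using d \<open>0 < \<epsilon>1\<close> \<open>\<epsilon>1 \<le> b * (g0 * (\<theta>' - \<theta>) / d)\<close> by (intro mult_mono) auto
      then show "real (card R) * \<epsilon>1 \<le> b * (\<theta>' - \<theta>) * g0" using d by (simp add: mult_ac)
    qed
    define \<epsilon> where "\<epsilon> = min (\<epsilon>1 / a1) (b / 2 / a1)"
    have \<epsilon>: "0 < \<epsilon>" "a1 * \<epsilon> \<le> \<epsilon>1" "a1 * \<epsilon> \<le> b / 2"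
    proof -
      show "0 < \<epsilon>" using \<epsilon>1(1) a1(1) b(1) by (simp add: \<epsilon>_def)
      have "a1 * \<epsilon> \<le> a1 * (\<epsilon>1 / a1)" "a1 * \<epsilon> \<le> a1 * (b / 2 / a1)"
        using a1(1) by (intro mult_left_mono; auto simp: \<epsilon>_def)+
      then show "a1 * \<epsilon> \<le> \<epsilon>1" "a1 * \<epsilon> \<le> b / 2" using a1(1) by auto
    qed
    define s where "s = \<alpha> * ((1 - \<theta>'') * (g0 * b))"
    have s: "0 < s" using \<alpha> th g0(1) b(1) by (simp add: s_def)
    \<comment> \<open>By \<open>t \<le> exp t\<close>, the condition \<open>K \<le> s * n\<close>
      makes the exponentially small barrier loss at most \<open>e' / 2\<close>.\<close>
    define K where "K = 2 * (W * (exp \<alpha> - 1)) / e'"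
    have ev1: "eventually (\<lambda>n. 48 \<le> (\<omega> * b) * real n) sequentially"
      by (rule eventually_real_ge) (use \<omega> b in simp)
    have ev2: "eventually (\<lambda>n. 1 \<le> s * real n) sequentially" by (rule eventually_real_ge[OF s])
    have ev3: "eventually (\<lambda>n. K \<le> s * real n) sequentially" by (rule eventually_real_ge[OF s])
    have ev4: "eventually (\<lambda>n. 1 \<le> (\<alpha> * (g0 * b / 2)) * real n) sequentially"
      by (rule eventually_real_ge) (use \<alpha> g0 b in simp)
    have ev5: "eventually (\<lambda>n. real (card R) * ln 2 \<le> (\<tau> * e / 4) * real n) sequentially"
      by (rule eventually_real_ge) (use \<tau> e in simp)
    have "eventually (\<lambda>n. \<forall>y\<in>Zplus R. nrm (\<lambda>r. y r - real n * x r) < \<epsilon> * real n \<longrightarrow>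
        exp (- (face_cost L D x + e) * (real n * \<tau>)) \<le> tprob nrm y n x D \<tau> \<delta>) sequentially"
      using ev1 ev2 ev3 ev4 ev5 eventually_gt_at_top[of 0]
    proof eventually_elim
      case (elim n)
      have n: "0 < real n" using elim(6) by simp
      show ?case
      proof (intro ballI impI)
        fix y assume y: "y \<in> Zplus R" and close: "nrm (\<lambda>r. y r - real n * x r) < \<epsilon> * real n"
        have vR: "(\<lambda>r. y r - real n * x r) \<in> Rsub R"
          using deviation_Rsub[OF Zplus_Zgrid[OF y] x, of n 0] by simp
        have yx: "\<bar>y r - real n * x r\<bar> \<le> a1 * \<epsilon> * real n" if "r \<in> R" for r
        proof -
          have "\<bar>y r - real n * x r\<bar> \<le> a1 * nrm (\<lambda>r. y r - real n * x r)" by (rule a1(2)[OF vR that])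
          also have "\<dots> \<le> a1 * (\<epsilon> * real n)" using close a1(1) by (intro mult_left_mono) auto
          finally show ?thesis by (simp add: mult.assoc)
        qed
        have "exp (- (face_cost L D x + 2 * real (card R) * e') * (real n * \<tau>)) * (exp (- (2 * E + 1) * (b * real n)) / 2) ^ card R
            \<le> tprob nrm y n x D \<tau> \<delta>"
        proof (rule tube_lower_core[OF x y n \<tau>(1) E(1) E(2)[OF x] \<theta>(3,1) th g0(1) _ \<rho>m e'(1) \<omega> _ \<kappa>0(2,3) _ b(1-3) D\<tau> a2(2)
              _ \<epsilon>1(2-4) _ _ \<alpha>_def])
          show "g0 \<le> lam r \<and> g0 \<le> lam r / mu r \<and> g0 \<le> C (fst r) \<and> g0 \<le> C (snd r)" if "r \<in> R" for r
            using g0(2)[OF that] by simp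
          show "\<bar>m z r - m x r\<bar> \<le> \<kappa>0" if "z \<in> Rplus R" "\<And>s. s \<in> R \<Longrightarrow> \<bar>z s - x s\<bar> \<le> \<eta>" "r \<in> L" for z r
            by (rule \<eta>(2)[OF base_pts_D(1)[OF x L] that(1) base_pts_D(2,3)[OF x L] that(2)]) (use that(3) in auto)
          show "\<bar>y r - real n * x r\<bar> \<le> \<epsilon>1 * real n" if "r \<in> R" for r
            using yx[OF that] mult_right_mono[OF \<epsilon>(2), of "real n"] by simp
          show "\<bar>y r - real n * x r\<bar> \<le> b * real n / 2" if "r \<in> R" for r
            using yx[OF that] mult_right_mono[OF \<epsilon>(3), of "real n"] by simp
          show "48 \<le> \<omega> * (b * real n)" using elim(1) by (simp add: mult.assoc)
          have s_eq: "\<alpha> * ((1 - \<theta>'') * (g0 * b * real n)) = s * real n" by (simp add: s_def mult.assoc)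
          show "1 \<le> \<alpha> * ((1 - \<theta>'') * (g0 * b * real n))" unfolding s_eq by (rule elim(2))
          show "W * (exp \<alpha> - 1) * exp (- (\<alpha> * ((1 - \<theta>'') * (g0 * b * real n)))) \<le> e' / 2"
          proof -
            define X where "X = W * (exp \<alpha> - 1)"
            have X: "0 \<le> X" using W_pos \<alpha> by (simp add: X_def)
            have "s * real n \<le> exp (s * real n)" using exp_ge_add_one_self[of "s * real n"] by linarith
            then have "K \<le> exp (s * real n)" using elim(3) by linarith
            then have "2 * X \<le> e' * exp (s * real n)" using e'(1) by (simp add: K_def X_def divide_le_eq mult.commute)
            then have "X * exp (- (s * real n)) \<le> e' / 2" by (simp add: exp_minus field_simps)
            then show ?thesis by (simp add: s_eq X_def)
          qed
          show "1 \<le> \<alpha> * (g0 * b * real n / 2)" using elim(4) by (simp add: mult.assoc)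
        qed (use \<kappa>0(1) \<epsilon>1(1) in auto)
        \<comment> \<open>The budget \<open>e\<close> is spent as follows: one half on the excess
          \<open>2 * card R * e'\<close>, one quarter on the width of the hump, one quarter on the
          factors 1/2.\<close>
        moreover have "exp (- (face_cost L D x + e) * (real n * \<tau>)) \<le>
            exp (- (face_cost L D x + 2 * real (card R) * e') * (real n * \<tau>)) * (exp (- (2 * E + 1) * (b * real n)) / 2) ^ card R"
        proof -
          have "(exp (- (2 * E + 1) * (b * real n)) / 2) ^ card R = exp (- (2 * E + 1) * (b * real n) - ln 2) ^ card R"
            by (simp add: exp_diff)
          also have "\<dots> = exp (real (card R) * (- (2 * E + 1) * (b * real n) - ln 2))"
            by (simp add: exp_of_nat_mult)
          finally have pw: "(exp (- (2 * E + 1) * (b * real n)) / 2) ^ card R = exp (real (card R) * (- (2 * E + 1) * (b * real n) - ln 2))" .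
          have "2 * real (card R) * e' * (real n * \<tau>) \<le> e / 2 * (real n * \<tau>)"
            using e'(2) n \<tau>(1) by (intro mult_right_mono) auto
          moreover have "real (card R) * ((2 * E + 1) * (b * real n)) \<le> \<tau> * e / 4 * real n"
          proof -
            have "real (card R) * ((2 * E + 1) * b) \<le> d * ((2 * E + 1) * b)"
              using d(2) E(1) b(1) by (intro mult_right_mono) auto
            then have "real (card R) * ((2 * E + 1) * b) * real n \<le> \<tau> * e / 4 * real n"
              using b(4) n by (intro mult_right_mono) auto
            then show ?thesis by (simp add: mult.assoc)
          qed
          ultimately have "- (face_cost L D x + e) * (real n * \<tau>) \<le>
            - (face_cost L D x + 2 * real (card R) * e') * (real n * \<tau>) + real (card R) * (- (2 * E + 1) * (b * real n) - ln 2)"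
            using elim(5) by (simp add: algebra_simps)
          then show ?thesis unfolding pw exp_add[symmetric] by simp
        qed
        ultimately show "exp (- (face_cost L D x + e) * (real n * \<tau>)) \<le> tprob nrm y n x D \<tau> \<delta>" by linarith
      qed
    qed
    then show "\<exists>\<epsilon>>0. eventually (\<lambda>n. \<forall>y\<in>Zplus R. nrm (\<lambda>r. y r - real n * x r) < \<epsilon> * real n \<longrightarrow>
        exp (- (face_cost L D x + e) * (real n * \<tau>)) \<le> tprob nrm y n x D \<tau> \<delta>) sequentially"
      using \<epsilon>(1) by blast
  qed
qed

section \<open>The upper bound\<close>

text \<open>The test functions are pure exponentials on the face and on the first-order routes, and
  constant on the others, where the cost is 0. In the tube each factor lies between
  \<open>exp (- H * q)\<close> and \<open>exp (H * q)\<close>, so terminal and initial values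
  together cost \<open>2 * card R * H * q\<close> with \<open>q\<close> proportional to
  \<open>\<delta> * n\<close>. Hence the bound holds for every positive \<open>n\<close>.\<close>

theorem tube_upper:
  assumes e: "0 < e"
  obtains \<tau>0 where "0 < \<tau>0"
    "\<And>\<tau> x. 0 < \<tau> \<Longrightarrow> \<tau> < \<tau>0 \<Longrightarrow> x \<in> base_pts L mn mx \<Longrightarrow>
      \<exists>\<delta>0>0. \<forall>\<delta> n y. 0 < \<delta> \<longrightarrow> \<delta> < \<delta>0 \<longrightarrow> 0 < n \<longrightarrow> y \<in> Zplus R \<longrightarrow> nrm (\<lambda>r. y r - real n * x r) < \<delta> * real n \<longrightarrow>
        tprob nrm y n x D \<tau> \<delta> \<le> exp (- (face_cost L D x - e) * (real n * \<tau>))"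
proof -
  obtain E where E: "1 \<le> E" "\<And>x r. x \<in> base_pts L mn mx \<Longrightarrow> r \<in> L \<Longrightarrow> 0 < m x r \<and> tilt (D r) (lam r) (m x r) \<le> E \<and>
       1 / tilt (D r) (lam r) (m x r) \<le> E \<and> \<bar>ln (tilt (D r) (lam r) (m x r))\<bar> \<le> E"
    using tilt_uniform by blast
  define d where "d = real (card R) + 1"
  have d: "1 \<le> d" "real (card R) \<le> d" by (auto simp: d_def)
  define e' where "e' = e / (2 * d)"
  have e': "0 < e'" "real (card R) * e' \<le> e / 2"
    using e d by (auto simp: e'_def field_simps)
  \<comment> \<open>On a first-order route the weight \<open>exp (- \<beta> * v)\<close> suppresses
    arrivals: as \<open>exp \<beta>\<close> exceeds \<open>2 * W / e'\<close>, the term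
    \<open>lam r * exp (- \<beta>)\<close> is at most \<open>e' / 2\<close>. The added 1 makes
    \<beta> positive.\<close>
  define \<beta> where "\<beta> = ln (1 + 2 * W / e')"
  have big: "1 < 1 + 2 * W / e'" using W_pos e' by simp
  have \<beta>: "0 < \<beta>" "exp \<beta> = 1 + 2 * W / e'" using big by (auto simp: \<beta>_def intro: exp_ln)
  \<comment> \<open>The same weight magnifies departures by \<open>exp \<beta>\<close>, so the
    service on these routes must be small against \<open>exp (- \<beta>)\<close>.\<close>
  define \<kappa>0 where "\<kappa>0 = min (e' / 2 / exp \<beta>) (e' / (E + 1))"
  have \<kappa>0: "0 < \<kappa>0" "\<kappa>0 * exp \<beta> \<le> e' / 2" "\<kappa>0 * (E + 1) \<le> e'"
  proof -
    show "0 < \<kappa>0" using E e' by (auto simp: \<kappa>0_def)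
    have "\<kappa>0 * exp \<beta> \<le> (e' / 2 / exp \<beta>) * exp \<beta>" by (intro mult_right_mono) (auto simp: \<kappa>0_def)
    then show "\<kappa>0 * exp \<beta> \<le> e' / 2" by simp
    have "\<kappa>0 * (E + 1) \<le> (e' / (E + 1)) * (E + 1)" using E by (intro mult_right_mono) (auto simp: \<kappa>0_def)
    then show "\<kappa>0 * (E + 1) \<le> e'" using E by simp
  qed
  obtain \<eta> where \<eta>: "0 < \<eta>"
    "\<And>x z r. x \<in> Rplus R \<Longrightarrow> z \<in> Rplus R \<Longrightarrow> (\<And>s. s \<notin> L \<Longrightarrow> x s = 0) \<Longrightarrow> (\<And>s. s \<in> L \<Longrightarrow> mn \<le> x s) \<Longrightarrow>
      (\<And>s. s \<in> R \<Longrightarrow> \<bar>z s - x s\<bar> \<le> \<eta>) \<Longrightarrow> r \<in> L \<union> face1 R L \<Longrightarrow> \<bar>m z r - m x r\<bar> \<le> \<kappa>0"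
    using m_near[OF L mn \<kappa>0(1)] by blast
  obtain \<tau>0 where \<tau>0: "0 < \<tau>0" "\<And>\<tau> r. 0 < \<tau> \<Longrightarrow> \<tau> < \<tau>0 \<Longrightarrow> r \<in> R \<Longrightarrow> \<bar>D r\<bar> * \<tau> \<le> \<eta> / 2"
    using short_time[OF \<eta>(1)] by blast
  obtain a1 where a1: "0 < a1" "\<And>v r. v \<in> Rsub R \<Longrightarrow> r \<in> R \<Longrightarrow> \<bar>v r\<bar> \<le> a1 * nrm v"
    using norm_lower[OF nrm finite_R] by blast
  show ?thesis
  proof (rule that[OF \<tau>0(1)])
    fix \<tau> x assume \<tau>: "0 < \<tau>" "\<tau> < \<tau>0" and x: "x \<in> base_pts L mn mx"
    note D\<tau> = \<tau>0(2)[OF \<tau>]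
    note xD = base_pts_D[OF x L]
    define H where "H = E + \<beta>"
    have H: "0 < H" using E \<beta> by (simp add: H_def)
    \<comment> \<open>The first bound keeps the rates close to those at \<open>x\<close>, the second
      keeps the boundary factors below \<open>exp (\<tau> * e / 2 * n)\<close>. \<open>H\<close>
      bounds the slopes of all exponents.\<close>
    define \<delta>0 where "\<delta>0 = min (\<eta> / (2 * a1)) (\<tau> * e / (4 * d * H * a1))"
    have \<delta>0: "0 < \<delta>0" using \<eta>(1) a1(1) \<tau>(1) e d H by (simp add: \<delta>0_def)
    have main: "tprob nrm y n x D \<tau> \<delta> \<le> exp (- (face_cost L D x - e) * (real n * \<tau>))"
      if \<delta>: "0 < \<delta>" "\<delta> < \<delta>0" and n0: "0 < n" and y: "y \<in> Zplus R"
        and close: "nrm (\<lambda>r. y r - real n * x r) < \<delta> * real n" for \<delta> n y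
    proof -
      define \<nu> where "\<nu> = real n"
      have \<nu>: "0 < \<nu>" using n0 by (simp add: \<nu>_def)
      define q where "q = a1 * (\<delta> * \<nu>)"
      have q0: "0 \<le> q" using a1(1) \<delta> \<nu> by (simp add: q_def)
      have \<delta>1: "a1 * \<delta> \<le> \<eta> / 2" "2 * d * (H * (a1 * \<delta>)) \<le> \<tau> * e / 2"
      proof -
        have "a1 * \<delta> \<le> a1 * (\<eta> / (2 * a1))" using \<delta> a1(1) by (intro mult_left_mono) (auto simp: \<delta>0_def)
        then show "a1 * \<delta> \<le> \<eta> / 2" using a1(1) by simp
        have "(2 * d * H * a1) * \<delta> \<le> (2 * d * H * a1) * (\<tau> * e / (4 * d * H * a1))"
          using \<delta> a1(1) d H by (intro mult_left_mono) (auto simp: \<delta>0_def)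
        also have "\<dots> = \<tau> * e / 2" using a1(1) d H by (simp add: field_simps)
        finally show "2 * d * (H * (a1 * \<delta>)) \<le> \<tau> * e / 2" by (simp add: mult.assoc)
      qed
      define u where "u r = tilt (D r) (lam r) (m x r)" for r
      have u: "0 < u r" "u r \<le> E" "1 / u r \<le> E" "\<bar>ln (u r)\<bar> \<le> E" "0 < m x r" "0 < lam r" if "r \<in> L" for r
        using E(2)[OF x that] tilt_props(1)[of "lam r" "m x r" "D r"] that L R_D(1)[of r] by (auto simp: u_def)
      define F where "F r v t = (if r \<in> L then exp (ln (u r) * (v - \<nu> * x r - D r * t))
        else if r \<in> face1 R L then exp (- \<beta> * v) else 1)" for r v t
      define cr where "cr r = (if r \<in> L \<union> face1 R L then lfun (D r) (lam r) (m x r) else 0) - e'" for r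
      have out: "x r = 0" "D r = 0" if "r \<notin> L" for r using that xD(2) drift_zero by auto
      have q_bound: "\<bar>z r - \<nu> * x r - D r * t\<bar> \<le> q"
        if z: "z \<in> Zplus R" and c: "deviation nrm D n x z t < \<delta> * \<nu>" and r: "r \<in> R" for z t r
      proof -
        have "\<bar>z r - \<nu> * x r - D r * t\<bar> \<le> a1 * deviation nrm D n x z t"
          using a1(2)[OF deviation_Rsub[OF Zplus_Zgrid[OF z] x] r] by (simp add: \<nu>_def)
        also have "\<dots> \<le> q" unfolding q_def using c a1(1) by (intro mult_left_mono) auto
        finally show ?thesis .
      qed
      have F_two_sided: "exp (- H * q) \<le> F r (z r) t" "F r (z r) t \<le> exp (H * q)"
        if z: "z \<in> Zplus R" and c: "deviation nrm D n x z t < \<delta> * \<nu>" and r: "r \<in> R" for z t r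
      proof -
        have zr: "0 \<le> z r" using Zplus_Rplus[OF z] r by (simp add: Rplus_def)
        have Hq: "0 \<le> H * q" using H q0 by simp
        have bnd: "\<bar>k * v\<bar> \<le> H * q" if "\<bar>k\<bar> \<le> H" "\<bar>v\<bar> \<le> q" for k v :: real
          unfolding abs_mult using that H by (intro mult_mono) auto
        have "exp (- H * q) \<le> F r (z r) t \<and> F r (z r) t \<le> exp (H * q)"
        proof (cases "r \<in> L")
          case True
          have "\<bar>ln (u r) * (z r - \<nu> * x r - D r * t)\<bar> \<le> H * q"
            by (rule bnd[OF _ q_bound[OF z c r]]) (use u(4)[OF True] \<beta> in \<open>simp add: H_def\<close>)
          then show ?thesis using True by (simp add: F_def abs_le_iff)
        next
          case False
          have "\<bar>- \<beta> * z r\<bar> \<le> H * q"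
            by (rule bnd) (use q_bound[OF z c r] out[OF False] E \<beta> in \<open>auto simp: H_def\<close>)
          then show ?thesis using False Hq by (auto simp: F_def abs_le_iff)
        qed
        then show "exp (- H * q) \<le> F r (z r) t" "F r (z r) t \<le> exp (H * q)" by auto
      qed
      have m_close: "\<bar>m z r - m x r\<bar> \<le> \<kappa>0"
        if z: "z \<in> Zplus R" and t: "0 \<le> t" "t \<le> \<nu> * \<tau>" and c: "deviation nrm D n x z t < \<delta> * \<nu>" and r: "r \<in> L \<union> face1 R L" for z t r
      proof -
        have "\<bar>m (\<lambda>r. z r / \<nu>) r - m x r\<bar> \<le> \<kappa>0"
        proof (rule \<eta>(2)[OF xD(1) _ xD(2,3) _ r])
          show "(\<lambda>r. z r / \<nu>) \<in> Rplus R" using Zplus_Rplus[OF z] \<nu> by (simp add: Rplus_def)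
          fix s assume s: "s \<in> R"
          show "\<bar>z s / \<nu> - x s\<bar> \<le> \<eta>"
            by (rule rescaled_near[where p="a1 * \<delta>", OF \<nu> _ t]) (use q_bound[OF z c s] \<delta>1(1) D\<tau>[OF s] in \<open>auto simp: q_def mult_ac\<close>)
        qed
        then show ?thesis by (simp add: m_scale[OF \<nu>])
      qed
      have "measure P (tub (deviation nrm D n x) (\<nu> * \<tau>) (\<delta> * \<nu>) y 0)
          \<le> exp (H * q) ^ card R * exp (- (\<Sum>r\<in>R. cr r) * (\<nu> * \<tau>)) * (\<Prod>r\<in>R. F r (y r) 0)"
      proof (rule upper_product)
        show "continuous_on {0..\<nu> * \<tau>} (deviation nrm D n x z)" if "z \<in> Zgrid" for z
          by (rule continuous_deviation[OF that x])
        show "0 \<le> \<nu> * \<tau>" using \<nu> \<tau> by simp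
        show "0 \<le> F r v t" for r v t by (simp add: F_def)
        show "0 \<le> exp (H * q) ^ card R" by simp
        show "continuous_on UNIV (F r v)" for r v
          unfolding F_def by (cases "r \<in> L") (auto intro!: continuous_intros)
        show "1 \<le> exp (H * q) ^ card R * (\<Prod>r\<in>R. F r (z r) (\<nu> * \<tau>))"
          if z: "z \<in> Zplus R" and c: "deviation nrm D n x z (\<nu> * \<tau>) < \<delta> * \<nu>" for z
        proof -
          have "(\<Prod>r\<in>R. exp (- H * q)) \<le> (\<Prod>r\<in>R. F r (z r) (\<nu> * \<tau>))"
            by (intro prod_mono) (use F_two_sided(1)[OF z c] in auto)
          then have "exp (H * q) ^ card R * exp (- H * q) ^ card R \<le> exp (H * q) ^ card R * (\<Prod>r\<in>R. F r (z r) (\<nu> * \<tau>))"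
            by (intro mult_left_mono) auto
          then show ?thesis by (simp add: power_mult_distrib[symmetric] exp_add[symmetric])
        qed
        show "y \<in> Zplus R" by (rule y)
        \<comment> \<open>Closeness of the rates comes from the time \<open>t'\<close> at which
          \<open>z\<close> is in the tube; the inequality is then verified at the unrelated time
          \<open>t\<close>.\<close>
        fix z t t' r
        assume z: "z \<in> Zplus R" and t': "0 \<le> t'" "t' \<le> \<nu> * \<tau>" and c: "deviation nrm D n x z t' < \<delta> * \<nu>" and r: "r \<in> R"
        have m0: "0 \<le> m z r" by (rule m_bounds(1)[OF Zplus_Rplus[OF z] r])
        note pos = R_D[OF r]
        show "\<exists>d. (F r (z r) has_real_derivative d) (at t) \<and>
         d + (lam r * (F r (z r + 1) t - F r (z r) t) + m z r * (F r (z r - 1) t - F r (z r) t)) + cr r * F r (z r) t \<le> 0"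
        proof (cases "r \<in> L")
          case True
          note uL = u[OF True]
          define Fz where "Fz = exp (ln (u r) * (z r - \<nu> * x r - D r * t))"
          have F_eq: "F r (z r) = (\<lambda>t. exp (ln (u r) * (z r - \<nu> * x r - D r * t)))"
            using True by (simp add: F_def fun_eq_iff)
          have "(F r (z r) has_real_derivative - (ln (u r) * D r) * Fz) (at t)"
            unfolding F_eq Fz_def by (auto intro!: derivative_eq_intros)
          moreover have "- (ln (u r) * D r) * Fz + (lam r * (F r (z r + 1) t - F r (z r) t) + m z r * (F r (z r - 1) t - F r (z r) t)) + cr r * F r (z r) t \<le> 0"
          proof -
            have F0: "F r (z r) t = Fz" using True by (simp add: F_def Fz_def)
            have "F r (z r + 1) t = exp (ln (u r) * (z r - \<nu> * x r - D r * t) + ln (u r))"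
              using True by (simp add: F_def algebra_simps)
            then have Fu: "F r (z r + 1) t = Fz * u r" using uL(1) by (simp add: Fz_def exp_add)
            have "F r (z r - 1) t = exp (ln (u r) * (z r - \<nu> * x r - D r * t) - ln (u r))"
              using True by (simp add: F_def algebra_simps)
            then have Fd: "F r (z r - 1) t = Fz * (1 / u r)" using uL(1) by (simp add: Fz_def exp_diff)
            have dm: "\<bar>m z r - m x r\<bar> \<le> \<kappa>0" by (rule m_close[OF z t' c]) (use True in auto)
            have "\<bar>1 / u r - 1\<bar> \<le> E + 1" using uL(1,3) by (auto simp: abs_le_iff) (smt (verit) divide_pos_pos)
            then have "\<bar>(m z r - m x r) * (1 / u r - 1)\<bar> \<le> \<kappa>0 * (E + 1)"
              unfolding abs_mult using dm \<kappa>0(1) by (intro mult_mono) auto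
            then have le: "(m z r - m x r) * (1 / u r - 1) \<le> e'" using \<kappa>0(3) by linarith
            have "- (ln (u r) * D r) + lam r * (u r - 1) + m z r * (1 / u r - 1) + cr r = (m z r - m x r) * (1 / u r - 1) - e'"
              using lfun_tilt[OF pos(1) uL(5), of "D r"] True by (simp add: cr_def u_def[symmetric] algebra_simps diff_divide_distrib)
            then have "- (ln (u r) * D r) + lam r * (u r - 1) + m z r * (1 / u r - 1) + cr r \<le> 0" using le by linarith
            then have "Fz * (- (ln (u r) * D r) + lam r * (u r - 1) + m z r * (1 / u r - 1) + cr r) \<le> 0"
              by (intro mult_nonneg_nonpos) (auto simp: Fz_def)
            then show ?thesis unfolding F0 Fu Fd by (simp add: algebra_simps)
          qed
          ultimately show ?thesis by blast
        next
          case rL: False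
          then have der: "(F r (z r) has_real_derivative 0) (at t)"
            by (cases "r \<in> face1 R L") (simp_all add: F_def[abs_def])
          have "0 + (lam r * (F r (z r + 1) t - F r (z r) t) + m z r * (F r (z r - 1) t - F r (z r) t)) + cr r * F r (z r) t \<le> 0"
          proof (cases "r \<in> face1 R L")
            case True
            define Fz where "Fz = exp (- \<beta> * z r)"
            have F0: "F r (z r) t = Fz" "F r (z r + 1) t = Fz * exp (- \<beta>)" "F r (z r - 1) t = Fz * exp \<beta>"
              using rL True by (auto simp: F_def Fz_def exp_add[symmetric] algebra_simps)
            have "m x r = 0" using out[OF rL] by (simp add: murate_def nu_def)
            then have "m z r \<le> \<kappa>0" using m_close[OF z t' c, of r] True by auto
            then have "m z r * (exp \<beta> - 1) \<le> \<kappa>0 * exp \<beta>" using m0 \<beta> \<kappa>0(1) big by (intro mult_mono) auto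
            then have 1: "m z r * (exp \<beta> - 1) \<le> e' / 2" using \<kappa>0(2) by linarith
            have lW: "lam r \<le> W" by (rule rate_le_W[OF Zplus_Rplus[OF z] r])
            have "2 * W / e' \<le> exp \<beta>" using \<beta>(2) by simp
            then have "2 * W \<le> e' * exp \<beta>" using e'(1) by (simp add: divide_le_eq mult.commute)
            then have 2: "lam r * exp (- \<beta>) \<le> e' / 2" using lW by (simp add: exp_minus field_simps)
            have "lam r * (exp (- \<beta>) - 1) + m z r * (exp \<beta> - 1) + cr r \<le> 0"
              using 1 2 True first_order_cost(3)[OF x True] by (simp add: cr_def algebra_simps)
            then have "Fz * (lam r * (exp (- \<beta>) - 1) + m z r * (exp \<beta> - 1) + cr r) \<le> 0"
              by (intro mult_nonneg_nonpos) (auto simp: Fz_def)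
            then show ?thesis unfolding F0 by (simp add: algebra_simps)
          next
            case False
            then show ?thesis using rL e' by (simp add: F_def cr_def)
          qed
          then show ?thesis using der by blast
        qed
      qed
      also have "\<dots> \<le> exp (H * q) ^ card R * exp (- (\<Sum>r\<in>R. cr r) * (\<nu> * \<tau>)) * exp (H * q) ^ card R"
      proof (intro mult_left_mono)
        have "(\<Prod>r\<in>R. F r (y r) 0) \<le> (\<Prod>r\<in>R. exp (H * q))"
          using F_two_sided(2)[OF y, of 0] close by (intro prod_mono) (auto simp: F_def \<nu>_def)
        then show "(\<Prod>r\<in>R. F r (y r) 0) \<le> exp (H * q) ^ card R" by simp
      qed auto
      also have "\<dots> = exp (2 * real (card R) * (H * q) - (\<Sum>r\<in>R. cr r) * (\<nu> * \<tau>))"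
        by (simp add: exp_of_nat_mult[symmetric] exp_add[symmetric])
      also have "\<dots> \<le> exp (- (face_cost L D x - e) * (\<nu> * \<tau>))"
      proof -
        have sum: "(\<Sum>r\<in>R. cr r) = face_cost L D x - real (card R) * e'"
          unfolding cr_def face_cost_split[OF x] by (simp add: sum_subtractf)
        have "2 * real (card R) * (H * q) \<le> 2 * d * (H * q)"
          using d H q0 by (intro mult_right_mono) auto
        also have "\<dots> = 2 * d * (H * (a1 * \<delta>)) * \<nu>" by (simp add: q_def)
        also have "\<dots> \<le> \<tau> * e / 2 * \<nu>" using \<delta>1(2) \<nu> by (intro mult_right_mono) auto
        finally have "2 * real (card R) * (H * q) \<le> \<tau> * e / 2 * \<nu>" .
        moreover have "real (card R) * e' * (\<nu> * \<tau>) \<le> e / 2 * (\<nu> * \<tau>)"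
          using e'(2) \<nu> \<tau>(1) by (intro mult_right_mono) auto
        ultimately show ?thesis unfolding sum by (simp add: algebra_simps)
      qed
      finally show ?thesis by (simp add: tube_prob_eq \<nu>_def)
    qed
    show "\<exists>\<delta>0>0. \<forall>\<delta> n y. 0 < \<delta> \<longrightarrow> \<delta> < \<delta>0 \<longrightarrow> 0 < n \<longrightarrow> y \<in> Zplus R \<longrightarrow> nrm (\<lambda>r. y r - real n * x r) < \<delta> * real n \<longrightarrow>
        tprob nrm y n x D \<tau> \<delta> \<le> exp (- (face_cost L D x - e) * (real n * \<tau>))"
      using \<delta>0 main by blast
  qed
qed

end

section \<open>The iterated limits\<close>

context
  fixes nrm :: "vec \<Rightarrow> real" and L :: "route set" and D :: vec and mn mx :: real
  assumes nrm: "is_norm_on R nrm" and L: "L \<subseteq> R" and D: "D \<in> Rsub L" and mn: "0 < mn"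
begin

abbreviation "start x n \<epsilon> \<equiv> {y \<in> Zplus R. nrm (\<lambda>r. y r - real n * x r) < \<epsilon> * real n}"
abbreviation "low \<equiv> lowF N C lam mu nrm"
abbreviation "upp \<equiv> upF N C lam mu nrm"

text \<open>Rounding \<open>n * x\<close> down gives a start. Over an empty set of starts the
  infimum is infinite and the supremum minus infinite, so bounding \<open>low\<close> from above and
  \<open>upp\<close> from below requires an actual start.\<close>

lemma start_nonempty:
  assumes x: "x \<in> base_pts L mn mx" and \<epsilon>: "0 < \<epsilon>"
  shows "eventually (\<lambda>n. start x n \<epsilon> \<noteq> {}) sequentially"
proof -
  obtain a where a: "0 < a" "\<And>v b. v \<in> Rsub R \<Longrightarrow> 0 \<le> b \<Longrightarrow> (\<And>r. r \<in> R \<Longrightarrow> \<bar>v r\<bar> \<le> b) \<Longrightarrow> nrm v \<le> a * b"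
    using norm_upper[OF nrm finite_R] by blast
  show ?thesis
    using eventually_real_ge[OF \<epsilon>, of "a + 1"]
  proof eventually_elim
    case (elim n)
    define y where "y r = (if r \<in> R then real (nat \<lfloor>real n * x r\<rfloor>) else 0)" for r
    have y: "y \<in> Zplus R" by (auto simp: y_def Zplus_def)
    have "nrm (\<lambda>r. y r - real n * x r) \<le> a * 1"
    proof (rule a(2))
      show "(\<lambda>r. y r - real n * x r) \<in> Rsub R"
        using deviation_Rsub[OF nrm L D mn Zplus_Zgrid[OF y] x, of n 0] by simp
      fix r assume r: "r \<in> R"
      have "0 \<le> real n * x r" using base_pts_D(1)[OF x L] r by (simp add: Rplus_def)
      then show "\<bar>y r - real n * x r\<bar> \<le> 1" using r by (simp add: y_def abs_le_iff) linarith
    qed simp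
    then have "y \<in> start x n \<epsilon>" using y elim by simp
    then show ?case by blast
  qed
qed

lemma tube_prob_mono:
  assumes x: "x \<in> base_pts L mn mx" and y: "y \<in> Zplus R" and "0 < \<tau>" "\<delta> \<le> \<delta>'"
  shows "tprob nrm y n x D \<tau> \<delta> \<le> tprob nrm y n x D \<tau> \<delta>'"
proof -
  interpret PP: prob_space P by (rule prob_space_P)
  have "tub (deviation nrm D n x) (real n * \<tau>) (\<delta>' * real n) y 0 \<in> sets P"
    by (rule sets_tub[OF _ continuous_deviation[OF nrm L D mn _ x] Zplus_Zgrid[OF y]]) (use assms(3) in auto)
  moreover have "tub (deviation nrm D n x) (real n * \<tau>) (\<delta> * real n) y 0
      \<subseteq> tub (deviation nrm D n x) (real n * \<tau>) (\<delta>' * real n) y 0"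
  proof -
    have "ereal (\<delta> * real n) \<le> ereal (\<delta>' * real n)" using assms(4) by (simp add: mult_right_mono)
    then show ?thesis unfolding tub_def by (intro subsetI CollectI) (auto elim: less_le_trans)
  qed
  ultimately show ?thesis unfolding tube_prob_eq by (rule PP.finite_measure_mono[rotated])
qed

lemma low_antimono:
  assumes "0 < \<tau>" "\<epsilon> \<le> \<epsilon>'"
  shows "low x D \<tau> \<delta> \<epsilon>' \<le> low x D \<tau> \<delta> \<epsilon>"
  unfolding lowF_def
proof (intro Liminf_mono always_eventually allI ereal_mult_left_mono INF_superset_mono order_refl subsetI)
  fix n y assume "y \<in> start x n \<epsilon>"
  then show "y \<in> start x n \<epsilon>'" using mult_right_mono[OF assms(2), of "real n"] by auto
qed (use assms in simp)

lemma upp_mono: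
  assumes "0 < \<tau>" "\<epsilon> \<le> \<epsilon>'"
  shows "upp x D \<tau> \<delta> \<epsilon> \<le> upp x D \<tau> \<delta> \<epsilon>'"
  unfolding upF_def
proof (intro Limsup_mono always_eventually allI ereal_mult_left_mono SUP_subset_mono order_refl subsetI)
  fix n y assume "y \<in> start x n \<epsilon>"
  then show "y \<in> start x n \<epsilon>'" using mult_right_mono[OF assms(2), of "real n"] by auto
qed (use assms in simp)

lemma low_mono_delta:
  assumes x: "x \<in> base_pts L mn mx" and \<tau>: "0 < \<tau>" and "\<delta> \<le> \<delta>'"
  shows "low x D \<tau> \<delta> \<epsilon> \<le> low x D \<tau> \<delta>' \<epsilon>"
  unfolding lowF_def
proof (intro Liminf_mono always_eventually allI ereal_mult_left_mono INF_mono)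
  fix n y assume "y \<in> start x n \<epsilon>"
  then show "\<exists>y'\<in>start x n \<epsilon>. eln (tprob nrm y' n x D \<tau> \<delta>) \<le> eln (tprob nrm y n x D \<tau> \<delta>')"
    using tube_prob_mono[OF x _ \<tau> assms(3)] by (intro bexI[of _ y] eln_mono) auto
qed (use \<tau> in simp)

lemma upp_mono_delta:
  assumes x: "x \<in> base_pts L mn mx" and \<tau>: "0 < \<tau>" and "\<delta> \<le> \<delta>'"
  shows "upp x D \<tau> \<delta> \<epsilon> \<le> upp x D \<tau> \<delta>' \<epsilon>"
  unfolding upF_def
proof (intro Limsup_mono always_eventually allI ereal_mult_left_mono SUP_mono)
  fix n y assume "y \<in> start x n \<epsilon>"
  then show "\<exists>y'\<in>start x n \<epsilon>. eln (tprob nrm y n x D \<tau> \<delta>) \<le> eln (tprob nrm y' n x D \<tau> \<delta>')"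
    using tube_prob_mono[OF x _ \<tau> assms(3)] by (intro bexI[of _ y] eln_mono) auto
qed (use \<tau> in simp)

text \<open>Shrinking \<epsilon> leaves fewer starts and raises the infimum, hence a supremum over
  \<epsilon>; shrinking \<delta> narrows the tube, hence an infimum over \<delta>.\<close>

definition low_lim :: "vec \<Rightarrow> real \<Rightarrow> ereal" where
  "low_lim x \<tau> = (INF \<delta>\<in>{0<..}. SUP \<epsilon>\<in>{0<..}. low x D \<tau> \<delta> \<epsilon>)"

definition upp_lim :: "vec \<Rightarrow> real \<Rightarrow> ereal" where
  "upp_lim x \<tau> = (INF \<delta>\<in>{0<..}. INF \<epsilon>\<in>{0<..}. upp x D \<tau> \<delta> \<epsilon>)"

lemma is_dlim_low:
  assumes x: "x \<in> base_pts L mn mx" and \<tau>: "0 < \<tau>"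
  shows "is_dlim (low x D) \<tau> (low_lim x \<tau>)"
  unfolding is_dlim_def low_lim_def
proof (intro exI[of _ "\<lambda>\<delta>. SUP \<epsilon>\<in>{0<..}. low x D \<tau> \<delta> \<epsilon>"] conjI allI impI)
  show "(low x D \<tau> \<delta> \<longlongrightarrow> (SUP \<epsilon>\<in>{0<..}. low x D \<tau> \<delta> \<epsilon>)) (at_right 0)" for \<delta>
    by (rule antimono_tendsto_SUP) (rule low_antimono[OF \<tau>])
  show "((\<lambda>\<delta>. SUP \<epsilon>\<in>{0<..}. low x D \<tau> \<delta> \<epsilon>) \<longlongrightarrow> (INF \<delta>\<in>{0<..}. SUP \<epsilon>\<in>{0<..}. low x D \<tau> \<delta> \<epsilon>)) (at_right 0)"
    by (rule mono_tendsto_INF) (intro SUP_mono' low_mono_delta x \<tau>)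
qed

lemma is_dlim_upp:
  assumes x: "x \<in> base_pts L mn mx" and \<tau>: "0 < \<tau>"
  shows "is_dlim (upp x D) \<tau> (upp_lim x \<tau>)"
  unfolding is_dlim_def upp_lim_def
proof (intro exI[of _ "\<lambda>\<delta>. INF \<epsilon>\<in>{0<..}. upp x D \<tau> \<delta> \<epsilon>"] conjI allI impI)
  show "(upp x D \<tau> \<delta> \<longlongrightarrow> (INF \<epsilon>\<in>{0<..}. upp x D \<tau> \<delta> \<epsilon>)) (at_right 0)" for \<delta>
    by (rule mono_tendsto_INF) (rule upp_mono[OF \<tau>])
  show "((\<lambda>\<delta>. INF \<epsilon>\<in>{0<..}. upp x D \<tau> \<delta> \<epsilon>) \<longlongrightarrow> (INF \<delta>\<in>{0<..}. INF \<epsilon>\<in>{0<..}. upp x D \<tau> \<delta> \<epsilon>)) (at_right 0)"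
    by (rule mono_tendsto_INF) (intro INF_mono' upp_mono_delta x \<tau>)
qed

text \<open>For \<open>low\<close> one admissible \<epsilon> suffices. For \<open>upp\<close> every
  \<epsilon> must be treated: below \<epsilon>0 the bound holds at some start, and monotonicity
  covers larger \<epsilon>.\<close>

lemma limits_ge:
  assumes \<tau>: "0 < \<tau>" and x: "x \<in> base_pts L mn mx"
    and bound: "\<And>\<delta>. 0 < \<delta> \<Longrightarrow> \<exists>\<epsilon>>0. eventually (\<lambda>n. \<forall>y\<in>Zplus R. nrm (\<lambda>r. y r - real n * x r) < \<epsilon> * real n \<longrightarrow>
        exp (a * (real n * \<tau>)) \<le> tprob nrm y n x D \<tau> \<delta>) sequentially"
  shows "ereal a \<le> low_lim x \<tau>" "ereal a \<le> upp_lim x \<tau>"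
proof -
  have *: "(\<exists>\<epsilon>>0. ereal a \<le> low x D \<tau> \<delta> \<epsilon>) \<and> (\<forall>\<epsilon>>0. ereal a \<le> upp x D \<tau> \<delta> \<epsilon>)" if \<delta>: "0 < \<delta>" for \<delta>
  proof -
    obtain \<epsilon>0 where \<epsilon>0: "0 < \<epsilon>0" and ev: "eventually (\<lambda>n. \<forall>y\<in>Zplus R. nrm (\<lambda>r. y r - real n * x r) < \<epsilon>0 * real n \<longrightarrow>
        exp (a * (real n * \<tau>)) \<le> tprob nrm y n x D \<tau> \<delta>) sequentially"
      using bound[OF \<delta>] by blast
    have ev': "eventually (\<lambda>n. \<forall>y\<in>start x n \<epsilon>0. ereal (a * (real n * \<tau>)) \<le> eln (tprob nrm y n x D \<tau> \<delta>)) sequentially"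
      using ev by eventually_elim (use eln_mono in fastforce)
    have "ereal a \<le> low x D \<tau> \<delta> \<epsilon>0"
      unfolding lowF_def
    proof (rule Liminf_bounded, use ev' eventually_gt_at_top[of 0] in eventually_elim)
      case (elim n)
      have n: "0 < real n * \<tau>" using elim(2) \<tau> by simp
      show "ereal a \<le> ereal (1 / (real n * \<tau>)) * (INF y\<in>start x n \<epsilon>0. eln (tprob nrm y n x D \<tau> \<delta>))"
        unfolding scaled_ereal[OF n, of a, symmetric] by (intro scale_mono[OF n] INF_greatest) (use elim(1) in blast)
    qed
    moreover have "ereal a \<le> upp x D \<tau> \<delta> \<epsilon>" if \<epsilon>: "0 < \<epsilon>" for \<epsilon>
    proof -
      have e: "0 < min \<epsilon> \<epsilon>0" using \<epsilon> \<epsilon>0 by simp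
      have "ereal a \<le> liminf (\<lambda>n. ereal (1 / (real n * \<tau>)) * (SUP y\<in>start x n (min \<epsilon> \<epsilon>0). eln (tprob nrm y n x D \<tau> \<delta>)))"
      proof (rule Liminf_bounded, use ev' eventually_gt_at_top[of 0] start_nonempty[OF x e] in eventually_elim)
        case (elim n)
        have n: "0 < real n * \<tau>" using elim(2) \<tau> by simp
        obtain y where y: "y \<in> start x n (min \<epsilon> \<epsilon>0)" using elim(3) by blast
        have "min \<epsilon> \<epsilon>0 * real n \<le> \<epsilon>0 * real n" by (intro mult_right_mono) auto
        then have "y \<in> start x n \<epsilon>0" using y by auto
        then have "ereal (a * (real n * \<tau>)) \<le> eln (tprob nrm y n x D \<tau> \<delta>)" using elim(1) by blast
        also have "\<dots> \<le> (SUP y\<in>start x n (min \<epsilon> \<epsilon>0). eln (tprob nrm y n x D \<tau> \<delta>))" by (rule SUP_upper[OF y])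
        finally show "ereal a \<le> ereal (1 / (real n * \<tau>)) * (SUP y\<in>start x n (min \<epsilon> \<epsilon>0). eln (tprob nrm y n x D \<tau> \<delta>))"
          unfolding scaled_ereal[OF n, of a, symmetric] by (rule scale_mono[OF n])
      qed
      also have "\<dots> \<le> upp x D \<tau> \<delta> (min \<epsilon> \<epsilon>0)" unfolding upF_def by (rule Liminf_le_Limsup) simp
      also have "\<dots> \<le> upp x D \<tau> \<delta> \<epsilon>" by (rule upp_mono[OF \<tau>]) simp
      finally show ?thesis .
    qed
    ultimately show ?thesis using \<epsilon>0 by blast
  qed
  show "ereal a \<le> low_lim x \<tau>" unfolding low_lim_def
  proof (rule INF_greatest)
    fix \<delta> :: real assume "\<delta> \<in> {0<..}"
    then obtain \<epsilon> where "0 < \<epsilon>" "ereal a \<le> low x D \<tau> \<delta> \<epsilon>" using * by auto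
    then show "ereal a \<le> (SUP \<epsilon>\<in>{0<..}. low x D \<tau> \<delta> \<epsilon>)" by (intro SUP_upper2[of \<epsilon>]) auto
  qed
  show "ereal a \<le> upp_lim x \<tau>" unfolding upp_lim_def using * by (intro INF_greatest) auto
qed

text \<open>The values at one \<delta> bound both limits. For \<open>upp\<close> take \<epsilon>
  equal to \<delta>; for \<open>low\<close> shrink \<epsilon> below \<delta> and bound the infimum
  by its value at an existing start.\<close>

lemma limits_le:
  assumes \<tau>: "0 < \<tau>" and x: "x \<in> base_pts L mn mx" and \<delta>: "0 < \<delta>"
    and bound: "\<And>n y. 0 < n \<Longrightarrow> y \<in> Zplus R \<Longrightarrow> nrm (\<lambda>r. y r - real n * x r) < \<delta> * real n \<Longrightarrow>
        tprob nrm y n x D \<tau> \<delta> \<le> exp (a * (real n * \<tau>))"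
  shows "low_lim x \<tau> \<le> ereal a" "upp_lim x \<tau> \<le> ereal a"
proof -
  have b: "eln (tprob nrm y n x D \<tau> \<delta>) \<le> ereal (a * (real n * \<tau>))" if "0 < n" "y \<in> start x n \<delta>" for n y
    using eln_mono[OF bound[of n y]] that by simp
  have "upp x D \<tau> \<delta> \<delta> \<le> ereal a"
    unfolding upF_def
  proof (rule Limsup_bounded, use eventually_gt_at_top[of 0] in eventually_elim)
    case (elim n)
    have n: "0 < real n * \<tau>" using elim \<tau> by simp
    show "ereal (1 / (real n * \<tau>)) * (SUP y\<in>start x n \<delta>. eln (tprob nrm y n x D \<tau> \<delta>)) \<le> ereal a"
      unfolding scaled_ereal[OF n, of a, symmetric] by (intro scale_mono[OF n] SUP_least b elim)
  qed
  then show "upp_lim x \<tau> \<le> ereal a" unfolding upp_lim_def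
    using \<delta> by (intro INF_lower2[of \<delta>] INF_lower2[of \<delta>]) auto
  have "low x D \<tau> \<delta> \<epsilon> \<le> ereal a" if \<epsilon>: "0 < \<epsilon>" for \<epsilon>
  proof -
    have e: "0 < min \<epsilon> \<delta>" using \<epsilon> \<delta> by simp
    have "low x D \<tau> \<delta> \<epsilon> \<le> low x D \<tau> \<delta> (min \<epsilon> \<delta>)" by (rule low_antimono[OF \<tau>]) simp
    also have "\<dots> \<le> limsup (\<lambda>n. ereal (1 / (real n * \<tau>)) * (INF y\<in>start x n (min \<epsilon> \<delta>). eln (tprob nrm y n x D \<tau> \<delta>)))"
      unfolding lowF_def by (rule Liminf_le_Limsup) simp
    also have "\<dots> \<le> ereal a"
    proof (rule Limsup_bounded, use eventually_gt_at_top[of 0] start_nonempty[OF x e] in eventually_elim)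
      case (elim n)
      have n: "0 < real n * \<tau>" using elim(1) \<tau> by simp
      obtain y where y: "y \<in> start x n (min \<epsilon> \<delta>)" using elim(2) by blast
      have "min \<epsilon> \<delta> * real n \<le> \<delta> * real n" by (intro mult_right_mono) auto
      then have "y \<in> start x n \<delta>" using y by auto
      then have "(INF y\<in>start x n (min \<epsilon> \<delta>). eln (tprob nrm y n x D \<tau> \<delta>)) \<le> ereal (a * (real n * \<tau>))"
        using b[OF elim(1)] by (intro INF_lower2[OF y]) blast
      then show "ereal (1 / (real n * \<tau>)) * (INF y\<in>start x n (min \<epsilon> \<delta>). eln (tprob nrm y n x D \<tau> \<delta>)) \<le> ereal a"
        unfolding scaled_ereal[OF n, of a, symmetric] by (rule scale_mono[OF n])
    qed
    finally show ?thesis .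
  qed
  then show "low_lim x \<tau> \<le> ereal a" unfolding low_lim_def
    using \<delta> by (intro INF_lower2[of \<delta>] SUP_least) auto
qed

text \<open>Each of the two limits is enclosed from both sides separately; applying the bounds with
  \<open>e / 2\<close> makes the inequalities strict.\<close>

theorem uniform_limits:
  assumes erg: "ergodic N C lam mu" and e: "0 < e"
  shows "\<exists>\<tau>0>0. \<forall>\<tau>. 0 < \<tau> \<and> \<tau> < \<tau>0 \<longrightarrow> (\<forall>x\<in>base_pts L mn mx.
    ereal (- face_cost L D x - e) < low_lim x \<tau> \<and> low_lim x \<tau> < ereal (- face_cost L D x + e) \<and>
    ereal (- face_cost L D x - e) < upp_lim x \<tau> \<and> upp_lim x \<tau> < ereal (- face_cost L D x + e))"
proof -
  have e2: "0 < e / 2" using e by simp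
  obtain \<tau>1 where \<tau>1: "0 < \<tau>1"
    "\<And>\<tau> x \<delta>. 0 < \<tau> \<Longrightarrow> \<tau> < \<tau>1 \<Longrightarrow> x \<in> base_pts L mn mx \<Longrightarrow> 0 < \<delta> \<Longrightarrow>
      \<exists>\<epsilon>>0. eventually (\<lambda>n. \<forall>y\<in>Zplus R. nrm (\<lambda>r. y r - real n * x r) < \<epsilon> * real n \<longrightarrow>
        exp (- (face_cost L D x + e / 2) * (real n * \<tau>)) \<le> tprob nrm y n x D \<tau> \<delta>) sequentially"
    using tube_lower[OF nrm L D mn erg e2, of mx] by blast
  obtain \<tau>2 where \<tau>2: "0 < \<tau>2"
    "\<And>\<tau> x. 0 < \<tau> \<Longrightarrow> \<tau> < \<tau>2 \<Longrightarrow> x \<in> base_pts L mn mx \<Longrightarrow>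
      \<exists>\<delta>0>0. \<forall>\<delta> n y. 0 < \<delta> \<longrightarrow> \<delta> < \<delta>0 \<longrightarrow> 0 < n \<longrightarrow> y \<in> Zplus R \<longrightarrow> nrm (\<lambda>r. y r - real n * x r) < \<delta> * real n \<longrightarrow>
        tprob nrm y n x D \<tau> \<delta> \<le> exp (- (face_cost L D x - e / 2) * (real n * \<tau>))"
    using tube_upper[OF nrm L D mn e2, of mx] by blast
  show ?thesis
  proof (intro exI[of _ "min \<tau>1 \<tau>2"] conjI allI impI ballI)
    show "0 < min \<tau>1 \<tau>2" using \<tau>1(1) \<tau>2(1) by simp
    fix \<tau> x assume "0 < \<tau> \<and> \<tau> < min \<tau>1 \<tau>2" and x: "x \<in> base_pts L mn mx"
    then have \<tau>: "0 < \<tau>" "\<tau> < \<tau>1" "\<tau> < \<tau>2" by auto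
    note ge = limits_ge[OF \<tau>(1) x \<tau>1(2)[OF \<tau>(1,2) x]]
    obtain \<delta>0 where \<delta>0: "0 < \<delta>0" "\<And>\<delta> n y. 0 < \<delta> \<Longrightarrow> \<delta> < \<delta>0 \<Longrightarrow> 0 < n \<Longrightarrow> y \<in> Zplus R \<Longrightarrow>
        nrm (\<lambda>r. y r - real n * x r) < \<delta> * real n \<Longrightarrow>
        tprob nrm y n x D \<tau> \<delta> \<le> exp (- (face_cost L D x - e / 2) * (real n * \<tau>))"
      using \<tau>2(2)[OF \<tau>(1,3) x] by blast
    have \<delta>: "0 < \<delta>0 / 2" "\<delta>0 / 2 < \<delta>0" using \<delta>0(1) by auto
    note le = limits_le[OF \<tau>(1) x \<delta>(1) \<delta>0(2)[OF \<delta>]]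
    have lt: "ereal (- face_cost L D x - e) < ereal (- (face_cost L D x + e / 2))"
      "ereal (- (face_cost L D x - e / 2)) < ereal (- face_cost L D x + e)" using e by auto
    show "ereal (- face_cost L D x - e) < low_lim x \<tau>" by (rule less_le_trans[OF lt(1) ge(1)])
    show "ereal (- face_cost L D x - e) < upp_lim x \<tau>" by (rule less_le_trans[OF lt(1) ge(2)])
    show "low_lim x \<tau> < ereal (- face_cost L D x + e)" by (rule le_less_trans[OF le(1) lt(2)])
    show "upp_lim x \<tau> < ereal (- face_cost L D x + e)" by (rule le_less_trans[OF le(2) lt(2)])
  qed
qed

lemma Lcost_eq:
  assumes x: "x \<in> base_pts L mn mx"
  shows "Lcost N C lam mu x D = face_cost L D x"
proof -
  have "lface R x = L"
    using base_pts_D[OF x L] mn L unfolding lface_def by force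
  then show ?thesis by (simp add: Lcost_def face_cost_def Let_def)
qed

end

text \<open>Each coordinate is continuous in the product topology, so on \<open>K\<close> it attains
  a minimum, positive on the face, and a maximum. The additional 1 in \<open>Min\<close> and
  \<open>Max\<close> covers an empty face.\<close>

lemma compact_face:
  assumes K: "compact K" "K \<subseteq> faceset L" and L: "L \<subseteq> R"
  obtains mn mx where "0 < mn" "K \<subseteq> base_pts L mn mx"
proof (cases "K = {}")
  case True
  then show ?thesis using that[of 1 1] by simp
next
  case False
  have fin: "finite L" using L finite_R finite_subset by blast
  have "\<exists>a b. 0 < a \<and> (\<forall>x\<in>K. a \<le> x r \<and> x r \<le> b)" if r: "r \<in> L" for r
  proof -
    have cont: "continuous_on K (\<lambda>x. x r)"
      by (rule continuous_on_subset[OF continuous_on_product_coordinates]) simp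
    obtain x1 where "x1 \<in> K" "\<And>x. x \<in> K \<Longrightarrow> x1 r \<le> x r"
      using continuous_attains_inf[OF K(1) False cont] by blast
    moreover obtain x2 where "x2 \<in> K" "\<And>x. x \<in> K \<Longrightarrow> x r \<le> x2 r"
      using continuous_attains_sup[OF K(1) False cont] by blast
    moreover have "0 < x1 r" using \<open>x1 \<in> K\<close> K(2) r by (auto simp: faceset_def)
    ultimately show ?thesis by blast
  qed
  then obtain a b where ab: "\<And>r. r \<in> L \<Longrightarrow> 0 < a r" "\<And>r x. r \<in> L \<Longrightarrow> x \<in> K \<Longrightarrow> a r \<le> x r \<and> x r \<le> b r"
    by metis
  define mn where "mn = Min (insert 1 (a ` L))"
  define mx where "mx = Max (insert 1 (b ` L))"
  have "0 < mn" unfolding mn_def using fin ab(1) by (subst Min_gr_iff) auto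
  moreover have "K \<subseteq> base_pts L mn mx"
  proof
    fix x assume x: "x \<in> K"
    have "mn \<le> x r \<and> x r \<le> mx" if r: "r \<in> L" for r
    proof -
      have "mn \<le> a r" "b r \<le> mx" unfolding mn_def mx_def using fin r by (auto intro!: Min_le Max_ge)
      then show ?thesis using ab(2)[OF r x] by linarith
    qed
    then show "x \<in> base_pts L mn mx" using x K(2) by (auto simp: base_pts_def)
  qed
  ultimately show ?thesis by (rule that)
qed

end

section \<open>Assembly of the pointwise and the uniform claim\<close>

lemma tendsto_ereal_two_sided:
  fixes f :: "real \<Rightarrow> ereal"
  assumes "\<And>e. 0 < e \<Longrightarrow> \<exists>t0>0. \<forall>t. 0 < t \<and> t < t0 \<longrightarrow> ereal (c - e) < f t \<and> f t < ereal (c + e)"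
  shows "(f \<longlongrightarrow> ereal c) (at_right 0)"
proof (rule order_tendstoI)
  fix a assume "a < ereal c"
  then obtain b where b: "a < ereal b" "b < c" using ereal_dense2 by force
  obtain t0 where "0 < t0" "\<forall>t. 0 < t \<and> t < t0 \<longrightarrow> ereal (c - (c - b)) < f t \<and> f t < ereal (c + (c - b))"
    using assms[of "c - b"] b(2) by auto
  then show "eventually (\<lambda>t. a < f t) (at_right 0)"
    using b(1) by (intro eventually_at_rightI[of 0 t0]) (auto intro: less_trans)
next
  fix a assume "ereal c < a"
  then obtain b where b: "ereal b < a" "c < b" using ereal_dense2 by force
  obtain t0 where "0 < t0" "\<forall>t. 0 < t \<and> t < t0 \<longrightarrow> ereal (c - (b - c)) < f t \<and> f t < ereal (c + (b - c))"
    using assms[of "b - c"] b(2) by auto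
  then show "eventually (\<lambda>t. f t < a) (at_right 0)"
    using b(1) by (intro eventually_at_rightI[of 0 t0]) (auto intro: less_trans)
qed

theorem theorem1p2:
  fixes N :: nat and C :: "nat \<Rightarrow> real" and lam mu :: "route \<Rightarrow> real" and nrm :: "vec \<Rightarrow> real"
  assumes C_pos: "\<forall>i\<in>{1..N}. C i > 0"
    and lam_nonneg: "\<forall>r\<in>routes N. lam r \<ge> 0"
    and mu_pos: "\<forall>r\<in>routes N. mu r > 0"
    and norm: "is_norm_on (active N lam) nrm"
    and erg: "ergodic N C lam mu"
  shows "(\<forall>x\<in>Rplus (active N lam). \<forall>D\<in>Rsub (lface (active N lam) x).
            is_itlim (lowF N C lam mu nrm x D) (ereal (- Lcost N C lam mu x D)) \<and>
            is_itlim (upF N C lam mu nrm x D) (ereal (- Lcost N C lam mu x D)))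
       \<and> (\<forall>L D K. L \<subseteq> active N lam \<longrightarrow> D \<in> Rsub L \<longrightarrow> compact K \<longrightarrow> K \<subseteq> faceset L \<longrightarrow>
            (\<exists>Hl Hu :: vec \<Rightarrow> real \<Rightarrow> ereal.
               (\<forall>x\<in>K. \<forall>\<tau>>0. is_dlim (lowF N C lam mu nrm x D) \<tau> (Hl x \<tau>)
                              \<and> is_dlim (upF N C lam mu nrm x D) \<tau> (Hu x \<tau>)) \<and>
               (\<forall>e>0. \<exists>\<tau>0>0. \<forall>\<tau>. 0 < \<tau> \<and> \<tau> < \<tau>0 \<longrightarrow> (\<forall>x\<in>K.
                  ereal (- Lcost N C lam mu x D - e) < Hl x \<tau> \<and> Hl x \<tau> < ereal (- Lcost N C lam mu x D + e) \<and>
                  ereal (- Lcost N C lam mu x D - e) < Hu x \<tau> \<and> Hu x \<tau> < ereal (- Lcost N C lam mu x D + e)))))"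
    (is "?pointwise \<and> ?uniform")
proof -
  interpret star_network N C lam mu
    by unfold_locales (fact C_pos lam_nonneg mu_pos)+
  have uniform: ?uniform
  proof (intro allI impI)
    fix L D K assume L: "L \<subseteq> R" and D: "D \<in> Rsub L" and K: "compact K" "K \<subseteq> faceset L"
    obtain mn mx where mn: "0 < mn" and KB: "K \<subseteq> base_pts L mn mx" using compact_face[OF K L] by blast
    show "\<exists>Hl Hu :: vec \<Rightarrow> real \<Rightarrow> ereal.
               (\<forall>x\<in>K. \<forall>\<tau>>0. is_dlim (lowF N C lam mu nrm x D) \<tau> (Hl x \<tau>)
                              \<and> is_dlim (upF N C lam mu nrm x D) \<tau> (Hu x \<tau>)) \<and>
               (\<forall>e>0. \<exists>\<tau>0>0. \<forall>\<tau>. 0 < \<tau> \<and> \<tau> < \<tau>0 \<longrightarrow> (\<forall>x\<in>K.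
                  ereal (- Lcost N C lam mu x D - e) < Hl x \<tau> \<and> Hl x \<tau> < ereal (- Lcost N C lam mu x D + e) \<and>
                  ereal (- Lcost N C lam mu x D - e) < Hu x \<tau> \<and> Hu x \<tau> < ereal (- Lcost N C lam mu x D + e)))"
    proof (rule exI[of _ "low_lim nrm D"], rule exI[of _ "upp_lim nrm D"], intro conjI ballI allI impI)
      fix x and \<tau> :: real assume x: "x \<in> K" and \<tau>: "0 < \<tau>"
      then have xB: "x \<in> base_pts L mn mx" using KB by auto
      show "is_dlim (lowF N C lam mu nrm x D) \<tau> (low_lim nrm D x \<tau>)"
        by (rule is_dlim_low[OF norm L D mn xB \<tau>])
      show "is_dlim (upF N C lam mu nrm x D) \<tau> (upp_lim nrm D x \<tau>)"
        by (rule is_dlim_upp[OF norm L D mn xB \<tau>])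
    next
      fix e :: real assume "0 < e"
      from uniform_limits[OF norm L D mn erg this, of mx]
      obtain \<tau>0 where \<tau>0: "0 < \<tau>0" "\<And>\<tau> x. 0 < \<tau> \<Longrightarrow> \<tau> < \<tau>0 \<Longrightarrow> x \<in> base_pts L mn mx \<Longrightarrow>
        ereal (- face_cost L D x - e) < low_lim nrm D x \<tau> \<and> low_lim nrm D x \<tau> < ereal (- face_cost L D x + e) \<and>
        ereal (- face_cost L D x - e) < upp_lim nrm D x \<tau> \<and> upp_lim nrm D x \<tau> < ereal (- face_cost L D x + e)"
        by blast
      have cost: "Lcost N C lam mu x D = face_cost L D x" if "x \<in> K" for x
        using Lcost_eq[OF norm L D mn] KB that by blast
      show "\<exists>\<tau>0>0. \<forall>\<tau>. 0 < \<tau> \<and> \<tau> < \<tau>0 \<longrightarrow> (\<forall>x\<in>K.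
        ereal (- Lcost N C lam mu x D - e) < low_lim nrm D x \<tau> \<and> low_lim nrm D x \<tau> < ereal (- Lcost N C lam mu x D + e) \<and>
        ereal (- Lcost N C lam mu x D - e) < upp_lim nrm D x \<tau> \<and> upp_lim nrm D x \<tau> < ereal (- Lcost N C lam mu x D + e))"
      proof (intro exI[of _ \<tau>0] conjI allI impI ballI)
        fix \<tau> x assume t: "0 < \<tau> \<and> \<tau> < \<tau>0" and x: "x \<in> K"
        have xB: "x \<in> base_pts L mn mx" using KB x by auto
        from \<tau>0(2)[OF _ _ xB, of \<tau>] t
        show "ereal (- Lcost N C lam mu x D - e) < low_lim nrm D x \<tau>"
          "low_lim nrm D x \<tau> < ereal (- Lcost N C lam mu x D + e)"
          "ereal (- Lcost N C lam mu x D - e) < upp_lim nrm D x \<tau>"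
          "upp_lim nrm D x \<tau> < ereal (- Lcost N C lam mu x D + e)"
          unfolding cost[OF x] by auto
      qed (rule \<tau>0(1))
    qed
  qed
  \<comment> \<open>The pointwise claim is the uniform one on the compact set \<open>{x}\<close>,
    which lies in its own face.\<close>
  have ?pointwise
  proof (intro ballI)
    fix x D assume x: "x \<in> Rplus R" and D: "D \<in> Rsub (lface R x)"
    have L: "lface R x \<subseteq> R" by (auto simp: lface_def)
    have K: "compact {x}" "{x} \<subseteq> faceset (lface R x)"
      using x by (auto simp: faceset_def lface_def Rplus_def less_le)
    obtain Hl Hu :: "vec \<Rightarrow> real \<Rightarrow> ereal" where
      dl: "\<And>\<tau>. 0 < \<tau> \<Longrightarrow> is_dlim (lowF N C lam mu nrm x D) \<tau> (Hl x \<tau>)"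
        "\<And>\<tau>. 0 < \<tau> \<Longrightarrow> is_dlim (upF N C lam mu nrm x D) \<tau> (Hu x \<tau>)"
      and lim: "\<And>e. 0 < e \<Longrightarrow> \<exists>\<tau>0>0. \<forall>\<tau>. 0 < \<tau> \<and> \<tau> < \<tau>0 \<longrightarrow>
        ereal (- Lcost N C lam mu x D - e) < Hl x \<tau> \<and> Hl x \<tau> < ereal (- Lcost N C lam mu x D + e) \<and>
        ereal (- Lcost N C lam mu x D - e) < Hu x \<tau> \<and> Hu x \<tau> < ereal (- Lcost N C lam mu x D + e)"
      using uniform[rule_format, OF L D K] by auto
    have "(Hl x \<longlongrightarrow> ereal (- Lcost N C lam mu x D)) (at_right 0)"
      "(Hu x \<longlongrightarrow> ereal (- Lcost N C lam mu x D)) (at_right 0)"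
      using lim by (intro tendsto_ereal_two_sided; meson)+
    then show "is_itlim (lowF N C lam mu nrm x D) (ereal (- Lcost N C lam mu x D)) \<and>
            is_itlim (upF N C lam mu nrm x D) (ereal (- Lcost N C lam mu x D))"
      unfolding is_itlim_def using dl by blast
  qed
  with uniform show ?thesis by blast
qed

end
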